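(* Let $\nu>0$ and let $u\in \mathcal C([0,\infty),\mathcal X^{-1}(\mathbb R^3))\cap L^1_{loc}([0,\infty),\mathcal X^{1}(\mathbb R^3))$ be a global solution of (NS) with viscosity $\nu$. Let $v^0\in\mathcal X^{-1}(\mathbb R^3)$ be divergence free and satisfy $$\|v^0-u(0)\|_{\mathcal X^{-1}}<\frac{\nu}{8}\exp\Big(-\frac{2}{\nu}\int_0^\infty\|\widehat u(s)\|_{L^1}^2\,ds\Big).$$ Then (NS) with initial datum $v^0$ has a global solution $v\in \mathcal C([0,\infty),\mathcal X^{-1})\cap L^1_{loc}([0,\infty),\mathcal X^{1})$, and for all $t\ge0$, $$\|v(t)-u(t)\|_{\mathcal X^{-1}}+\frac{\nu}{2}\int_0^t\|v(s)-u(s)\|_{\mathcal X^{1}}\,ds\le \|v^0-u(0)\|_{\mathcal X^{-1}}\exp\Big(\frac{2}{\nu}\int_0^\infty\|\widehat u(s)\|_{L^1}^2\,ds\Big).$$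
   Context: For $i\in\{-1,0,1\}$, $\mathcal X^{i}(\mathbb R^3)$ denotes the space of tempered distributions $f$ on $\mathbb R^3$ whose Fourier transform $\widehat f(\xi)=\int_{\mathbb R^3}e^{-ix\cdot\xi}f(x)\,dx$ is a locally integrable function with $\|f\|_{\mathcal X^{i}}:=\int_{\mathbb R^3}|\xi|^{i}|\widehat f(\xi)|\,d\xi<\infty$ (so $\|f\|_{\mathcal X^0}=\|\widehat f\|_{L^1}$). Vector fields are measured componentwise. The Navier–Stokes system (NS) with viscosity $\nu>0$ is: $\partial_t u-\nu\Delta u+(u\cdot\nabla)u=-\nabla p$, $\operatorname{div}u=0$ on $\mathbb R^+\times\mathbb R^3$, $u(0)=u^0$; a solution on $[0,T)$ is a divergence-free $u\in \mathcal C([0,T),\mathcal X^{-1})\cap L^1_{loc}([0,T),\mathcal X^{1})$ satisfying the equations in the sense of distributions (equivalently $\partial_t u-\nu\Delta u+\mathbb P\operatorname{div}(u\otimes u)=0$ with $\mathbb P$ the Leray projector) with $u(0)=u^0$; it is global if $T=\infty$. It is known (and may be used) that for every divergence-free $u^0\in\mathcal X^{-1}$ there is a unique maximal such solution on some $[0,T^* )$, $T^*>0$. *)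

theory Defs
  imports "HOL-Analysis.Analysis"
begin

text \<open>Everything is formulated on the Fourier side: a (vector) tempered distribution
  f in X^i is represented by its Fourier transform, a function
  real^3 \<Rightarrow> complex^3 (determined a.e.). Fourier convention:
  hat f(xi) = int e^{-i x.xi} f(x) dx, so hat(fg) = (2 pi)^(-3) hat f * hat g and
  hat(partial_k h) = i xi_k hat h.\<close>

definition Xweight :: "int \<Rightarrow> real^3 \<Rightarrow> real" where
  "Xweight i \<xi> = (if i = -1 then inverse (norm \<xi>) else if i = 1 then norm \<xi> else 1)"

definition Xnorm :: "int \<Rightarrow> (real^3 \<Rightarrow> complex^3) \<Rightarrow> real" where
  "Xnorm i F = (\<integral>\<xi>. Xweight i \<xi> * norm (F \<xi>) \<partial>lborel)"

definition in_X :: "int \<Rightarrow> (real^3 \<Rightarrow> complex^3) \<Rightarrow> bool" where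
  "in_X i F \<longleftrightarrow> F \<in> borel_measurable lborel
     \<and> (\<forall>K. compact K \<longrightarrow> set_integrable lborel K F)
     \<and> integrable lborel (\<lambda>\<xi>. Xweight i \<xi> * norm (F \<xi>))"

definition dotc :: "real^3 \<Rightarrow> complex^3 \<Rightarrow> complex" where
  "dotc \<xi> w = (\<Sum>k\<in>UNIV. complex_of_real (\<xi>$k) * w$k)"

definition div_free :: "(real^3 \<Rightarrow> complex^3) \<Rightarrow> bool" where
  "div_free F \<longleftrightarrow> (AE \<xi> in lborel. dotc \<xi> (F \<xi>) = 0)"

definition leray :: "real^3 \<Rightarrow> complex^3 \<Rightarrow> complex^3" where
  "leray \<xi> w = (if \<xi> = 0 then w else
     (\<chi> j. w$j - dotc \<xi> w / complex_of_real ((norm \<xi>)\<^sup>2) * complex_of_real (\<xi>$j)))"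

text \<open>Fourier transform of (f \<otimes> g)_{jk} = f_j g_k.\<close>
definition conv_tensor :: "(real^3 \<Rightarrow> complex^3) \<Rightarrow> (real^3 \<Rightarrow> complex^3) \<Rightarrow> real^3 \<Rightarrow> 3 \<Rightarrow> 3 \<Rightarrow> complex" where
  "conv_tensor F G \<xi> j k =
     complex_of_real (1 / (2 * pi) ^ 3) * (\<integral>\<eta>. (F (\<xi> - \<eta>))$j * (G \<eta>)$k \<partial>lborel)"

text \<open>Fourier transform of P div (f \<otimes> g).\<close>
definition NSnonlin :: "(real^3 \<Rightarrow> complex^3) \<Rightarrow> (real^3 \<Rightarrow> complex^3) \<Rightarrow> real^3 \<Rightarrow> complex^3" where
  "NSnonlin F G \<xi> = leray \<xi> (\<chi> j. \<i> * (\<Sum>k\<in>UNIV. complex_of_real (\<xi>$k) * conv_tensor F G \<xi> j k))"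

text \<open>Global solution of (NS) with viscosity nu, u t = Fourier transform of u(t):
  u in C([0,inf), X^-1) \<inter> L^1_loc([0,inf), X^1), divergence free, and the equation
  d_t hat u + nu |xi|^2 hat u + hat(P div(u \<otimes> u)) = 0 in the (time-integrated) weak sense.\<close>
definition NS_global_solution :: "real \<Rightarrow> (real \<Rightarrow> real^3 \<Rightarrow> complex^3) \<Rightarrow> bool" where
  "NS_global_solution \<nu> u \<longleftrightarrow>
     (\<forall>t\<ge>0. in_X (-1) (u t))
   \<and> (\<forall>t\<ge>0. ((\<lambda>s. Xnorm (-1) (\<lambda>\<xi>. u s \<xi> - u t \<xi>)) \<longlongrightarrow> 0) (at t within {0..}))
   \<and> (\<lambda>(t, \<xi>). if 0 \<le> t then u t \<xi> else 0) \<in> borel_measurable (lborel \<Otimes>\<^sub>M lborel)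
   \<and> (AE s in lborel. 0 \<le> s \<longrightarrow> in_X 1 (u s))
   \<and> (\<forall>T\<ge>0. set_integrable lborel {0..T} (\<lambda>s. Xnorm 1 (u s)))
   \<and> (\<forall>t\<ge>0. div_free (u t))
   \<and> (\<forall>t\<ge>0. AE \<xi> in lborel.
        set_integrable lborel {0..t} (\<lambda>s. (\<nu> * (norm \<xi>)\<^sup>2) *\<^sub>R u s \<xi> + NSnonlin (u s) (u s) \<xi>)
      \<and> u t \<xi> = u 0 \<xi> - (LINT s:{0..t}|lborel. (\<nu> * (norm \<xi>)\<^sup>2) *\<^sub>R u s \<xi> + NSnonlin (u s) (u s) \<xi>))"

definition L1sq_total :: "(real \<Rightarrow> real^3 \<Rightarrow> complex^3) \<Rightarrow> ennreal" where
  "L1sq_total u = (\<integral>\<^sup>+ s. ennreal ((Xnorm 0 (u s))\<^sup>2) * indicator {0..} s \<partial>lborel)"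

end

theory Submission
  imports Defs
begin

text \<open>
  The perturbation \<open>w = v - u\<close> solves the heat equation with forcing
  \<open>g = P div ((u + w) \<otimes> (u + w)) - P div (u \<otimes> u)\<close>. Taking \<open>g\<close> as the unknown, with \<open>w\<close>
  given by Duhamel's formula, turns the problem into a fixed point equation in \<open>L\<^sup>1\<close> of space-time with
  weight \<open>\<theta>(s) / |\<xi>|\<close>, where \<open>\<theta>(s) = exp (-(2/\<nu>) \<integral>\<^sub>0\<^sup>s \<parallel>u\<parallel>\<^sub>0\<^sup>2)\<close>. The exponential weight produces the
  damping term \<open>(2/\<nu>) \<parallel>u\<parallel>\<^sub>0\<^sup>2 \<parallel>w\<parallel>\<^sub>-\<^sub>1\<close> in the energy, which together with the viscous term
  absorbs the part of \<open>g\<close> linear in \<open>w\<close>; smallness of the datum makes the quadratic part, and hence the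
  whole map, a contraction on all of \<open>[0, \<infinity>)\<close> at once. Inserting the fixed point into the
  energy estimate once more yields the bound with the sharp constant.
\<close>

text \<open>The forcing rather than \<open>w\<close> is the unknown because it lives in a plain
  weighted L1 space over space-time: completeness is a telescoping series, and a candidate only has
  to be measurable. The continuity in time demanded of a solution is recovered afterwards from the
  Duhamel integral, which sees \<open>g\<close> only up to null sets and defines \<open>w\<close> at
  every time. The obstacle to a differential inequality is regularity: the modulus of
  \<open>w\<close> at a fixed frequency need not be differentiable, and the squared norm of
  \<open>u\<close> is merely integrable in time. The energy estimate is therefore proved for a
  single impulse, where it concerns one explicit kernel, and superposed by Tonelli. Norms are kept
  in the extended reals as long as finiteness is open. On the constants: bounding the nonlinearity
  costs 1/8. The ball of forcings has the radius \<delta> of the datum, so energies are at most 2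
  \<delta>. The hypothesis is used as \<delta> E \<le> \<nu>/8, with E the exponential of 2/\<nu>
  times the time integral of the squared norm. Distances then shrink by 7/32, below the required
  1/2.\<close>

section \<open>Integral inequalities and a fixed point theorem in \<open>L\<^sup>1\<close>\<close>

text \<open>Since \<open>H\<close> is only absolutely continuous, the fundamental theorem of calculus is replaced by cutting
  \<open>[a, b]\<close> at equally spaced values of \<open>H\<close> and using \<open>x \<le> e\<^sup>x (1 - e\<^sup>-\<^sup>x)\<close> on each piece.\<close>
lemma nn_integral_exp_primitive_le:
  fixes h :: "real \<Rightarrow> ennreal" and H :: "real \<Rightarrow> real"
  assumes [measurable]: "h \<in> borel_measurable borel" "H \<in> borel_measurable borel"
    and cont: "continuous_on {a..b} H"
    and prim: "\<And>s t. a \<le> s \<Longrightarrow> s \<le> t \<Longrightarrow> t \<le> b \<Longrightarrow> (\<integral>\<^sup>+\<tau>\<in>{s..t}. h \<tau> \<partial>lborel) = ennreal (H t - H s)"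
    and mono: "\<And>s t. a \<le> s \<Longrightarrow> s \<le> t \<Longrightarrow> t \<le> b \<Longrightarrow> H s \<le> H t"
    and ab: "a \<le> b"
  shows "(\<integral>\<^sup>+\<tau>\<in>{a..b}. h \<tau> * ennreal (exp (- H \<tau>)) \<partial>lborel) \<le> ennreal (exp (- H a) - exp (- H b))"
proof -
  have small: "(\<integral>\<^sup>+\<tau>\<in>{s..t}. h \<tau> * ennreal (exp (- H \<tau>)) \<partial>lborel) \<le> ennreal (exp \<epsilon> * (exp (- H s) - exp (- H t)))"
    if "a \<le> s" "s \<le> t" "t \<le> b" "H t - H s \<le> \<epsilon>" for s t \<epsilon>
  proof -
    have "(\<integral>\<^sup>+\<tau>\<in>{s..t}. h \<tau> * ennreal (exp (- H \<tau>)) \<partial>lborel) \<le> (\<integral>\<^sup>+\<tau>. (h \<tau> * indicator {s..t} \<tau>) * ennreal (exp (- H s)) \<partial>lborel)"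
      using that by (intro nn_integral_mono) (auto simp: indicator_def intro!: mult_left_mono ennreal_leI mono)
    also have "\<dots> = ennreal (H t - H s) * ennreal (exp (- H s))"
      using prim[of s t] that by (simp add: nn_integral_multc)
    \<comment> \<open>\<open>ennreal\<close> truncates negative numbers to 0, so \<open>prim\<close>
      alone would not exclude a decreasing \<open>H\<close>; this is why monotonicity is assumed
      separately.\<close>
    also have "\<dots> = ennreal ((H t - H s) * exp (- H s))"
      using mono[of s t] that by (simp add: ennreal_mult)
    also have "\<dots> \<le> ennreal (exp \<epsilon> * (exp (- H s) - exp (- H t)))"
    proof (rule ennreal_leI)
      define x where "x = H t - H s"
      have x: "0 \<le> x" "x \<le> \<epsilon>" using mono[of s t] that by (auto simp: x_def)
      have "x \<le> exp x - 1" using exp_ge_add_one_self[of x] by linarith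
      also have "\<dots> = exp x * (1 - exp (- x))" by (simp add: algebra_simps exp_minus)
      also have "\<dots> \<le> exp \<epsilon> * (1 - exp (- x))" using x by (intro mult_right_mono) auto
      finally have "x * exp (- H s) \<le> (exp \<epsilon> * (1 - exp (- x))) * exp (- H s)"
        by (intro mult_right_mono) auto
      also have "\<dots> = exp \<epsilon> * (exp (- H s) - exp (- H t))"
        by (simp add: x_def algebra_simps flip: exp_add)
      finally show "(H t - H s) * exp (- H s) \<le> exp \<epsilon> * (exp (- H s) - exp (- H t))" by (simp add: x_def)
    qed
    finally show ?thesis .
  qed
  \<comment> \<open>\<open>n\<close> bounds the number of cuts left: each cut sits, by the
    intermediate value theorem, where \<open>H\<close> has grown by exactly \<epsilon>. Every piece
    then loses the same factor exp \<epsilon>, so the total loss does not depend on the number of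
    pieces and disappears as \<epsilon> tends to 0.\<close>
  have pieces: "(\<integral>\<^sup>+\<tau>\<in>{s..b}. h \<tau> * ennreal (exp (- H \<tau>)) \<partial>lborel) \<le> ennreal (exp \<epsilon> * (exp (- H s) - exp (- H b)))"
    if "0 < \<epsilon>" "a \<le> s" "s \<le> b" "H b - H s \<le> real n * \<epsilon>" for n s \<epsilon>
    using that
  proof (induction n arbitrary: s)
    case 0
    then show ?case using small[of s b \<epsilon>] by auto
  next
    case (Suc n)
    show ?case
    proof (cases "H b - H s \<le> \<epsilon>")
      case True then show ?thesis using small[of s b \<epsilon>] Suc.prems by auto
    next
      case False
      have "\<exists>m. s \<le> m \<and> m \<le> b \<and> H m = H s + \<epsilon>"
        by (rule IVT') (use False Suc.prems in \<open>auto intro: continuous_on_subset[OF cont]\<close>)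
      then obtain m where m: "s \<le> m" "m \<le> b" "H m = H s + \<epsilon>" by auto
      have "(\<integral>\<^sup>+\<tau>\<in>{s..b}. h \<tau> * ennreal (exp (- H \<tau>)) \<partial>lborel)
         \<le> (\<integral>\<^sup>+\<tau>. h \<tau> * ennreal (exp (- H \<tau>)) * indicator {s..m} \<tau> + h \<tau> * ennreal (exp (- H \<tau>)) * indicator {m..b} \<tau> \<partial>lborel)"
        by (intro nn_integral_mono) (auto simp: indicator_def)
      also have "\<dots> = (\<integral>\<^sup>+\<tau>\<in>{s..m}. h \<tau> * ennreal (exp (- H \<tau>)) \<partial>lborel) + (\<integral>\<^sup>+\<tau>\<in>{m..b}. h \<tau> * ennreal (exp (- H \<tau>)) \<partial>lborel)"
        by (intro nn_integral_add) auto
      also have "\<dots> \<le> ennreal (exp \<epsilon> * (exp (- H s) - exp (- H m))) + ennreal (exp \<epsilon> * (exp (- H m) - exp (- H b)))"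
        by (intro add_mono small Suc.IH) (use Suc.prems m in \<open>auto simp: algebra_simps\<close>)
      also have "\<dots> = ennreal (exp \<epsilon> * (exp (- H s) - exp (- H b)))"
        using m mono[of s m] mono[of m b] Suc.prems
        by (subst ennreal_plus[symmetric]) (auto simp: algebra_simps)
      finally show ?thesis .
    qed
  qed
  have "(\<integral>\<^sup>+\<tau>\<in>{a..b}. h \<tau> * ennreal (exp (- H \<tau>)) \<partial>lborel) \<le> ennreal (exp (inverse (real (Suc n))) * (exp (- H a) - exp (- H b)))" for n
  proof -
    obtain m where m: "H b - H a \<le> real m * inverse (real (Suc n))"
      using reals_Archimedean3[of "inverse (real (Suc n))"] by (metis inverse_positive_iff_positive less_imp_le of_nat_0_less_iff zero_less_Suc)
    show ?thesis by (rule pieces[OF _ _ _ m]) (use ab in auto)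
  qed
  moreover have "(\<lambda>n. ennreal (exp (inverse (real (Suc n))) * (exp (- H a) - exp (- H b)))) \<longlonglongrightarrow> ennreal (exp 0 * (exp (- H a) - exp (- H b)))"
    by (intro tendsto_ennrealI tendsto_intros LIMSEQ_inverse_real_of_nat)
  ultimately show ?thesis
    by (intro LIMSEQ_le_const[of _ "ennreal (exp (- H a) - exp (- H b))"]) auto
qed

text \<open>Banach's theorem on a closed ball of L1, phrased for functions instead of classes modulo
  null sets, so that the equation holds almost everywhere. The increments of the Picard iteration
  started at 0 have geometrically decreasing norms; their series converges absolutely almost
  everywhere and sums to the fixed point.\<close>

lemma L1_contraction_fixpoint:
  fixes \<Phi> :: "('a \<Rightarrow> 'b::{banach, second_countable_topology}) \<Rightarrow> 'a \<Rightarrow> 'b"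
  assumes meas: "\<And>f. f \<in> borel_measurable M \<Longrightarrow> \<Phi> f \<in> borel_measurable M"
    and ball: "\<And>f. f \<in> borel_measurable M \<Longrightarrow> (\<integral>\<^sup>+x. norm (f x) \<partial>M) \<le> ennreal R \<Longrightarrow> (\<integral>\<^sup>+x. norm (\<Phi> f x) \<partial>M) \<le> ennreal R"
    and contr: "\<And>f f'. f \<in> borel_measurable M \<Longrightarrow> f' \<in> borel_measurable M \<Longrightarrow>
       (\<integral>\<^sup>+x. norm (f x) \<partial>M) \<le> ennreal R \<Longrightarrow> (\<integral>\<^sup>+x. norm (f' x) \<partial>M) \<le> ennreal R \<Longrightarrow>
       (\<integral>\<^sup>+x. norm (\<Phi> f x - \<Phi> f' x) \<partial>M) \<le> ennreal (1/2) * (\<integral>\<^sup>+x. norm (f x - f' x) \<partial>M)"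
    and R: "0 \<le> R"
  shows "\<exists>f \<in> borel_measurable M. (\<integral>\<^sup>+x. norm (f x) \<partial>M) \<le> ennreal R \<and> (AE x in M. \<Phi> f x = f x)"
proof -
  define F where "F n = (\<Phi> ^^ n) (\<lambda>_. 0)" for n
  have F_Suc: "F (Suc n) = \<Phi> (F n)" for n by (simp add: F_def)
  have F_meas [measurable]: "F n \<in> borel_measurable M" for n
    by (induction n) (auto simp: F_def intro: meas)
  have F_ball: "(\<integral>\<^sup>+x. norm (F n x) \<partial>M) \<le> ennreal R" for n
    by (induction n) (simp_all add: F_Suc ball, simp add: F_def)
  define g where "g n x = F (Suc n) x - F n x" for n x
  have [measurable]: "g n \<in> borel_measurable M" for n unfolding g_def[abs_def] by measurable
  have g_le: "(\<integral>\<^sup>+x. norm (g n x) \<partial>M) \<le> ennreal ((1/2)^n * R)" for n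
  proof (induction n)
    case 0 then show ?case using F_ball[of 1] by (simp add: g_def F_def)
  next
    case (Suc n)
    have "(\<integral>\<^sup>+x. norm (g (Suc n) x) \<partial>M) \<le> ennreal (1/2) * (\<integral>\<^sup>+x. norm (g n x) \<partial>M)"
      unfolding g_def F_Suc[of "Suc n"] using contr[OF F_meas F_meas F_ball F_ball, of "Suc n" n] by (simp add: F_Suc)
    also have "\<dots> \<le> ennreal (1/2) * ennreal ((1/2)^n * R)" by (intro mult_left_mono Suc) auto
    also have "\<dots> = ennreal ((1/2)^(Suc n) * R)" using R by (subst ennreal_mult[symmetric]) auto
    finally show ?case .
  qed
  have tail: "(\<integral>\<^sup>+x. (\<Sum>k. ennreal (norm (g (k+n) x))) \<partial>M) \<le> ennreal (2 * R * (1/2)^n)" for n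
  proof -
    have "(\<integral>\<^sup>+x. (\<Sum>k. ennreal (norm (g (k+n) x))) \<partial>M) = (\<Sum>k. \<integral>\<^sup>+x. norm (g (k+n) x) \<partial>M)"
      by (intro nn_integral_suminf) measurable
    also have "\<dots> \<le> (\<Sum>k. ennreal ((1/2)^(k+n) * R))" by (intro suminf_le g_le) auto
    also have "\<dots> = ennreal (\<Sum>k. (1/2)^(k+n) * R)"
      using R by (intro suminf_ennreal2) (auto simp: power_add intro!: summable_mult2)
    also have "(\<Sum>k. (1/2::real)^(k+n) * R) = 2 * R * (1/2)^n"
      using suminf_mult2[of "\<lambda>k. (1/2::real)^k" "(1/2)^n * R"] by (simp add: power_add suminf_geometric mult_ac)
    finally show ?thesis .
  qed
  have sm: "AE x in M. summable (\<lambda>k. norm (g k x))"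
  proof -
    have "AE x in M. (\<Sum>k. ennreal (norm (g k x))) \<noteq> \<infinity>"
      using tail[of 0] by (intro nn_integral_PInf_AE) (auto simp: top_unique)
    then show ?thesis by eventually_elim (auto intro: summable_suminf_not_top)
  qed
  \<comment> \<open>On the null set where the series diverges this is a default value, which no
    integral below sees.\<close>
  define f where "f x = (\<Sum>k. g k x)" for x
  have f_meas [measurable]: "f \<in> borel_measurable M" unfolding f_def[abs_def] by measurable
  have F_sum: "F n x = (\<Sum>k<n. g k x)" for n x
    by (induction n) (simp_all add: g_def, simp add: F_def)
  have diff: "(\<integral>\<^sup>+x. norm (f x - F n x) \<partial>M) \<le> ennreal (2 * R * (1/2)^n)" for n
  proof -
    have "(\<integral>\<^sup>+x. norm (f x - F n x) \<partial>M) \<le> (\<integral>\<^sup>+x. (\<Sum>k. ennreal (norm (g (k+n) x))) \<partial>M)"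
      using sm
    proof (intro nn_integral_mono_AE, eventually_elim)
      fix x assume s: "summable (\<lambda>k. norm (g k x))"
      have s': "summable (\<lambda>k. norm (g (k+n) x))" by (rule summable_ignore_initial_segment[OF s])
      have "f x - F n x = (\<Sum>k. g (k+n) x)"
        using suminf_split_initial_segment[OF summable_norm_cancel[OF s], of n] by (simp add: f_def F_sum)
      then have "norm (f x - F n x) \<le> (\<Sum>k. norm (g (k+n) x))" using summable_norm[OF s'] by simp
      then show "ennreal (norm (f x - F n x)) \<le> (\<Sum>k. ennreal (norm (g (k+n) x)))"
        using s' by (subst suminf_ennreal2) (auto intro: ennreal_leI)
    qed
    then show ?thesis using tail[of n] by (rule order_trans)
  qed
  have half: "(\<lambda>n. (1/2::real)^n) \<longlonglongrightarrow> 0" by (rule LIMSEQ_power_zero) simp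
  have f_ball: "(\<integral>\<^sup>+x. norm (f x) \<partial>M) \<le> ennreal R"
  proof -
    have "(\<integral>\<^sup>+x. norm (f x) \<partial>M) \<le> ennreal (2 * R * (1/2)^n + R)" for n
    proof -
      have "(\<integral>\<^sup>+x. norm (f x) \<partial>M) \<le> (\<integral>\<^sup>+x. ennreal (norm (f x - F n x)) + ennreal (norm (F n x)) \<partial>M)"
        by (intro nn_integral_mono) (simp flip: ennreal_plus, metis diff_add_cancel norm_triangle_ineq)
      also have "\<dots> = (\<integral>\<^sup>+x. norm (f x - F n x) \<partial>M) + (\<integral>\<^sup>+x. norm (F n x) \<partial>M)"
        by (intro nn_integral_add) auto
      also have "\<dots> \<le> ennreal (2 * R * (1/2)^n) + ennreal R" by (intro add_mono diff F_ball)
      also have "\<dots> = ennreal (2 * R * (1/2)^n + R)" using R by simp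
      finally show ?thesis .
    qed
    moreover have "(\<lambda>n. ennreal (2 * R * (1/2)^n + R)) \<longlonglongrightarrow> ennreal (2 * R * 0 + R)"
      by (intro tendsto_ennrealI tendsto_intros half)
    ultimately show ?thesis by (intro LIMSEQ_le_const[of _ "ennreal R"]) auto
  qed
  \<comment> \<open>Compare with \<open>\<Phi> (F n) = F (Suc n)\<close>: the contraction halves the
    distance from \<open>f\<close> to \<open>F n\<close>, and the tail bound at \<open>Suc n\<close>
    supplies the other half of the error.\<close>
  have "(\<integral>\<^sup>+x. norm (\<Phi> f x - f x) \<partial>M) \<le> 0"
  proof -
    have [measurable]: "\<Phi> f \<in> borel_measurable M" by (rule meas) measurable
    have "(\<integral>\<^sup>+x. norm (\<Phi> f x - f x) \<partial>M) \<le> ennreal (2 * R * (1/2)^n)" for n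
    proof -
      have "(\<integral>\<^sup>+x. norm (\<Phi> f x - f x) \<partial>M) \<le> (\<integral>\<^sup>+x. ennreal (norm (\<Phi> f x - \<Phi> (F n) x)) + ennreal (norm (f x - F (Suc n) x)) \<partial>M)"
        by (intro nn_integral_mono) (simp add: F_Suc flip: ennreal_plus, metis dist_norm dist_triangle2)
      also have "\<dots> = (\<integral>\<^sup>+x. norm (\<Phi> f x - \<Phi> (F n) x) \<partial>M) + (\<integral>\<^sup>+x. norm (f x - F (Suc n) x) \<partial>M)"
        using F_meas[of "Suc n"] by (intro nn_integral_add) (auto simp: F_Suc)
      also have "\<dots> \<le> ennreal (1/2) * ennreal (2 * R * (1/2)^n) + ennreal (2 * R * (1/2)^(Suc n))"
        by (intro add_mono diff order_trans[OF contr] mult_left_mono f_ball F_ball) auto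
      also have "\<dots> = ennreal (2 * R * (1/2)^n)" using R by (subst ennreal_mult[symmetric]) (auto simp flip: ennreal_plus)
      finally show ?thesis .
    qed
    moreover have "(\<lambda>n. ennreal (2 * R * (1/2)^n)) \<longlonglongrightarrow> ennreal (2 * R * 0)"
      by (intro tendsto_ennrealI tendsto_intros half)
    ultimately show ?thesis by (intro LIMSEQ_le_const[of _ "0::ennreal"]) auto
  qed
  then have "AE x in M. \<Phi> f x = f x"
    using meas[OF f_meas] by (subst (asm) le_zero_eq, subst (asm) nn_integral_0_iff_AE) auto
  with f_meas f_ball show ?thesis by blast
qed

text \<open>The Bochner integral of a non-integrable function is 0 by convention, so the bound is
  unconditional. Estimates of convolutions and Duhamel integrals can thus precede any proof that
  they converge.\<close>

lemma norm_integral_le_nn_integral: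
  fixes f :: "'a \<Rightarrow> 'b::{banach, second_countable_topology}"
  shows "ennreal (norm (\<integral>x. f x \<partial>M)) \<le> (\<integral>\<^sup>+x. ennreal (norm (f x)) \<partial>M)"
  by (cases "integrable M f") (auto simp: integral_norm_bound_ennreal not_integrable_integral_eq)

section \<open>The norms and the nonlinearity\<close>

lemma borel_measurable_vec_nth [measurable (raw)]:
  fixes f :: "'a \<Rightarrow> 'b::euclidean_space ^ 'n"
  assumes "f \<in> borel_measurable M"
  shows "(\<lambda>x. f x $ i) \<in> borel_measurable M"
  by (rule measurable_compose[OF assms borel_measurable_continuous_onI]) (intro continuous_intros)

lemma borel_measurable_vec_lambda [measurable (raw)]:
  fixes f :: "'a \<Rightarrow> 'n::finite \<Rightarrow> 'b::euclidean_space"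
  assumes "\<And>i. (\<lambda>x. f x i) \<in> borel_measurable M"
  shows "(\<lambda>x. \<chi> i. f x i) \<in> borel_measurable M"
  using assms by (subst borel_measurable_euclidean_space) (auto simp: Basis_vec_def inner_axis)

lemma Xweight_nonneg [simp]: "0 \<le> Xweight i \<xi>"
  by (simp add: Xweight_def)

lemma Xweight_measurable [measurable]: "Xweight i \<in> borel_measurable borel"
  unfolding Xweight_def[abs_def] by measurable

lemma measurable_dotc [measurable (raw)]:
  assumes [measurable]: "f \<in> borel_measurable M" "g \<in> borel_measurable M"
  shows "(\<lambda>x. dotc (f x) (g x)) \<in> borel_measurable M"
  unfolding dotc_def by measurable

lemma measurable_leray [measurable (raw)]:
  assumes [measurable]: "f \<in> borel_measurable M" "g \<in> borel_measurable M"
  shows "(\<lambda>x. leray (f x) (g x)) \<in> borel_measurable M"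
  unfolding leray_def by measurable

lemma measurable_NSnonlin [measurable (raw)]:
  assumes [measurable]: "case_prod F \<in> borel_measurable (M \<Otimes>\<^sub>M lborel)" "case_prod G \<in> borel_measurable (M \<Otimes>\<^sub>M lborel)"
  shows "(\<lambda>(x, \<xi>). NSnonlin (F x) (G x) \<xi>) \<in> borel_measurable (M \<Otimes>\<^sub>M lborel)"
  unfolding NSnonlin_def conv_tensor_def by measurable

lemma measurable_NSnonlin' [measurable (raw)]:
  assumes [measurable]: "F \<in> borel_measurable borel" "G \<in> borel_measurable borel"
  shows "NSnonlin F G \<in> borel_measurable borel"
  unfolding NSnonlin_def[abs_def] conv_tensor_def by measurable

section \<open>The Leray projector at a fixed frequency\<close>

lemma dotc_leray: "\<xi> \<noteq> 0 \<Longrightarrow> dotc \<xi> (leray \<xi> w) = 0"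
proof -
  assume "\<xi> \<noteq> 0"
  then have nz: "complex_of_real ((norm \<xi>)\<^sup>2) \<noteq> 0" by simp
  have sq: "(\<Sum>k\<in>UNIV. complex_of_real (\<xi>$k) * complex_of_real (\<xi>$k)) = complex_of_real ((norm \<xi>)\<^sup>2)"
    by (simp add: power2_norm_eq_inner inner_vec_def flip: of_real_mult of_real_sum)
  have *: "dotc \<xi> (\<chi> j. w$j - c * complex_of_real (\<xi>$j)) = dotc \<xi> w - c *
      (\<Sum>k\<in>UNIV. complex_of_real (\<xi>$k) * complex_of_real (\<xi>$k))" for c
    by (simp add: dotc_def algebra_simps sum_subtractf sum_distrib_left)
  show ?thesis using nz \<open>\<xi> \<noteq> 0\<close> unfolding leray_def by (simp only: if_False * sq) simp
qed

lemma leray_add: "leray \<xi> (v + w) = leray \<xi> v + leray \<xi> w"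
  by (auto simp: leray_def dotc_def vec_eq_iff algebra_simps sum.distrib add_divide_distrib)

lemma norm_dotc_le: "norm (dotc \<xi> w) \<le> norm \<xi> * norm w"
proof -
  have "norm (dotc \<xi> w) \<le> (\<Sum>k\<in>UNIV. \<bar>\<xi>$k\<bar> * \<bar>norm (w$k)\<bar>)"
    unfolding dotc_def by (intro order_trans[OF norm_sum] sum_mono) (simp add: norm_mult)
  also have "\<dots> \<le> L2_set (\<lambda>k. \<xi>$k) UNIV * L2_set (\<lambda>k. norm (w$k)) UNIV" by (rule L2_set_mult_ineq)
  finally show ?thesis by (simp add: norm_vec_def L2_set_def)
qed

text \<open>Triangle inequality for \<open>w\<close> minus its component along \<xi>. Orthogonality
  would give 1; the slack in the final constant 1/8 covers the factor 2.\<close>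

lemma norm_leray_le: "norm (leray \<xi> w) \<le> 2 * norm w"
proof (cases "\<xi> = 0")
  case False
  define c where "c = dotc \<xi> w / complex_of_real ((norm \<xi>)\<^sup>2)"
  define z :: "complex^3" where "z = (\<chi> j. c * complex_of_real (\<xi>$j))"
  have "norm z = norm c * norm \<xi>"
    by (simp add: norm_vec_def z_def norm_mult L2_set_def power_mult_distrib real_sqrt_mult flip: sum_distrib_left)
  also have "\<dots> = norm (dotc \<xi> w) / norm \<xi>"
    using False by (simp add: c_def norm_divide norm_mult power2_eq_square)
  also have "\<dots> \<le> norm w" using norm_dotc_le[of \<xi> w] False by (simp add: field_simps)
  finally have "norm z \<le> norm w" .
  moreover have "leray \<xi> w = w - z" using False by (simp add: leray_def z_def c_def vec_eq_iff)
  ultimately show ?thesis using norm_triangle_ineq4[of w z] by simp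
qed (simp add: leray_def)

section \<open>Convolutions in L1 and the bilinear estimate\<close>

definition abs_conv :: "(real^3 \<Rightarrow> complex^3) \<Rightarrow> (real^3 \<Rightarrow> complex^3) \<Rightarrow> real^3 \<Rightarrow> ennreal" where
  "abs_conv F G \<xi> = (\<integral>\<^sup>+\<eta>. ennreal (norm (F (\<xi> - \<eta>)) * norm (G \<eta>)) \<partial>lborel)"

text \<open>The extended version of \<^const>\<open>Xnorm\<close>: infinite, rather than the junk value 0, on functions that are
  not integrable. The estimates below therefore need no integrability hypotheses.\<close>
definition eXnorm :: "int \<Rightarrow> (real^3 \<Rightarrow> complex^3) \<Rightarrow> ennreal" where
  "eXnorm i F = (\<integral>\<^sup>+\<xi>. ennreal (Xweight i \<xi> * norm (F \<xi>)) \<partial>lborel)"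

lemma eXnorm_0: "eXnorm 0 F = (\<integral>\<^sup>+\<xi>. ennreal (norm (F \<xi>)) \<partial>lborel)"
  by (simp add: eXnorm_def Xweight_def)

lemma measurable_eXnorm [measurable (raw)]:
  assumes [measurable]: "case_prod F \<in> borel_measurable (M \<Otimes>\<^sub>M lborel)"
  shows "(\<lambda>x. eXnorm i (F x)) \<in> borel_measurable M"
  unfolding eXnorm_def by measurable

lemma nn_integral_lborel_minus:
  fixes f :: "'a::euclidean_space \<Rightarrow> ennreal"
  assumes [measurable]: "f \<in> borel_measurable borel"
  shows "(\<integral>\<^sup>+x. f (x - c) \<partial>lborel) = (\<integral>\<^sup>+x. f x \<partial>lborel)"
proof -
  have "(\<integral>\<^sup>+x. f x \<partial>lborel) = (\<integral>\<^sup>+x. f x \<partial>distr lborel borel ((+) (- c)))" by (simp add: lborel_distr_plus)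
  also have "\<dots> = (\<integral>\<^sup>+x. f (x - c) \<partial>lborel)" by (subst nn_integral_distr) auto
  finally show ?thesis by simp
qed

text \<open>Tonelli and translation invariance: for nonnegative functions Young's inequality in L1
  is an equality, also when a norm is infinite.\<close>

lemma nn_integral_abs_conv:
  assumes [measurable]: "F \<in> borel_measurable borel" "G \<in> borel_measurable borel"
  shows "(\<integral>\<^sup>+\<xi>. abs_conv F G \<xi> \<partial>lborel) = eXnorm 0 F * eXnorm 0 G"
proof -
  have "(\<integral>\<^sup>+\<xi>. abs_conv F G \<xi> \<partial>lborel) = (\<integral>\<^sup>+\<eta>. (\<integral>\<^sup>+\<xi>. ennreal (norm (F (\<xi> - \<eta>)) * norm (G \<eta>)) \<partial>lborel) \<partial>lborel)"
    unfolding abs_conv_def by (rule lborel_pair.Fubini'[symmetric]) measurable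
  also have "\<dots> = (\<integral>\<^sup>+\<eta>. eXnorm 0 F * ennreal (norm (G \<eta>)) \<partial>lborel)"
  proof (rule nn_integral_cong)
    fix \<eta>
    have "(\<integral>\<^sup>+\<xi>. ennreal (norm (F (\<xi> - \<eta>)) * norm (G \<eta>)) \<partial>lborel) = (\<integral>\<^sup>+\<xi>. ennreal (norm (F (\<xi> - \<eta>))) \<partial>lborel) * ennreal (norm (G \<eta>))"
      by (simp add: ennreal_mult nn_integral_multc)
    then show "(\<integral>\<^sup>+\<xi>. ennreal (norm (F (\<xi> - \<eta>)) * norm (G \<eta>)) \<partial>lborel) = eXnorm 0 F * ennreal (norm (G \<eta>))"
      using nn_integral_lborel_minus[of "\<lambda>\<xi>. ennreal (norm (F \<xi>))" \<eta>] by (simp add: eXnorm_0)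
  qed
  also have "\<dots> = eXnorm 0 F * eXnorm 0 G" by (simp add: nn_integral_cmult eXnorm_0)
  finally show ?thesis .
qed

lemma measurable_abs_conv [measurable]:
  assumes [measurable]: "F \<in> borel_measurable borel" "G \<in> borel_measurable borel"
  shows "abs_conv F G \<in> borel_measurable borel"
  unfolding abs_conv_def[abs_def] by measurable

lemma AE_abs_conv_finite:
  assumes [measurable]: "F \<in> borel_measurable borel" "G \<in> borel_measurable borel"
    and "eXnorm 0 F < \<infinity>" "eXnorm 0 G < \<infinity>"
  shows "AE \<xi> in lborel. abs_conv F G \<xi> < \<infinity>"
proof -
  have "AE \<xi> in lborel. abs_conv F G \<xi> \<noteq> \<infinity>"
    using assms(3,4) by (intro nn_integral_PInf_AE) (auto simp: nn_integral_abs_conv ennreal_mult_eq_top_iff)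
  then show ?thesis by (simp add: less_top)
qed

lemma conv_integrable:
  assumes [measurable]: "F \<in> borel_measurable borel" "G \<in> borel_measurable borel"
    and "abs_conv F G \<xi> < \<infinity>"
  shows "integrable lborel (\<lambda>\<eta>. F (\<xi> - \<eta>) $ j * G \<eta> $ k)"
proof (rule integrableI_bounded)
  have "(\<integral>\<^sup>+\<eta>. ennreal (norm (F (\<xi> - \<eta>) $ j * G \<eta> $ k)) \<partial>lborel) \<le> abs_conv F G \<xi>"
    unfolding abs_conv_def by (intro nn_integral_mono ennreal_leI) (auto simp: norm_mult intro!: mult_mono Finite_Cartesian_Product.norm_nth_le)
  then show "(\<integral>\<^sup>+\<eta>. ennreal (norm (F (\<xi> - \<eta>) $ j * G \<eta> $ k)) \<partial>lborel) < \<infinity>" using assms(3) by (rule order.strict_trans1)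
qed measurable

text \<open>Bilinearity is not unconditional: a divergent convolution integral is 0 by convention,
  and such defaults do not add up. It is therefore asserted one frequency at a time, where the
  absolute convolutions are finite.\<close>

lemma NSnonlin_add_left:
  assumes [measurable]: "F \<in> borel_measurable borel" "F' \<in> borel_measurable borel" "G \<in> borel_measurable borel"
    and "abs_conv F G \<xi> < \<infinity>" "abs_conv F' G \<xi> < \<infinity>"
  shows "NSnonlin (\<lambda>\<xi>. F \<xi> + F' \<xi>) G \<xi> = NSnonlin F G \<xi> + NSnonlin F' G \<xi>"
proof -
  have "conv_tensor (\<lambda>\<xi>. F \<xi> + F' \<xi>) G \<xi> j k = conv_tensor F G \<xi> j k + conv_tensor F' G \<xi> j k" for j k
    using conv_integrable[OF assms(1,3,4), of j k] conv_integrable[OF assms(2,3,5), of j k]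
    by (simp add: conv_tensor_def algebra_simps Bochner_Integration.integral_add)
  then show ?thesis unfolding NSnonlin_def leray_add[symmetric]
    by (intro arg_cong[where f="leray \<xi>"]) (simp add: vec_eq_iff algebra_simps sum.distrib)
qed

lemma NSnonlin_add_right:
  assumes [measurable]: "F \<in> borel_measurable borel" "G \<in> borel_measurable borel" "G' \<in> borel_measurable borel"
    and "abs_conv F G \<xi> < \<infinity>" "abs_conv F G' \<xi> < \<infinity>"
  shows "NSnonlin F (\<lambda>\<xi>. G \<xi> + G' \<xi>) \<xi> = NSnonlin F G \<xi> + NSnonlin F G' \<xi>"
proof -
  have "conv_tensor F (\<lambda>\<xi>. G \<xi> + G' \<xi>) \<xi> j k = conv_tensor F G \<xi> j k + conv_tensor F G' \<xi> j k" for j k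
    using conv_integrable[OF assms(1,2,4), of j k] conv_integrable[OF assms(1,3,5), of j k]
    by (simp add: conv_tensor_def algebra_simps Bochner_Integration.integral_add)
  then show ?thesis unfolding NSnonlin_def leray_add[symmetric]
    by (intro arg_cong[where f="leray \<xi>"]) (simp add: vec_eq_iff algebra_simps sum.distrib)
qed

lemma norm_vec_le_sum:
  fixes x :: "'b::real_normed_vector ^ 'n"
  shows "norm x \<le> (\<Sum>i\<in>UNIV. norm (x $ i))"
  unfolding norm_vec_def by (rule L2_set_le_sum) simp

text \<open>The constant is a crude bound for \<open>2 \<cdot> 9 / (2 \<pi>)\<^sup>3\<close>: 2 from the Leray projector, 9 from the number of
  tensor entries.\<close>
lemma norm_NSnonlin_le: "ennreal (norm (NSnonlin F G \<xi>)) \<le> ennreal (1/8 * norm \<xi>) * abs_conv F G \<xi>"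
proof (cases "abs_conv F G \<xi> = \<infinity>")
  \<comment> \<open>Here the right side is infinite except at \<xi> = 0, where 0 times infinity is
    0; at that frequency the factor \<xi> of the divergence kills the left side too.\<close>
  case True
  then show ?thesis
  proof (cases "\<xi> = 0")
    case True
    then have "NSnonlin F G \<xi> = 0" by (simp add: NSnonlin_def leray_def vec_eq_iff)
    then show ?thesis by simp
  qed (simp add: ennreal_mult_top)
next
  case False
  then obtain c where c: "abs_conv F G \<xi> = ennreal c" "0 \<le> c" by (cases "abs_conv F G \<xi>") auto
  \<comment> \<open>216 = 6^3 is a lower bound for \<open>(2 * pi) ^ 3\<close>. With nine entries
    and the Leray factor 2 the total is 18/216 = 1/12, below 1/8.\<close>
  have T: "norm (conv_tensor F G \<xi> j k) \<le> c / 216" for j k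
  proof -
    have "ennreal (norm (\<integral>\<eta>. F (\<xi> - \<eta>) $ j * G \<eta> $ k \<partial>lborel)) \<le> (\<integral>\<^sup>+\<eta>. ennreal (norm (F (\<xi> - \<eta>) $ j * G \<eta> $ k)) \<partial>lborel)"
      by (rule norm_integral_le_nn_integral)
    also have "\<dots> \<le> abs_conv F G \<xi>"
      unfolding abs_conv_def by (intro nn_integral_mono ennreal_leI) (auto simp: norm_mult intro!: mult_mono Finite_Cartesian_Product.norm_nth_le)
    finally have *: "norm (\<integral>\<eta>. F (\<xi> - \<eta>) $ j * G \<eta> $ k \<partial>lborel) \<le> c" using c by simp
    have "216 \<le> (2 * pi) ^ 3" using power_mono[of 6 "2 * pi" 3] pi_gt3 by simp
    then have "1 / (2 * pi) ^ 3 \<le> 1 / 216" by (intro divide_left_mono) auto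
    then have "1 / (2 * pi) ^ 3 * norm (\<integral>\<eta>. F (\<xi> - \<eta>) $ j * G \<eta> $ k \<partial>lborel) \<le> 1 / 216 * c"
      using * by (intro mult_mono) auto
    then show ?thesis unfolding conv_tensor_def norm_mult norm_of_real by simp
  qed
  have "norm (NSnonlin F G \<xi>) \<le> 2 * norm (\<chi> j. \<i> * (\<Sum>k\<in>UNIV. complex_of_real (\<xi>$k) * conv_tensor F G \<xi> j k) :: complex^3)"
    unfolding NSnonlin_def by (rule norm_leray_le)
  also have "\<dots> \<le> 2 * (\<Sum>j\<in>(UNIV::3 set). \<Sum>k\<in>(UNIV::3 set). norm \<xi> * (c / 216))"
  proof -
    have "norm (\<i> * (\<Sum>k\<in>UNIV. complex_of_real (\<xi>$k) * conv_tensor F G \<xi> j k)) \<le> (\<Sum>k\<in>(UNIV::3 set). norm \<xi> * (c / 216))" for j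
      unfolding norm_mult norm_ii mult_1
      by (intro order_trans[OF norm_sum] sum_mono) (auto simp only: norm_mult norm_of_real intro!: mult_mono T component_le_norm_cart norm_ge_zero)
    then show ?thesis by (intro mult_left_mono order_trans[OF norm_vec_le_sum] sum_mono) simp_all
  qed
  also have "\<dots> \<le> 1/8 * norm \<xi> * c" using c by simp
  finally show ?thesis using c by (simp flip: ennreal_mult)
qed

text \<open>The divergence costs a factor |\<xi>|, exactly what the weight of X^{-1} gives back;
  what remains is the L1 norm of a convolution. The weights cancel up to an inequality only, as
  \<open>inverse 0 = 0\<close>.\<close>

lemma eXnorm_NSnonlin_le:
  assumes [measurable]: "F \<in> borel_measurable borel" "G \<in> borel_measurable borel"
  shows "eXnorm (-1) (NSnonlin F G) \<le> ennreal (1/8) * (eXnorm 0 F * eXnorm 0 G)"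
proof -
  have "eXnorm (-1) (NSnonlin F G) \<le> (\<integral>\<^sup>+\<xi>. ennreal (1/8) * abs_conv F G \<xi> \<partial>lborel)"
    unfolding eXnorm_def
  proof (rule nn_integral_mono)
    fix \<xi> :: "real^3"
    have "ennreal (Xweight (-1) \<xi> * norm (NSnonlin F G \<xi>)) = ennreal (inverse (norm \<xi>)) * ennreal (norm (NSnonlin F G \<xi>))"
      by (simp add: Xweight_def ennreal_mult)
    also have "\<dots> \<le> ennreal (inverse (norm \<xi>)) * (ennreal (1/8 * norm \<xi>) * abs_conv F G \<xi>)"
      by (intro mult_left_mono norm_NSnonlin_le) auto
    also have "\<dots> = ennreal (inverse (norm \<xi>) * (1/8 * norm \<xi>)) * abs_conv F G \<xi>"
      by (subst ennreal_mult) (auto simp: mult_ac)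
    also have "\<dots> \<le> ennreal (1/8) * abs_conv F G \<xi>"
      by (intro mult_right_mono ennreal_leI) (auto simp: field_simps)
    finally show "ennreal (Xweight (-1) \<xi> * norm (NSnonlin F G \<xi>)) \<le> ennreal (1/8) * abs_conv F G \<xi>" .
  qed
  also have "\<dots> = ennreal (1/8) * (eXnorm 0 F * eXnorm 0 G)"
    by (simp add: nn_integral_cmult nn_integral_abs_conv)
  finally show ?thesis .
qed

lemma eXnorm_add_le:
  assumes [measurable]: "F \<in> borel_measurable borel" "G \<in> borel_measurable borel"
  shows "eXnorm i (\<lambda>\<xi>. F \<xi> + G \<xi>) \<le> eXnorm i F + eXnorm i G"
proof -
  have "eXnorm i (\<lambda>\<xi>. F \<xi> + G \<xi>) \<le> (\<integral>\<^sup>+\<xi>. ennreal (Xweight i \<xi> * norm (F \<xi>)) + ennreal (Xweight i \<xi> * norm (G \<xi>)) \<partial>lborel)"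
    unfolding eXnorm_def
    by (intro nn_integral_mono) (auto simp flip: ennreal_plus distrib_left intro!: ennreal_leI mult_left_mono norm_triangle_ineq)
  also have "\<dots> = eXnorm i F + eXnorm i G" unfolding eXnorm_def by (intro nn_integral_add) auto
  finally show ?thesis .
qed

text \<open>Expansion of the increment of the square from F to F + D. Finite X^0 norms make all
  convolutions involved converge off a common null set.\<close>

lemma AE_NSnonlin_square_add:
  assumes [measurable]: "F \<in> borel_measurable borel" "D \<in> borel_measurable borel"
    and fin: "eXnorm 0 F < \<infinity>" "eXnorm 0 D < \<infinity>"
  shows "AE \<xi> in lborel. NSnonlin (\<lambda>\<xi>. F \<xi> + D \<xi>) (\<lambda>\<xi>. F \<xi> + D \<xi>) \<xi> - NSnonlin F F \<xi>
     = NSnonlin F D \<xi> + (NSnonlin D F \<xi> + NSnonlin D D \<xi>)"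
proof -
  have FD [measurable]: "(\<lambda>\<xi>. F \<xi> + D \<xi>) \<in> borel_measurable borel" by measurable
  have fin2: "eXnorm 0 (\<lambda>\<xi>. F \<xi> + D \<xi>) < \<infinity>"
    using eXnorm_add_le[OF assms(1,2), of 0] fin by (auto simp: less_top[symmetric] top_unique)
  \<comment> \<open>Additivity is applied in one slot after the other, so convolutions with the
    unexpanded sum F + D have to be finite as well.\<close>
  show ?thesis
    using AE_abs_conv_finite[OF assms(1,1) fin(1,1)] AE_abs_conv_finite[OF assms(1,2) fin(1,2)]
      AE_abs_conv_finite[OF assms(2,1) fin(2,1)] AE_abs_conv_finite[OF assms(2,2) fin(2,2)]
      AE_abs_conv_finite[OF assms(1) FD fin(1) fin2] AE_abs_conv_finite[OF assms(2) FD fin(2) fin2]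
    by eventually_elim (simp add: NSnonlin_add_left NSnonlin_add_right)
qed

lemma eXnorm_cong_AE: "AE \<xi> in lborel. F \<xi> = G \<xi> \<Longrightarrow> eXnorm i F = eXnorm i G"
  unfolding eXnorm_def by (intro nn_integral_cong_AE) (auto elim: eventually_mono)

lemma eXnorm_NSnonlin_square_diff_le:
  assumes [measurable]: "F \<in> borel_measurable borel" "D \<in> borel_measurable borel"
    and fin: "eXnorm 0 F < \<infinity>" "eXnorm 0 D < \<infinity>"
  shows "eXnorm (-1) (\<lambda>\<xi>. NSnonlin (\<lambda>\<xi>. F \<xi> + D \<xi>) (\<lambda>\<xi>. F \<xi> + D \<xi>) \<xi> - NSnonlin F F \<xi>)
     \<le> ennreal (1/8) * (eXnorm 0 D * (2 * eXnorm 0 F + eXnorm 0 D))"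
proof -
  have "eXnorm (-1) (\<lambda>\<xi>. NSnonlin (\<lambda>\<xi>. F \<xi> + D \<xi>) (\<lambda>\<xi>. F \<xi> + D \<xi>) \<xi> - NSnonlin F F \<xi>)
     = eXnorm (-1) (\<lambda>\<xi>. NSnonlin F D \<xi> + (NSnonlin D F \<xi> + NSnonlin D D \<xi>))"
    by (intro eXnorm_cong_AE AE_NSnonlin_square_add assms)
  also have "\<dots> \<le> eXnorm (-1) (NSnonlin F D) + (eXnorm (-1) (NSnonlin D F) + eXnorm (-1) (NSnonlin D D))"
    by (intro order_trans[OF eXnorm_add_le] add_mono order_refl) auto
  also have "\<dots> \<le> ennreal (1/8) * (eXnorm 0 F * eXnorm 0 D) + (ennreal (1/8) * (eXnorm 0 D * eXnorm 0 F) + ennreal (1/8) * (eXnorm 0 D * eXnorm 0 D))"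
    by (intro add_mono eXnorm_NSnonlin_le) auto
  also have "\<dots> = ennreal (1/8) * (eXnorm 0 D * (2 * eXnorm 0 F + eXnorm 0 D))"
    by (simp only: distrib_left distrib_right mult_2 mult_ac add_ac)
  finally show ?thesis .
qed

text \<open>Integrate \<open>2 \<le> |\<xi>| / |\<eta>| + |\<eta>| / |\<xi>|\<close> against \<open>|F(\<xi>)| |G(\<eta>)|\<close>.\<close>
lemma eXnorm_interpolation_product:
  assumes [measurable]: "F \<in> borel_measurable borel" "G \<in> borel_measurable borel"
  shows "2 * (eXnorm 0 F * eXnorm 0 G) \<le> eXnorm 1 F * eXnorm (-1) G + eXnorm (-1) F * eXnorm 1 G"
proof -
  have prod: "eXnorm i F * eXnorm j G = (\<integral>\<^sup>+\<xi>. (\<integral>\<^sup>+\<eta>. ennreal (Xweight i \<xi> * norm (F \<xi>)) * ennreal (Xweight j \<eta> * norm (G \<eta>)) \<partial>lborel) \<partial>lborel)" for i j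
    unfolding eXnorm_def by (simp add: nn_integral_cmult nn_integral_multc)
  have "2 * (eXnorm 0 F * eXnorm 0 G) = (\<integral>\<^sup>+\<xi>. (\<integral>\<^sup>+\<eta>. 2 * (ennreal (Xweight 0 \<xi> * norm (F \<xi>)) * ennreal (Xweight 0 \<eta> * norm (G \<eta>))) \<partial>lborel) \<partial>lborel)"
    unfolding prod by (simp add: nn_integral_cmult)
  \<comment> \<open>The origin is removed in both variables: at 0 both weights on the right are 0,
    since \<open>inverse 0 = 0\<close>, and the pointwise inequality would fail.\<close>
  also have "\<dots> \<le> (\<integral>\<^sup>+\<xi>. (\<integral>\<^sup>+\<eta>. ennreal (Xweight 1 \<xi> * norm (F \<xi>)) * ennreal (Xweight (-1) \<eta> * norm (G \<eta>))
      + ennreal (Xweight (-1) \<xi> * norm (F \<xi>)) * ennreal (Xweight 1 \<eta> * norm (G \<eta>)) \<partial>lborel) \<partial>lborel)"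
    using AE_lborel_singleton[of 0]
  proof (intro nn_integral_mono_AE, eventually_elim)
    fix \<xi> :: "real^3" assume xi: "\<xi> \<noteq> 0"
    show "(\<integral>\<^sup>+\<eta>. 2 * (ennreal (Xweight 0 \<xi> * norm (F \<xi>)) * ennreal (Xweight 0 \<eta> * norm (G \<eta>))) \<partial>lborel)
      \<le> (\<integral>\<^sup>+\<eta>. ennreal (Xweight 1 \<xi> * norm (F \<xi>)) * ennreal (Xweight (-1) \<eta> * norm (G \<eta>))
      + ennreal (Xweight (-1) \<xi> * norm (F \<xi>)) * ennreal (Xweight 1 \<eta> * norm (G \<eta>)) \<partial>lborel)"
      using AE_lborel_singleton[of 0]
    proof (intro nn_integral_mono_AE, eventually_elim)
      fix \<eta> :: "real^3" assume eta: "\<eta> \<noteq> 0"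
      define p q where "p = norm \<xi>" and "q = norm \<eta>"
      have pq: "p > 0" "q > 0" using xi eta by (auto simp: p_def q_def)
      have "2 \<le> p * inverse q + inverse p * q"
        using pq sum_squares_bound[of p q] by (simp add: field_simps power2_eq_square)
      then have "2 * (norm (F \<xi>) * norm (G \<eta>)) \<le> (p * inverse q + inverse p * q) * (norm (F \<xi>) * norm (G \<eta>))"
        by (intro mult_right_mono) auto
      also have "\<dots> = p * norm (F \<xi>) * (inverse q * norm (G \<eta>)) + inverse p * norm (F \<xi>) * (q * norm (G \<eta>))"
        by (simp add: algebra_simps)
      finally have *: "2 * (norm (F \<xi>) * norm (G \<eta>)) \<le> p * norm (F \<xi>) * (inverse q * norm (G \<eta>)) + inverse p * norm (F \<xi>) * (q * norm (G \<eta>))" .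
      have "2 * (ennreal (Xweight 0 \<xi> * norm (F \<xi>)) * ennreal (Xweight 0 \<eta> * norm (G \<eta>))) = ennreal (2 * (norm (F \<xi>) * norm (G \<eta>)))"
        by (simp add: Xweight_def ennreal_mult)
      also have "\<dots> \<le> ennreal (p * norm (F \<xi>) * (inverse q * norm (G \<eta>)) + inverse p * norm (F \<xi>) * (q * norm (G \<eta>)))"
        by (rule ennreal_leI[OF *])
      also have "\<dots> = ennreal (Xweight 1 \<xi> * norm (F \<xi>)) * ennreal (Xweight (-1) \<eta> * norm (G \<eta>))
      + ennreal (Xweight (-1) \<xi> * norm (F \<xi>)) * ennreal (Xweight 1 \<eta> * norm (G \<eta>))"
        using pq by (simp add: Xweight_def flip: ennreal_mult ennreal_plus p_def q_def)
      finally show "2 * (ennreal (Xweight 0 \<xi> * norm (F \<xi>)) * ennreal (Xweight 0 \<eta> * norm (G \<eta>)))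
         \<le> ennreal (Xweight 1 \<xi> * norm (F \<xi>)) * ennreal (Xweight (-1) \<eta> * norm (G \<eta>))
      + ennreal (Xweight (-1) \<xi> * norm (F \<xi>)) * ennreal (Xweight 1 \<eta> * norm (G \<eta>))" .
    qed
  qed
  also have "\<dots> = eXnorm 1 F * eXnorm (-1) G + eXnorm (-1) F * eXnorm 1 G"
    unfolding prod by (simp add: nn_integral_add)
  finally show ?thesis .
qed

text \<open>Pointwise this is 2a \<le> (2/\<nu>) a^2 / |\<xi>| + (\<nu>/2) |\<xi>|, an
  arithmetic-geometric mean inequality. With a the X^0 norm of \<open>u\<close> at a given time, the
  first term matches the damping created by \<theta> and the second is half of the viscous
  dissipation; this is where the rate 2/\<nu> in the exponential comes from.\<close>

lemma eXnorm_interpolation_linear: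
  assumes [measurable]: "F \<in> borel_measurable borel" and "0 \<le> a" "0 < \<nu>"
  shows "ennreal (2 * a) * eXnorm 0 F \<le> ennreal (2 / \<nu> * a\<^sup>2) * eXnorm (-1) F + ennreal (\<nu> / 2) * eXnorm 1 F"
proof -
  have "ennreal (2 * a) * eXnorm 0 F = (\<integral>\<^sup>+\<xi>. ennreal (2 * a * norm (F \<xi>)) \<partial>lborel)"
    using assms(2) by (simp add: eXnorm_0 nn_integral_cmult ennreal_mult)
  also have "\<dots> \<le> (\<integral>\<^sup>+\<xi>. ennreal (2 / \<nu> * a\<^sup>2) * ennreal (Xweight (-1) \<xi> * norm (F \<xi>)) + ennreal (\<nu> / 2) * ennreal (Xweight 1 \<xi> * norm (F \<xi>)) \<partial>lborel)"
    using AE_lborel_singleton[of 0]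
  proof (intro nn_integral_mono_AE, eventually_elim)
    fix \<xi> :: "real^3" assume "\<xi> \<noteq> 0"
    define p where "p = norm \<xi>"
    have p: "p > 0" using \<open>\<xi> \<noteq> 0\<close> by (simp add: p_def)
    have "2 * a \<le> 2 / \<nu> * a\<^sup>2 * inverse p + \<nu> / 2 * p"
      using p assms sum_squares_bound[of "2 * a" "\<nu> * p"] by (simp add: field_simps power2_eq_square)
    then have "2 * a * norm (F \<xi>) \<le> (2 / \<nu> * a\<^sup>2 * inverse p + \<nu> / 2 * p) * norm (F \<xi>)"
      by (intro mult_right_mono) auto
    then have "ennreal (2 * a * norm (F \<xi>)) \<le> ennreal (2 / \<nu> * a\<^sup>2 * (inverse p * norm (F \<xi>)) + \<nu> / 2 * (p * norm (F \<xi>)))"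
      by (intro ennreal_leI) (simp add: algebra_simps)
    also have "\<dots> = ennreal (2 / \<nu> * a\<^sup>2) * ennreal (Xweight (-1) \<xi> * norm (F \<xi>)) + ennreal (\<nu> / 2) * ennreal (Xweight 1 \<xi> * norm (F \<xi>))"
      using p assms by (simp add: Xweight_def p_def ennreal_mult[symmetric] ennreal_plus[symmetric] del: ennreal_plus)
    finally show "ennreal (2 * a * norm (F \<xi>)) \<le> ennreal (2 / \<nu> * a\<^sup>2) * ennreal (Xweight (-1) \<xi> * norm (F \<xi>)) + ennreal (\<nu> / 2) * ennreal (Xweight 1 \<xi> * norm (F \<xi>))" .
  qed
  also have "\<dots> = ennreal (2 / \<nu> * a\<^sup>2) * eXnorm (-1) F + ennreal (\<nu> / 2) * eXnorm 1 F"
    unfolding eXnorm_def by (simp add: nn_integral_add nn_integral_cmult)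
  finally show ?thesis .
qed

section \<open>The weighted energy estimate\<close>

text \<open>The solution of y' + k y = f with y(0) = b, in extended reals. At frequency \<xi>, with
  k = \<nu> |\<xi>|^2, it dominates the modulus of the perturbation.\<close>

definition duhamel_majorant :: "real \<Rightarrow> ennreal \<Rightarrow> (real \<Rightarrow> ennreal) \<Rightarrow> real \<Rightarrow> ennreal" where
  "duhamel_majorant k b f t = ennreal (exp (- k * t)) * b + (\<integral>\<^sup>+s\<in>{0..t}. ennreal (exp (- k * (t - s))) * f s \<partial>lborel)"

lemma indicator_atLeastAtMost_measurable [measurable (raw)]:
  fixes f g h :: "'a \<Rightarrow> real"
  assumes [measurable]: "f \<in> borel_measurable M" "g \<in> borel_measurable M" "h \<in> borel_measurable M"
  shows "(\<lambda>x. indicator {f x..g x} (h x) :: 'b::{real_normed_vector, zero_neq_one}) \<in> borel_measurable M"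
    and "(\<lambda>x. indicator {f x..g x} (h x) :: ennreal) \<in> borel_measurable M"
  unfolding indicator_def of_bool_def atLeastAtMost_iff by measurable

lemma measurable_duhamel_majorant [measurable (raw)]:
  assumes [measurable]: "k \<in> borel_measurable M" "b \<in> borel_measurable M" "t \<in> borel_measurable M"
    "case_prod f \<in> borel_measurable (M \<Otimes>\<^sub>M lborel)"
  shows "(\<lambda>x. duhamel_majorant (k x) (b x) (f x) (t x)) \<in> borel_measurable M"
  unfolding duhamel_majorant_def by measurable

lemma nn_integral_linear_combination:
  assumes [measurable]: "A \<in> borel_measurable M" "B \<in> borel_measurable M"
  shows "(\<integral>\<^sup>+x. c * (p * A x + q * B x) \<partial>M) = c * (p * (\<integral>\<^sup>+x. A x \<partial>M) + q * (\<integral>\<^sup>+x. B x \<partial>M))"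
  by (simp add: nn_integral_cmult nn_integral_add)

section \<open>The exponential weight attached to a square-integrable function of time\<close>

locale time_weight =
  fixes \<nu> :: real and a :: "real \<Rightarrow> real"
  assumes \<nu>_pos: "0 < \<nu>"
    and a_meas [measurable]: "a \<in> borel_measurable borel"
    and a_sq: "integrable lborel (\<lambda>s. (a s)\<^sup>2)"
begin

text \<open>Starting at minus infinity makes \<open>U\<close> monotone on the whole line, without a
  case split on the sign of t. The estimates use only its increments and the bounds 0 and
  \<open>Uinf\<close>.\<close>

definition U :: "real \<Rightarrow> real" where "U t = (LINT s:{..t}|lborel. (a s)\<^sup>2)"

definition Uinf :: real where "Uinf = (LINT s|lborel. (a s)\<^sup>2)"

definition \<theta> :: "real \<Rightarrow> real" where "\<theta> t = exp (- (2 / \<nu> * U t))"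

lemma a_sq_set: "A \<in> sets borel \<Longrightarrow> set_integrable lborel A (\<lambda>s. (a s)\<^sup>2)"
  using integrable_mult_indicator[OF _ a_sq] by (simp add: set_integrable_def)

lemma U_diff: "s \<le> t \<Longrightarrow> U t - U s = (LINT r:{s..t}|lborel. (a r)\<^sup>2)"
proof -
  assume "s \<le> t"
  then have "U t = U s + (LINT r:{s<..t}|lborel. (a r)\<^sup>2)"
    unfolding U_def by (subst set_integral_Un[symmetric]) (auto intro!: a_sq_set simp: ivl_disj_un)
  moreover have "(LINT r:{s<..t}|lborel. (a r)\<^sup>2) = (LINT r:{s..t}|lborel. (a r)\<^sup>2)"
    unfolding set_lebesgue_integral_def
    by (intro integral_cong_AE) (use AE_lborel_singleton[of s] in \<open>auto elim!: eventually_mono simp: indicator_def\<close>)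
  ultimately show ?thesis by simp
qed

lemma U_diff_nn: "s \<le> t \<Longrightarrow> (\<integral>\<^sup>+r\<in>{s..t}. ennreal ((a r)\<^sup>2) \<partial>lborel) = ennreal (U t - U s)"
proof -
  assume "s \<le> t"
  have "(\<integral>\<^sup>+r\<in>{s..t}. ennreal ((a r)\<^sup>2) \<partial>lborel) = (\<integral>\<^sup>+r. ennreal (indicator {s..t} r *\<^sub>R (a r)\<^sup>2) \<partial>lborel)"
    by (intro nn_integral_cong) (auto simp: indicator_def)
  also have "\<dots> = ennreal (LINT r:{s..t}|lborel. (a r)\<^sup>2)"
    unfolding set_lebesgue_integral_def
    by (intro nn_integral_eq_integral) (use a_sq_set[of "{s..t}"] in \<open>auto simp: set_integrable_def\<close>)
  finally show ?thesis using U_diff[OF \<open>s \<le> t\<close>] by simp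
qed

lemma U_mono: "s \<le> t \<Longrightarrow> U s \<le> U t"
  unfolding U_def set_lebesgue_integral_def
  by (intro integral_mono) (use a_sq_set[of "{..s}"] a_sq_set[of "{..t}"] in \<open>auto simp: set_integrable_def indicator_def\<close>)

lemma U_le: "U t \<le> Uinf"
  unfolding U_def Uinf_def set_lebesgue_integral_def
  by (intro integral_mono a_sq) (use a_sq_set[of "{..t}"] in \<open>auto simp: set_integrable_def indicator_def\<close>)

lemma U_nonneg: "0 \<le> U t" unfolding U_def set_lebesgue_integral_def by (rule integral_nonneg_AE) auto

lemma U_continuous: "continuous_on {s..t} U"
proof -
  have "continuous_on {s..t} (\<lambda>x. integral {s..x} (\<lambda>r. (a r)\<^sup>2))"
    by (intro indefinite_integral_continuous_1 set_borel_integral_eq_integral(1) a_sq_set) auto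
  then have "continuous_on {s..t} (\<lambda>x. U s + integral {s..x} (\<lambda>r. (a r)\<^sup>2))" by (intro continuous_intros)
  moreover have "U s + integral {s..x} (\<lambda>r. (a r)\<^sup>2) = U x" if "x \<in> {s..t}" for x
    using U_diff[of s x] set_borel_integral_eq_integral(2)[OF a_sq_set, of "{s..x}"] that by simp
  ultimately show ?thesis by (rule continuous_on_eq)
qed

lemma U_meas [measurable]: "U \<in> borel_measurable borel"
  by (intro borel_measurable_mono) (auto simp: mono_def U_mono)

lemma \<theta>_meas [measurable]: "\<theta> \<in> borel_measurable borel"
  unfolding \<theta>_def[abs_def] by measurable

lemma \<theta>_pos: "0 < \<theta> t" by (simp add: \<theta>_def)
lemma \<theta>_le_1: "\<theta> t \<le> 1" using U_nonneg \<nu>_pos by (simp add: \<theta>_def)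
lemma \<theta>_ge: "exp (- (2 / \<nu> * Uinf)) \<le> \<theta> t"
  using U_le[of t] \<nu>_pos by (simp add: \<theta>_def divide_right_mono)
text \<open>Removing the weight from an estimate costs this exponential, which is the one in the
  final bound.\<close>

lemma \<theta>_inverse_le: "1 \<le> exp (2 / \<nu> * Uinf) * \<theta> t"
  using mult_left_mono[OF \<theta>_ge[of t], of "exp (2 / \<nu> * Uinf)"] by (simp flip: exp_add)

text \<open>Energy balance of a unit impulse released at time s. Formally
  \<open>\<theta> \<tau> * exp (- k * (\<tau> - s))\<close> has the derivative -(k + (2/\<nu>) a^2)
  times itself, so the left side would equal \<theta>(s). As \<open>U\<close> need not be
  differentiable everywhere, the integral is instead bounded by
  \<open>nn_integral_exp_primitive_le\<close>, with the total exponent \<open>H\<close> as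
  primitive.\<close>

lemma kernel_le:
  assumes "0 \<le> k" "s \<le> t"
  shows "ennreal (\<theta> t * exp (- k * (t - s))) +
     (\<integral>\<^sup>+\<tau>\<in>{s..t}. ennreal ((k + 2 / \<nu> * (a \<tau>)\<^sup>2) * (\<theta> \<tau> * exp (- k * (\<tau> - s)))) \<partial>lborel) \<le> ennreal (\<theta> s)"
proof -
  define H where "H \<tau> = k * \<tau> + 2 / \<nu> * U \<tau>" for \<tau>
  define h where "h \<tau> = ennreal (k + 2 / \<nu> * (a \<tau>)\<^sup>2)" for \<tau>
  have [measurable]: "H \<in> borel_measurable borel" "h \<in> borel_measurable borel"
    unfolding H_def[abs_def] h_def[abs_def] by measurable
  have expH: "exp (k * s) * exp (- H \<tau>) = \<theta> \<tau> * exp (- k * (\<tau> - s))" for \<tau>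
    by (simp add: H_def \<theta>_def algebra_simps flip: exp_add)
  have mono: "H x \<le> H y" if "x \<le> y" for x y
    using U_mono[OF that] assms \<nu>_pos that by (auto simp: H_def intro!: add_mono mult_left_mono divide_right_mono)
  have "(\<integral>\<^sup>+\<tau>\<in>{s..t}. h \<tau> * ennreal (exp (- H \<tau>)) \<partial>lborel) \<le> ennreal (exp (- H s) - exp (- H t))"
  proof (rule nn_integral_exp_primitive_le)
    show "continuous_on {s..t} H" unfolding H_def[abs_def] by (intro continuous_intros U_continuous)
    fix x y :: real assume "x \<le> y"
    have "(\<integral>\<^sup>+\<tau>\<in>{x..y}. h \<tau> \<partial>lborel) = (\<integral>\<^sup>+\<tau>. ennreal k * indicator {x..y} \<tau> + ennreal (2 / \<nu>) * (ennreal ((a \<tau>)\<^sup>2) * indicator {x..y} \<tau>) \<partial>lborel)"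
      using assms \<nu>_pos by (intro nn_integral_cong) (auto simp: h_def indicator_def ennreal_mult[symmetric] simp flip: ennreal_plus)
    also have "\<dots> = ennreal k * ennreal (y - x) + ennreal (2 / \<nu>) * ennreal (U y - U x)"
      using \<open>x \<le> y\<close> by (subst nn_integral_add) (auto simp: nn_integral_cmult U_diff_nn)
    also have "\<dots> = ennreal (H y - H x)"
    proof -
      have "H y - H x = k * (y - x) + 2 / \<nu> * (U y - U x)" by (simp add: H_def algebra_simps diff_divide_distrib)
      then show ?thesis using \<open>x \<le> y\<close> U_mono[of x y] assms \<nu>_pos by (simp add: ennreal_mult[symmetric])
    qed
    finally show "(\<integral>\<^sup>+\<tau>\<in>{x..y}. h \<tau> \<partial>lborel) = ennreal (H y - H x)" .
  qed (use mono assms in auto)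
  then have "ennreal (exp (k * s)) * (\<integral>\<^sup>+\<tau>\<in>{s..t}. h \<tau> * ennreal (exp (- H \<tau>)) \<partial>lborel) \<le> ennreal (exp (k * s)) * ennreal (exp (- H s) - exp (- H t))"
    by (intro mult_left_mono) auto
  also have "\<dots> = ennreal (\<theta> s - \<theta> t * exp (- k * (t - s)))"
    using mono[OF assms(2)] expH[of s] expH[of t] by (simp add: right_diff_distrib flip: ennreal_mult)
  also have "ennreal (exp (k * s)) * (\<integral>\<^sup>+\<tau>\<in>{s..t}. h \<tau> * ennreal (exp (- H \<tau>)) \<partial>lborel) =
    (\<integral>\<^sup>+\<tau>. ennreal (exp (k * s)) * (h \<tau> * ennreal (exp (- H \<tau>)) * indicator {s..t} \<tau>) \<partial>lborel)"
    by (rule nn_integral_cmult[symmetric]) measurable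
  also have "\<dots> = (\<integral>\<^sup>+\<tau>\<in>{s..t}. ennreal ((k + 2 / \<nu> * (a \<tau>)\<^sup>2) * (\<theta> \<tau> * exp (- k * (\<tau> - s)))) \<partial>lborel)"
  proof (rule nn_integral_cong)
    fix \<tau>
    have "0 \<le> k + 2 / \<nu> * (a \<tau>)\<^sup>2" using assms(1) \<nu>_pos by simp
    then have "ennreal (exp (k * s)) * (h \<tau> * ennreal (exp (- H \<tau>))) = ennreal ((k + 2 / \<nu> * (a \<tau>)\<^sup>2) * (exp (k * s) * exp (- H \<tau>)))"
      unfolding h_def by (simp only: ennreal_mult[symmetric] exp_ge_zero mult_nonneg_nonneg mult_ac)
    then show "ennreal (exp (k * s)) * (h \<tau> * ennreal (exp (- H \<tau>)) * indicator {s..t} \<tau>)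
      = ennreal ((k + 2 / \<nu> * (a \<tau>)\<^sup>2) * (\<theta> \<tau> * exp (- k * (\<tau> - s)))) * indicator {s..t} \<tau>"
      unfolding expH by (simp add: mult.assoc[symmetric])
  qed
  finally have *: "(\<integral>\<^sup>+\<tau>\<in>{s..t}. ennreal ((k + 2 / \<nu> * (a \<tau>)\<^sup>2) * (\<theta> \<tau> * exp (- k * (\<tau> - s)))) \<partial>lborel)
      \<le> ennreal (\<theta> s - \<theta> t * exp (- k * (t - s)))" .
  have "\<theta> t * exp (- k * (t - s)) \<le> \<theta> s"
  proof -
    have "exp (k * s) * exp (- H t) \<le> exp (k * s) * exp (- H s)" using mono[OF assms(2)] by (intro mult_left_mono) auto
    then show ?thesis unfolding expH by simp
  qed
  then have "ennreal (\<theta> t * exp (- k * (t - s))) + ennreal (\<theta> s - \<theta> t * exp (- k * (t - s))) = ennreal (\<theta> s)"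
    using \<theta>_pos[of t] by (subst ennreal_plus[symmetric]) auto
  then show ?thesis using add_left_mono[OF *, of "ennreal (\<theta> t * exp (- k * (t - s)))"] by simp
qed

text \<open>The majorant superposes impulses: \<open>b\<close> released at time 0 and
  \<open>f s\<close> at each time s. Tonelli on the triangle s \<le> \<tau> \<le> t reduces the
  claim to \<open>kernel_le\<close> for every impulse; \<theta>(0) \<le> 1 disposes of the weight on
  the datum. No Gronwall argument is involved.\<close>

lemma duhamel_majorant_energy:
  assumes [measurable]: "f \<in> borel_measurable borel" and k: "0 \<le> k" and t: "0 \<le> t"
  shows "ennreal (\<theta> t) * duhamel_majorant k b f t + (\<integral>\<^sup>+\<tau>\<in>{0..t}. ennreal ((k + 2 / \<nu> * (a \<tau>)\<^sup>2) * \<theta> \<tau>) * duhamel_majorant k b f \<tau> \<partial>lborel)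
    \<le> b + (\<integral>\<^sup>+s\<in>{0..t}. ennreal (\<theta> s) * f s \<partial>lborel)"
proof -
  define K where "K s \<tau> = ennreal ((k + 2 / \<nu> * (a \<tau>)\<^sup>2) * (\<theta> \<tau> * exp (- k * (\<tau> - s))))" for s \<tau>
  have [measurable]: "case_prod K \<in> borel_measurable (lborel \<Otimes>\<^sub>M lborel)" "K s \<in> borel_measurable borel" for s
    unfolding K_def[abs_def] by measurable
  have coeff: "0 \<le> k + 2 / \<nu> * (a \<tau>)\<^sup>2" for \<tau> using k \<nu>_pos by simp
  have K_eq: "ennreal ((k + 2 / \<nu> * (a \<tau>)\<^sup>2) * \<theta> \<tau>) * ennreal (exp (- k * (\<tau> - s))) = K s \<tau>" for s \<tau>
    unfolding K_def using coeff[of \<tau>] \<theta>_pos[of \<tau>] by (simp add: ennreal_mult[symmetric] mult_ac)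
  have "(\<integral>\<^sup>+\<tau>\<in>{0..t}. ennreal ((k + 2 / \<nu> * (a \<tau>)\<^sup>2) * \<theta> \<tau>) * duhamel_majorant k b f \<tau> \<partial>lborel)
     = (\<integral>\<^sup>+\<tau>. K 0 \<tau> * indicator {0..t} \<tau> * b + (\<integral>\<^sup>+s. K s \<tau> * f s * indicator {0..\<tau>} s * indicator {0..t} \<tau> \<partial>lborel) \<partial>lborel)"
  proof (rule nn_integral_cong)
    fix \<tau>
    have "ennreal ((k + 2 / \<nu> * (a \<tau>)\<^sup>2) * \<theta> \<tau>) * (\<integral>\<^sup>+s\<in>{0..\<tau>}. ennreal (exp (- k * (\<tau> - s))) * f s \<partial>lborel)
       = (\<integral>\<^sup>+s. K s \<tau> * f s * indicator {0..\<tau>} s \<partial>lborel)"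
      by (subst nn_integral_cmult[symmetric]) (auto simp: K_eq[symmetric] mult_ac intro!: nn_integral_cong)
    moreover have "(\<integral>\<^sup>+s. K s \<tau> * f s * indicator {0..\<tau>} s * indicator {0..t} \<tau> \<partial>lborel) = (\<integral>\<^sup>+s. K s \<tau> * f s * indicator {0..\<tau>} s \<partial>lborel) * indicator {0..t} \<tau>"
      by (rule nn_integral_multc) measurable
    ultimately show "ennreal ((k + 2 / \<nu> * (a \<tau>)\<^sup>2) * \<theta> \<tau>) * duhamel_majorant k b f \<tau> * indicator {0..t} \<tau>
      = K 0 \<tau> * indicator {0..t} \<tau> * b + (\<integral>\<^sup>+s. K s \<tau> * f s * indicator {0..\<tau>} s * indicator {0..t} \<tau> \<partial>lborel)"
      using K_eq[of \<tau> 0] by (simp add: duhamel_majorant_def distrib_left distrib_right mult_ac)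
  qed
  also have "\<dots> = (\<integral>\<^sup>+\<tau>\<in>{0..t}. K 0 \<tau> \<partial>lborel) * b + (\<integral>\<^sup>+\<tau>. (\<integral>\<^sup>+s. K s \<tau> * f s * indicator {0..\<tau>} s * indicator {0..t} \<tau> \<partial>lborel) \<partial>lborel)"
    by (subst nn_integral_add) (auto simp: nn_integral_multc)
  also have "(\<integral>\<^sup>+\<tau>. (\<integral>\<^sup>+s. K s \<tau> * f s * indicator {0..\<tau>} s * indicator {0..t} \<tau> \<partial>lborel) \<partial>lborel)
     = (\<integral>\<^sup>+s. (\<integral>\<^sup>+\<tau>. K s \<tau> * f s * indicator {0..\<tau>} s * indicator {0..t} \<tau> \<partial>lborel) \<partial>lborel)"
    by (rule lborel_pair.Fubini') measurable
  also have "\<dots> = (\<integral>\<^sup>+s. (\<integral>\<^sup>+\<tau>\<in>{s..t}. K s \<tau> \<partial>lborel) * (f s * indicator {0..t} s) \<partial>lborel)"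
  proof (rule nn_integral_cong)
    \<comment> \<open>For fixed s the triangle leaves \<tau> between s and t, the lifetime of the
      impulse.\<close>
    fix s
    have "(\<integral>\<^sup>+\<tau>. K s \<tau> * f s * indicator {0..\<tau>} s * indicator {0..t} \<tau> \<partial>lborel) = (\<integral>\<^sup>+\<tau>. K s \<tau> * indicator {s..t} \<tau> * (f s * indicator {0..t} s) \<partial>lborel)"
      by (intro nn_integral_cong) (auto simp: indicator_def)
    then show "(\<integral>\<^sup>+\<tau>. K s \<tau> * f s * indicator {0..\<tau>} s * indicator {0..t} \<tau> \<partial>lborel) = (\<integral>\<^sup>+\<tau>\<in>{s..t}. K s \<tau> \<partial>lborel) * (f s * indicator {0..t} s)"
      by (simp add: nn_integral_multc)
  qed
  finally have I: "(\<integral>\<^sup>+\<tau>\<in>{0..t}. ennreal ((k + 2 / \<nu> * (a \<tau>)\<^sup>2) * \<theta> \<tau>) * duhamel_majorant k b f \<tau> \<partial>lborel)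
     = (\<integral>\<^sup>+\<tau>\<in>{0..t}. K 0 \<tau> \<partial>lborel) * b + (\<integral>\<^sup>+s. (\<integral>\<^sup>+\<tau>\<in>{s..t}. K s \<tau> \<partial>lborel) * (f s * indicator {0..t} s) \<partial>lborel)" .
  have e: "ennreal (\<theta> t) * ennreal (exp (- k * (t - s))) = ennreal (\<theta> t * exp (- k * (t - s)))" for s
    using \<theta>_pos[of t] by (simp add: ennreal_mult)
  have J: "ennreal (\<theta> t) * duhamel_majorant k b f t = ennreal (\<theta> t * exp (- k * (t - 0))) * b +
      (\<integral>\<^sup>+s. ennreal (\<theta> t * exp (- k * (t - s))) * (f s * indicator {0..t} s) \<partial>lborel)"
    unfolding duhamel_majorant_def distrib_left e[symmetric]
    by (subst nn_integral_cmult[symmetric]) (auto simp: mult_ac intro!: nn_integral_cong arg_cong2[where f="(+)"])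
  have "ennreal (\<theta> t) * duhamel_majorant k b f t + (\<integral>\<^sup>+\<tau>\<in>{0..t}. ennreal ((k + 2 / \<nu> * (a \<tau>)\<^sup>2) * \<theta> \<tau>) * duhamel_majorant k b f \<tau> \<partial>lborel)
    = (ennreal (\<theta> t * exp (- k * (t - 0))) + (\<integral>\<^sup>+\<tau>\<in>{0..t}. K 0 \<tau> \<partial>lborel)) * b
     + (\<integral>\<^sup>+s. (ennreal (\<theta> t * exp (- k * (t - s))) + (\<integral>\<^sup>+\<tau>\<in>{s..t}. K s \<tau> \<partial>lborel)) * (f s * indicator {0..t} s) \<partial>lborel)"
  proof -
    have "(\<integral>\<^sup>+s. (ennreal (\<theta> t * exp (- k * (t - s))) + (\<integral>\<^sup>+\<tau>\<in>{s..t}. K s \<tau> \<partial>lborel)) * (f s * indicator {0..t} s) \<partial>lborel)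
      = (\<integral>\<^sup>+s. ennreal (\<theta> t * exp (- k * (t - s))) * (f s * indicator {0..t} s) \<partial>lborel)
      + (\<integral>\<^sup>+s. (\<integral>\<^sup>+\<tau>\<in>{s..t}. K s \<tau> \<partial>lborel) * (f s * indicator {0..t} s) \<partial>lborel)"
      unfolding distrib_right by (rule nn_integral_add) measurable
    then show ?thesis by (simp only: I J) (simp only: distrib_right add_ac)
  qed
  also have "\<dots> \<le> ennreal (\<theta> 0) * b + (\<integral>\<^sup>+s. ennreal (\<theta> s) * (f s * indicator {0..t} s) \<partial>lborel)"
  proof (rule add_mono[OF mult_right_mono nn_integral_mono])
    show "ennreal (\<theta> t * exp (- k * (t - 0))) + (\<integral>\<^sup>+\<tau>\<in>{0..t}. K 0 \<tau> \<partial>lborel) \<le> ennreal (\<theta> 0)"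
      unfolding K_def by (rule kernel_le[OF k t])
    fix s
    show "(ennreal (\<theta> t * exp (- k * (t - s))) + (\<integral>\<^sup>+\<tau>\<in>{s..t}. K s \<tau> \<partial>lborel)) * (f s * indicator {0..t} s) \<le> ennreal (\<theta> s) * (f s * indicator {0..t} s)"
      using kernel_le[OF k, of s t] unfolding K_def by (cases "s \<in> {0..t}") (auto intro!: mult_right_mono)
  qed auto
  also have "\<dots> \<le> 1 * b + (\<integral>\<^sup>+s\<in>{0..t}. ennreal (\<theta> s) * f s \<partial>lborel)"
    using \<theta>_le_1[of 0] by (intro add_mono mult_right_mono) (auto simp: mult_ac intro!: nn_integral_mono)
  finally show ?thesis by simp
qed

text \<open>The weighted X^{-1} norm at time t plus what has been lost until then: to viscosity, and
  to the decay of the weight, whose formal derivative is -(2/\<nu>) a^2 \<theta>.\<close>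

definition energy_of :: "(real \<Rightarrow> real^3 \<Rightarrow> complex^3) \<Rightarrow> real \<Rightarrow> ennreal" where
  "energy_of w t = ennreal (\<theta> t) * eXnorm (-1) (w t) +
    (\<integral>\<^sup>+\<tau>\<in>{0..t}. ennreal (\<theta> \<tau>) * (ennreal \<nu> * eXnorm 1 (w \<tau>) + ennreal (2 / \<nu> * (a \<tau>)\<^sup>2) * eXnorm (-1) (w \<tau>)) \<partial>lborel)"

text \<open>Integrate \<open>duhamel_majorant_energy\<close> over the frequencies against 1/|\<xi>|;
  as |\<xi>|^2 / |\<xi>| = |\<xi>|, the viscous term becomes the X^1 norm. Assuming domination by a
  majorant instead of Duhamel's formula lets one estimate serve both a solution and a difference of
  two solutions.\<close>

lemma energy:
  assumes [measurable]: "w0 \<in> borel_measurable borel" "case_prod g \<in> borel_measurable (lborel \<Otimes>\<^sub>M lborel)"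
    and le: "\<And>t. 0 \<le> t \<Longrightarrow> AE \<xi> in lborel. ennreal (norm (w t \<xi>)) \<le> duhamel_majorant (\<nu> * (norm \<xi>)\<^sup>2) (ennreal (norm (w0 \<xi>))) (\<lambda>s. ennreal (norm (g s \<xi>))) t"
    and t: "0 \<le> t"
  shows "energy_of w t \<le> eXnorm (-1) w0 + (\<integral>\<^sup>+s\<in>{0..t}. ennreal (\<theta> s) * eXnorm (-1) (g s) \<partial>lborel)"
proof -
  define Y where "Y t \<xi> = duhamel_majorant (\<nu> * (norm \<xi>)\<^sup>2) (ennreal (norm (w0 \<xi>))) (\<lambda>s. ennreal (norm (g s \<xi>))) t" for t and \<xi> :: "real^3"
  have [measurable]: "case_prod Y \<in> borel_measurable (lborel \<Otimes>\<^sub>M lborel)"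
    unfolding Y_def[abs_def] by measurable
  have [measurable]: "Y t \<in> borel_measurable borel" for t unfolding Y_def[abs_def] by measurable
  define eY where "eY i t = (\<integral>\<^sup>+\<xi>. ennreal (Xweight i \<xi>) * Y t \<xi> \<partial>lborel)" for i t
  have [measurable]: "eY i \<in> borel_measurable borel" for i unfolding eY_def[abs_def] by measurable
  have eXnorm_le: "eXnorm i (w t) \<le> eY i t" if "0 \<le> t" for i t
    unfolding eXnorm_def eY_def using le[OF that]
    by (intro nn_integral_mono_AE) (auto elim!: eventually_mono simp: ennreal_mult Y_def intro!: mult_left_mono)
  have "energy_of w t \<le> ennreal (\<theta> t) * eY (-1) t +
    (\<integral>\<^sup>+\<tau>\<in>{0..t}. ennreal (\<theta> \<tau>) * (ennreal \<nu> * eY 1 \<tau> + ennreal (2 / \<nu> * (a \<tau>)\<^sup>2) * eY (-1) \<tau>) \<partial>lborel)"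
    unfolding energy_of_def using t
    by (intro add_mono mult_left_mono eXnorm_le nn_integral_mono) (auto simp: indicator_def intro!: add_mono mult_left_mono eXnorm_le)
  also have "(\<integral>\<^sup>+\<tau>\<in>{0..t}. ennreal (\<theta> \<tau>) * (ennreal \<nu> * eY 1 \<tau> + ennreal (2 / \<nu> * (a \<tau>)\<^sup>2) * eY (-1) \<tau>) \<partial>lborel)
    = (\<integral>\<^sup>+\<tau>. (\<integral>\<^sup>+\<xi>. ennreal (Xweight (-1) \<xi>) * (ennreal ((\<nu> * (norm \<xi>)\<^sup>2 + 2 / \<nu> * (a \<tau>)\<^sup>2) * \<theta> \<tau>) * Y \<tau> \<xi> * indicator {0..t} \<tau>) \<partial>lborel) \<partial>lborel)"
  proof (rule nn_integral_cong)
    fix \<tau>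
    have w: "ennreal (Xweight (-1) \<xi>) * (ennreal ((\<nu> * (norm \<xi>)\<^sup>2 + 2 / \<nu> * (a \<tau>)\<^sup>2) * \<theta> \<tau>) * Y \<tau> \<xi> * indicator {0..t} \<tau>)
       = ennreal (\<theta> \<tau>) * indicator {0..t} \<tau> * (ennreal \<nu> * (ennreal (Xweight 1 \<xi>) * Y \<tau> \<xi>) + ennreal (2 / \<nu> * (a \<tau>)\<^sup>2) * (ennreal (Xweight (-1) \<xi>) * Y \<tau> \<xi>))" for \<xi>
    proof -
      have "Xweight (-1) \<xi> * ((\<nu> * (norm \<xi>)\<^sup>2 + 2 / \<nu> * (a \<tau>)\<^sup>2) * \<theta> \<tau>) = \<theta> \<tau> * (\<nu> * Xweight 1 \<xi> + 2 / \<nu> * (a \<tau>)\<^sup>2 * Xweight (-1) \<xi>)"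
        by (cases "\<xi> = 0") (auto simp: Xweight_def field_simps power2_eq_square)
      then have "ennreal (Xweight (-1) \<xi>) * ennreal ((\<nu> * (norm \<xi>)\<^sup>2 + 2 / \<nu> * (a \<tau>)\<^sup>2) * \<theta> \<tau>)
        = ennreal (\<theta> \<tau>) * (ennreal \<nu> * ennreal (Xweight 1 \<xi>) + ennreal (2 / \<nu> * (a \<tau>)\<^sup>2) * ennreal (Xweight (-1) \<xi>))"
        using \<nu>_pos \<theta>_pos[of \<tau>] by (simp add: ennreal_mult[symmetric] ennreal_plus[symmetric] del: ennreal_plus)
      then have "ennreal (Xweight (-1) \<xi>) * ennreal ((\<nu> * (norm \<xi>)\<^sup>2 + 2 / \<nu> * (a \<tau>)\<^sup>2) * \<theta> \<tau>) * (Y \<tau> \<xi> * indicator {0..t} \<tau>)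
        = ennreal (\<theta> \<tau>) * (ennreal \<nu> * ennreal (Xweight 1 \<xi>) + ennreal (2 / \<nu> * (a \<tau>)\<^sup>2) * ennreal (Xweight (-1) \<xi>)) * (Y \<tau> \<xi> * indicator {0..t} \<tau>)"
        by simp
      then show ?thesis by (simp only: distrib_left distrib_right mult_ac)
    qed
    show "ennreal (\<theta> \<tau>) * (ennreal \<nu> * eY 1 \<tau> + ennreal (2 / \<nu> * (a \<tau>)\<^sup>2) * eY (-1) \<tau>) * indicator {0..t} \<tau>
      = (\<integral>\<^sup>+\<xi>. ennreal (Xweight (-1) \<xi>) * (ennreal ((\<nu> * (norm \<xi>)\<^sup>2 + 2 / \<nu> * (a \<tau>)\<^sup>2) * \<theta> \<tau>) * Y \<tau> \<xi> * indicator {0..t} \<tau>) \<partial>lborel)"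
      unfolding w eY_def by (subst nn_integral_linear_combination) (measurable, simp only: mult_ac)
  qed
  also have "\<dots> = (\<integral>\<^sup>+\<xi>. (\<integral>\<^sup>+\<tau>. ennreal (Xweight (-1) \<xi>) * (ennreal ((\<nu> * (norm \<xi>)\<^sup>2 + 2 / \<nu> * (a \<tau>)\<^sup>2) * \<theta> \<tau>) * Y \<tau> \<xi> * indicator {0..t} \<tau>) \<partial>lborel) \<partial>lborel)"
    by (rule lborel_pair.Fubini'[symmetric]) measurable
  also have "ennreal (\<theta> t) * eY (-1) t + \<dots> = (\<integral>\<^sup>+\<xi>. ennreal (Xweight (-1) \<xi>) * (ennreal (\<theta> t) * Y t \<xi> +
      (\<integral>\<^sup>+\<tau>\<in>{0..t}. ennreal ((\<nu> * (norm \<xi>)\<^sup>2 + 2 / \<nu> * (a \<tau>)\<^sup>2) * \<theta> \<tau>) * Y \<tau> \<xi> \<partial>lborel)) \<partial>lborel)"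
  proof -
    have "ennreal (\<theta> t) * eY (-1) t = (\<integral>\<^sup>+\<xi>. ennreal (Xweight (-1) \<xi>) * (ennreal (\<theta> t) * Y t \<xi>) \<partial>lborel)"
      unfolding eY_def by (subst nn_integral_cmult[symmetric]) (measurable, simp only: mult_ac)
    moreover have "(\<integral>\<^sup>+\<tau>. ennreal (Xweight (-1) \<xi>) * (ennreal ((\<nu> * (norm \<xi>)\<^sup>2 + 2 / \<nu> * (a \<tau>)\<^sup>2) * \<theta> \<tau>) * Y \<tau> \<xi> * indicator {0..t} \<tau>) \<partial>lborel)
      = ennreal (Xweight (-1) \<xi>) * (\<integral>\<^sup>+\<tau>\<in>{0..t}. ennreal ((\<nu> * (norm \<xi>)\<^sup>2 + 2 / \<nu> * (a \<tau>)\<^sup>2) * \<theta> \<tau>) * Y \<tau> \<xi> \<partial>lborel)" for \<xi>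
      by (rule nn_integral_cmult) measurable
    ultimately show ?thesis unfolding distrib_left by (subst nn_integral_add) simp_all
  qed
  also have "\<dots> \<le> (\<integral>\<^sup>+\<xi>. ennreal (Xweight (-1) \<xi>) * (ennreal (norm (w0 \<xi>)) + (\<integral>\<^sup>+s\<in>{0..t}. ennreal (\<theta> s) * ennreal (norm (g s \<xi>)) \<partial>lborel)) \<partial>lborel)"
    unfolding Y_def using \<nu>_pos by (intro nn_integral_mono mult_left_mono duhamel_majorant_energy t) auto
  also have "\<dots> = eXnorm (-1) w0 + (\<integral>\<^sup>+\<xi>. (\<integral>\<^sup>+s. ennreal (Xweight (-1) \<xi>) * (ennreal (\<theta> s) * ennreal (norm (g s \<xi>)) * indicator {0..t} s) \<partial>lborel) \<partial>lborel)"
  proof -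
    have "(\<integral>\<^sup>+s. ennreal (Xweight (-1) \<xi>) * (ennreal (\<theta> s) * ennreal (norm (g s \<xi>)) * indicator {0..t} s) \<partial>lborel)
      = ennreal (Xweight (-1) \<xi>) * (\<integral>\<^sup>+s\<in>{0..t}. ennreal (\<theta> s) * ennreal (norm (g s \<xi>)) \<partial>lborel)" for \<xi>
      by (rule nn_integral_cmult) measurable
    then show ?thesis unfolding eXnorm_def distrib_left by (subst nn_integral_add) (simp_all add: ennreal_mult)
  qed
  also have "(\<integral>\<^sup>+\<xi>. (\<integral>\<^sup>+s. ennreal (Xweight (-1) \<xi>) * (ennreal (\<theta> s) * ennreal (norm (g s \<xi>)) * indicator {0..t} s) \<partial>lborel) \<partial>lborel)
     = (\<integral>\<^sup>+s. (\<integral>\<^sup>+\<xi>. ennreal (Xweight (-1) \<xi>) * (ennreal (\<theta> s) * ennreal (norm (g s \<xi>)) * indicator {0..t} s) \<partial>lborel) \<partial>lborel)"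
    by (rule lborel_pair.Fubini') measurable
  also have "\<dots> = (\<integral>\<^sup>+s\<in>{0..t}. ennreal (\<theta> s) * eXnorm (-1) (g s) \<partial>lborel)"
  proof (rule nn_integral_cong)
    fix s
    have "(\<integral>\<^sup>+\<xi>. ennreal (Xweight (-1) \<xi>) * (ennreal (\<theta> s) * ennreal (norm (g s \<xi>)) * indicator {0..t} s) \<partial>lborel)
      = (\<integral>\<^sup>+\<xi>. ennreal (\<theta> s) * indicator {0..t} s * ennreal (Xweight (-1) \<xi> * norm (g s \<xi>)) \<partial>lborel)"
      by (intro nn_integral_cong) (simp add: ennreal_mult mult_ac)
    then show "(\<integral>\<^sup>+\<xi>. ennreal (Xweight (-1) \<xi>) * (ennreal (\<theta> s) * ennreal (norm (g s \<xi>)) * indicator {0..t} s) \<partial>lborel)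
      = ennreal (\<theta> s) * eXnorm (-1) (g s) * indicator {0..t} s"
      unfolding eXnorm_def by (simp add: nn_integral_cmult mult_ac)
  qed
  finally show ?thesis .
qed

end

section \<open>Duhamel's formula\<close>

text \<open>Solution of y' + k y + g = 0 with y(0) = b. The forcing stands on the left, as the
  nonlinearity does in the equation, hence the minus sign.\<close>

definition duhamel :: "real \<Rightarrow> 'b \<Rightarrow> (real \<Rightarrow> 'b) \<Rightarrow> real \<Rightarrow> 'b::{banach, second_countable_topology}" where
  "duhamel k b g t = exp (- k * t) *\<^sub>R b - (LINT s:{0..t}|lborel. exp (- k * (t - s)) *\<^sub>R g s)"

lemma measurable_duhamel [measurable (raw)]:
  assumes [measurable]: "k \<in> borel_measurable M" "b \<in> borel_measurable M" "t \<in> borel_measurable M"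
    "case_prod g \<in> borel_measurable (M \<Otimes>\<^sub>M lborel)"
  shows "(\<lambda>x. duhamel (k x) (b x) (g x) (t x)) \<in> borel_measurable M"
  unfolding duhamel_def set_lebesgue_integral_def by measurable

text \<open>An integral over one point is controlled by an extended integral that vanishes, so the
  initial value is exact at every frequency, even where \<open>g\<close> is not integrable in
  time.\<close>

lemma duhamel_0 [simp]: "duhamel k b g 0 = b"
proof -
  have "ennreal (norm (LINT s:{0..0}|lborel. exp (- k * (0 - s)) *\<^sub>R g s))
      \<le> (\<integral>\<^sup>+s. ennreal (norm (indicator {0..0} s *\<^sub>R exp (- k * (0 - s)) *\<^sub>R g s)) \<partial>lborel)"
    unfolding set_lebesgue_integral_def by (rule norm_integral_le_nn_integral)
  also have "\<dots> = (\<integral>\<^sup>+s. 0 \<partial>(lborel::real measure))"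
    by (intro nn_integral_cong_AE eventually_mono[OF AE_lborel_singleton[of "0::real"]]) (auto simp: indicator_def)
  finally have "(LINT s:{0..0}|lborel. exp (- k * (0 - s)) *\<^sub>R g s) = 0" by simp
  then show ?thesis by (simp add: duhamel_def)
qed

lemma norm_set_integral_exp_le:
  fixes g :: "real \<Rightarrow> 'b::{banach, second_countable_topology}"
  shows "ennreal (norm (LINT s:{0..t}|lborel. exp (- k * (t - s)) *\<^sub>R g s)) \<le> (\<integral>\<^sup>+s\<in>{0..t}. ennreal (exp (- k * (t - s))) * ennreal (norm (g s)) \<partial>lborel)"
  unfolding set_lebesgue_integral_def
  by (rule order_trans[OF norm_integral_le_nn_integral])
     (auto intro!: nn_integral_mono simp: indicator_def ennreal_mult)

lemma norm_duhamel_le: "ennreal (norm (duhamel k b g t)) \<le> duhamel_majorant k (ennreal (norm b)) (\<lambda>s. ennreal (norm (g s))) t"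
proof -
  have "ennreal (norm (duhamel k b g t)) \<le> ennreal (norm (exp (- k * t) *\<^sub>R b) + norm (LINT s:{0..t}|lborel. exp (- k * (t - s)) *\<^sub>R g s))"
    unfolding duhamel_def by (intro ennreal_leI norm_triangle_ineq4)
  also have "\<dots> = ennreal (exp (- k * t)) * ennreal (norm b) + ennreal (norm (LINT s:{0..t}|lborel. exp (- k * (t - s)) *\<^sub>R g s))"
    by (simp add: ennreal_mult)
  also have "\<dots> \<le> duhamel_majorant k (ennreal (norm b)) (\<lambda>s. ennreal (norm (g s))) t"
    unfolding duhamel_majorant_def by (intro add_mono order_refl norm_set_integral_exp_le)
  finally show ?thesis .
qed

lemma set_integrable_exp:
  fixes g :: "real \<Rightarrow> 'b::{banach, second_countable_topology}"
  assumes [measurable]: "g \<in> borel_measurable borel" and "set_integrable lborel {0..t} g" "0 \<le> k"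
  shows "set_integrable lborel {0..t} (\<lambda>s. exp (- k * (t - s)) *\<^sub>R g s)"
  unfolding set_integrable_def
  by (rule Bochner_Integration.integrable_bound[OF assms(2)[unfolded set_integrable_def]])
     (use assms(3) in \<open>auto simp: indicator_def intro!: AE_I2 mult_left_le_one_le\<close>)

text \<open>Subtracting two Bochner integrals requires both to exist, hence the integrability
  assumptions, which \<open>norm_duhamel_le\<close> does without. The data cancel, which leaves
  datum 0 in the majorant.\<close>

lemma norm_duhamel_diff_le:
  assumes [measurable]: "g \<in> borel_measurable borel" "g' \<in> borel_measurable borel"
    and "set_integrable lborel {0..t} g" "set_integrable lborel {0..t} g'" "0 \<le> k"
  shows "ennreal (norm (duhamel k b g t - duhamel k b g' t)) \<le> duhamel_majorant k 0 (\<lambda>s. ennreal (norm (g s - g' s))) t"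
proof -
  have "(LINT s:{0..t}|lborel. exp (- k * (t - s)) *\<^sub>R (g s - g' s))
     = (LINT s:{0..t}|lborel. exp (- k * (t - s)) *\<^sub>R g s) - (LINT s:{0..t}|lborel. exp (- k * (t - s)) *\<^sub>R g' s)"
    unfolding scaleR_diff_right by (intro set_integral_diff set_integrable_exp assms)
  then have "norm (duhamel k b g t - duhamel k b g' t) = norm (LINT s:{0..t}|lborel. exp (- k * (t - s)) *\<^sub>R (g s - g' s))"
    by (simp add: duhamel_def norm_minus_commute)
  then show ?thesis using norm_set_integral_exp_le[of t k "\<lambda>s. g s - g' s"] by (simp add: duhamel_majorant_def)
qed

lemma duhamel_majorant_le:
  assumes "0 \<le> k" "0 \<le> t"
  shows "duhamel_majorant k b f t \<le> b + (\<integral>\<^sup>+s\<in>{0..t}. f s \<partial>lborel)"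
  unfolding duhamel_majorant_def
proof (intro add_mono nn_integral_mono)
  have "ennreal (exp (- k * t)) * b \<le> 1 * b" using assms by (intro mult_right_mono) auto
  then show "ennreal (exp (- k * t)) * b \<le> b" by simp
  fix s
  have "ennreal (exp (- k * (t - s))) * f s \<le> 1 * f s" if "s \<le> t" using assms that by (intro mult_right_mono) auto
  then show "ennreal (exp (- k * (t - s))) * f s * indicator {0..t} s \<le> f s * indicator {0..t} s"
    by (auto simp: indicator_def)
qed

lemma integral_exp_kernel:
  fixes s t k :: real
  assumes "s \<le> t"
  shows "(\<integral>\<tau>. k * exp (- k * (\<tau> - s)) * indicator {s..t} \<tau> \<partial>lborel) = 1 - exp (- k * (t - s))"
proof -
  have "(\<integral>\<tau>. k * exp (- k * (\<tau> - s)) * indicator {s..t} \<tau> \<partial>lborel) = - exp (- k * (t - s)) - (- exp (- k * (s - s)))"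
    by (rule integral_FTC_Icc_real[OF assms]) (auto intro!: derivative_eq_intros continuous_intros)
  then show ?thesis by simp
qed

text \<open>Variation of constants for a forcing that is merely integrable in time, so that there is
  no pointwise derivative to check. Fubini on the triangle s \<le> \<tau> \<le> t, together with
  \<open>integral_exp_kernel\<close>, yields the time-integrated equation, the form demanded of a
  solution.\<close>

lemma duhamel_integral_equation:
  fixes g :: "real \<Rightarrow> 'b::{banach, second_countable_topology}"
  assumes [measurable]: "g \<in> borel_measurable borel" and gi: "set_integrable lborel {0..t} g" and k: "0 \<le> k" and t: "0 \<le> t"
  shows "set_integrable lborel {0..t} (\<lambda>s. k *\<^sub>R duhamel k b g s + g s)"
    and "duhamel k b g t = b - (LINT s:{0..t}|lborel. k *\<^sub>R duhamel k b g s + g s)"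
proof -
  define f where "f \<tau> s = indicator {0..t} \<tau> *\<^sub>R indicator {0..\<tau>} s *\<^sub>R (k * exp (- k * (\<tau> - s))) *\<^sub>R g s" for \<tau> s
  have f_meas [measurable]: "case_prod f \<in> borel_measurable (lborel \<Otimes>\<^sub>M lborel)"
    unfolding f_def[abs_def] by measurable
  have fi: "integrable (lborel \<Otimes>\<^sub>M lborel) (case_prod f)"
  proof (rule integrableI_bounded)
    define C where "C = (\<integral>\<^sup>+s. ennreal (norm (indicator {0..t} s *\<^sub>R g s)) \<partial>lborel)"
    have C: "C < \<infinity>" using gi unfolding C_def set_integrable_def by (simp add: integrable_iff_bounded)
    have "(\<integral>\<^sup>+x. ennreal (norm (case_prod f x)) \<partial>(lborel \<Otimes>\<^sub>M lborel)) = (\<integral>\<^sup>+\<tau>. (\<integral>\<^sup>+s. ennreal (norm (f \<tau> s)) \<partial>lborel) \<partial>lborel)"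
      by (subst lborel.nn_integral_fst[symmetric]) auto
    also have "\<dots> \<le> (\<integral>\<^sup>+\<tau>. (\<integral>\<^sup>+s. ennreal k * indicator {0..t} \<tau> * ennreal (norm (indicator {0..t} s *\<^sub>R g s)) \<partial>lborel) \<partial>lborel)"
      using k by (intro nn_integral_mono) (auto simp: f_def indicator_def ennreal_mult[symmetric] mult.assoc intro!: ennreal_leI mult_left_mono mult_left_le_one_le)
    also have "\<dots> = ennreal k * ennreal t * C"
      using t by (simp add: nn_integral_cmult nn_integral_multc C_def)
    also have "\<dots> < \<infinity>" using C by (simp add: ennreal_mult_less_top)
    finally show "(\<integral>\<^sup>+x. ennreal (norm (case_prod f x)) \<partial>(lborel \<Otimes>\<^sub>M lborel)) < \<infinity>" .
  qed measurable
  have inner1: "(\<integral>s. f \<tau> s \<partial>lborel) = indicator {0..t} \<tau> *\<^sub>R k *\<^sub>R (LINT s:{0..\<tau>}|lborel. exp (- k * (\<tau> - s)) *\<^sub>R g s)" for \<tau>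
  proof -
    have "(\<integral>s. f \<tau> s \<partial>lborel) = (\<integral>s. (indicator {0..t} \<tau> * k) *\<^sub>R (indicator {0..\<tau>} s *\<^sub>R exp (- k * (\<tau> - s)) *\<^sub>R g s) \<partial>lborel)"
      by (intro Bochner_Integration.integral_cong refl) (simp add: f_def mult_ac)
    then show ?thesis unfolding set_lebesgue_integral_def by (simp only: integral_scaleR_right) simp
  qed
  have inner2: "(\<integral>\<tau>. f \<tau> s \<partial>lborel) = indicator {0..t} s *\<^sub>R (g s - exp (- k * (t - s)) *\<^sub>R g s)" for s
  proof (cases "s \<in> {0..t}")
    case True
    have "(\<integral>\<tau>. f \<tau> s \<partial>lborel) = (\<integral>\<tau>. (k * exp (- k * (\<tau> - s)) * indicator {s..t} \<tau>) *\<^sub>R g s \<partial>lborel)"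
      using True by (intro Bochner_Integration.integral_cong refl) (auto simp: f_def indicator_def)
    also have "\<dots> = (\<integral>\<tau>. k * exp (- k * (\<tau> - s)) * indicator {s..t} \<tau> \<partial>lborel) *\<^sub>R g s"
      by (rule integral_scaleR_left) (auto intro!: borel_integrable_atLeastAtMost continuous_intros)
    also have "\<dots> = (1 - exp (- k * (t - s))) *\<^sub>R g s" using True by (subst integral_exp_kernel) auto
    finally show ?thesis using True by (simp add: algebra_simps)
  next
    case False
    then have "f \<tau> s = 0" for \<tau> by (auto simp: f_def indicator_def)
    then show ?thesis using False by simp
  qed
  have F: "set_integrable lborel {0..t} (\<lambda>\<tau>. k *\<^sub>R (LINT s:{0..\<tau>}|lborel. exp (- k * (\<tau> - s)) *\<^sub>R g s))"
    using lborel_pair.integrable_fst[OF fi] by (simp add: set_integrable_def inner1)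
  have Feq: "(LINT \<tau>:{0..t}|lborel. k *\<^sub>R (LINT s:{0..\<tau>}|lborel. exp (- k * (\<tau> - s)) *\<^sub>R g s))
     = (LINT s:{0..t}|lborel. g s) - (LINT s:{0..t}|lborel. exp (- k * (t - s)) *\<^sub>R g s)"
  proof -
    have "(LINT \<tau>:{0..t}|lborel. k *\<^sub>R (LINT s:{0..\<tau>}|lborel. exp (- k * (\<tau> - s)) *\<^sub>R g s)) = (\<integral>\<tau>. (\<integral>s. f \<tau> s \<partial>lborel) \<partial>lborel)"
      by (simp only: inner1 set_lebesgue_integral_def)
    also have "\<dots> = (\<integral>s. (\<integral>\<tau>. f \<tau> s \<partial>lborel) \<partial>lborel)" by (rule lborel_pair.Fubini_integral[OF fi, symmetric])
    also have "\<dots> = (LINT s:{0..t}|lborel. g s - exp (- k * (t - s)) *\<^sub>R g s)"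
      by (simp add: inner2 set_lebesgue_integral_def)
    also have "\<dots> = (LINT s:{0..t}|lborel. g s) - (LINT s:{0..t}|lborel. exp (- k * (t - s)) *\<^sub>R g s)"
      by (intro set_integral_diff gi set_integrable_exp k) measurable
    finally show ?thesis .
  qed
  have E: "set_integrable lborel {0..t} (\<lambda>\<tau>. (k * exp (- k * \<tau>)) *\<^sub>R b)"
    by (intro borel_integrable_atLeastAtMost' continuous_intros)
  have Eeq: "(LINT \<tau>:{0..t}|lborel. (k * exp (- k * \<tau>)) *\<^sub>R b) = b - exp (- k * t) *\<^sub>R b"
  proof -
    have "(LINT \<tau>:{0..t}|lborel. (k * exp (- k * \<tau>)) *\<^sub>R b) = (\<integral>\<tau>. (k * exp (- k * (\<tau> - 0)) * indicator {0..t} \<tau>) *\<^sub>R b \<partial>lborel)"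
      unfolding set_lebesgue_integral_def by (intro Bochner_Integration.integral_cong refl) (auto simp: indicator_def)
    also have "\<dots> = (\<integral>\<tau>. k * exp (- k * (\<tau> - 0)) * indicator {0..t} \<tau> \<partial>lborel) *\<^sub>R b"
      by (rule integral_scaleR_left) (auto intro!: borel_integrable_atLeastAtMost continuous_intros)
    also have "\<dots> = (1 - exp (- k * (t - 0))) *\<^sub>R b" using t by (subst integral_exp_kernel) auto
    finally show ?thesis by (simp add: algebra_simps)
  qed
  have eq: "k *\<^sub>R duhamel k b g s + g s = ((k * exp (- k * s)) *\<^sub>R b - k *\<^sub>R (LINT r:{0..s}|lborel. exp (- k * (s - r)) *\<^sub>R g r)) + g s" for s
    by (simp add: duhamel_def scaleR_diff_right)
  show "set_integrable lborel {0..t} (\<lambda>s. k *\<^sub>R duhamel k b g s + g s)"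
    unfolding eq by (intro set_integral_add set_integral_diff E F gi)
  show "duhamel k b g t = b - (LINT s:{0..t}|lborel. k *\<^sub>R duhamel k b g s + g s)"
    unfolding eq
    by (subst set_integral_add, intro set_integral_diff E F, rule gi, subst set_integral_diff, rule E, rule F)
       (simp only: Feq Eeq duhamel_def, simp)
qed

text \<open>The integral equation exhibits the formula as a constant minus an indefinite integral,
  which is continuous although \<open>g\<close> need not be.\<close>

lemma continuous_on_duhamel:
  fixes g :: "real \<Rightarrow> 'b::euclidean_space"
  assumes [measurable]: "g \<in> borel_measurable borel" and gi: "\<And>T. set_integrable lborel {0..T} g" and k: "0 \<le> k"
  shows "continuous_on {0..T} (duhamel k b g)"
proof -
  define \<phi> where "\<phi> s = k *\<^sub>R duhamel k b g s + g s" for s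
  have \<phi>: "set_integrable lborel {0..t} \<phi>" if "0 \<le> t" for t
    unfolding \<phi>_def using duhamel_integral_equation(1)[OF assms(1) gi k that] .
  show ?thesis
  proof (cases "0 \<le> T")
    case True
    have "continuous_on {0..T} (\<lambda>x. b - integral {0..x} \<phi>)"
      by (intro continuous_intros indefinite_integral_continuous_1 set_borel_integral_eq_integral(1) \<phi> True)
    moreover have "b - integral {0..x} \<phi> = duhamel k b g x" if "x \<in> {0..T}" for x
      using duhamel_integral_equation(2)[OF assms(1) gi k, of x b] set_borel_integral_eq_integral(2)[OF \<phi>, of x] that
      by (simp add: \<phi>_def)
    ultimately show ?thesis by (rule continuous_on_eq)
  qed simp
qed

lemma bounded_linear_dotc: "bounded_linear (dotc \<xi>)"
proof (rule bounded_linear_intro[of _ "norm \<xi>"])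
  show "norm (dotc \<xi> x) \<le> norm x * norm \<xi>" for x using norm_dotc_le[of \<xi> x] by (simp add: mult.commute)
qed (auto simp: dotc_def algebra_simps sum.distrib scaleR_sum_right)

text \<open>\<open>dotc \<xi>\<close> is bounded and linear, hence commutes with the time integral.
  The constraint on \<open>g\<close> is stated for almost every time because the fixed point
  provides no more.\<close>

lemma dotc_duhamel:
  assumes [measurable]: "g \<in> borel_measurable borel" and gi: "set_integrable lborel {0..t} g" and k: "0 \<le> k"
    and b: "dotc \<xi> b = 0" and g: "AE s in lborel. 0 \<le> s \<longrightarrow> dotc \<xi> (g s) = 0"
  shows "dotc \<xi> (duhamel k b g t) = 0"
proof -
  interpret bounded_linear "dotc \<xi>" by (rule bounded_linear_dotc)
  have "dotc \<xi> (LINT s:{0..t}|lborel. exp (- k * (t - s)) *\<^sub>R g s) = (\<integral>s. dotc \<xi> (indicator {0..t} s *\<^sub>R exp (- k * (t - s)) *\<^sub>R g s) \<partial>lborel)"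
    unfolding set_lebesgue_integral_def
    by (rule integral_bounded_linear[OF bounded_linear_dotc, symmetric])
       (rule set_integrable_exp[OF assms(1) gi k, unfolded set_integrable_def])
  also have "\<dots> = (\<integral>s. 0 \<partial>(lborel::real measure))"
    using g by (intro integral_cong_AE) (auto elim!: eventually_mono simp: indicator_def scaleR zero simp del: exp_zero)
  finally show ?thesis using b by (simp add: duhamel_def diff scaleR)
qed

section \<open>The perturbation equation\<close>

lemma nn_integral_atLeast_le:
  fixes f :: "real \<Rightarrow> ennreal"
  assumes [measurable]: "f \<in> borel_measurable borel"
    and le: "\<And>t. 0 \<le> t \<Longrightarrow> (\<integral>\<^sup>+s\<in>{0..t}. f s \<partial>lborel) \<le> C"
  shows "(\<integral>\<^sup>+s\<in>{0..}. f s \<partial>lborel) \<le> C"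
proof -
  have "f s * indicator {0..} s = (SUP n::nat. f s * indicator {0..real n} s)" for s
  proof (rule antisym)
    obtain n :: nat where "s \<le> real n" using real_arch_simple by blast
    then have "f s * indicator {0..} s \<le> f s * indicator {0..real n} s" by (auto simp: indicator_def)
    then show "f s * indicator {0..} s \<le> (SUP n::nat. f s * indicator {0..real n} s)" by (intro SUP_upper2[of n]) auto
  qed (auto intro!: SUP_least simp: indicator_def)
  then have "(\<integral>\<^sup>+s\<in>{0..}. f s \<partial>lborel) = (\<integral>\<^sup>+s. (SUP n::nat. f s * indicator {0..real n} s) \<partial>lborel)" by simp
  also have "\<dots> = (SUP n::nat. \<integral>\<^sup>+s\<in>{0..real n}. f s \<partial>lborel)"
    by (intro nn_integral_monotone_convergence_SUP) (auto simp: incseq_def le_fun_def indicator_def)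
  also have "\<dots> \<le> C" by (intro SUP_least le) auto
  finally show ?thesis .
qed

lemma eXnorm_0_finite:
  assumes [measurable]: "F \<in> borel_measurable borel" and "eXnorm (-1) F < \<infinity>" "eXnorm 1 F < \<infinity>"
  shows "eXnorm 0 F < \<infinity>"
proof -
  \<comment> \<open>The values a = 1 and \<nu> = 2 turn both coefficients on the right into
    1.\<close>
  have "ennreal (2 * 1) * eXnorm 0 F \<le> ennreal (2 / 2 * 1\<^sup>2) * eXnorm (-1) F + ennreal (2 / 2) * eXnorm 1 F"
    by (rule eXnorm_interpolation_linear) auto
  also have "\<dots> < \<infinity>" using assms by simp
  finally show ?thesis by (auto simp: ennreal_mult_less_top)
qed

text \<open>For F = G the two terms of the product interpolation coincide: a Cauchy-Schwarz
  inequality without square roots.\<close>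

lemma eXnorm_interpolation:
  assumes [measurable]: "F \<in> borel_measurable borel"
  shows "eXnorm 0 F * eXnorm 0 F \<le> eXnorm (-1) F * eXnorm 1 F"
proof -
  have "2 * (eXnorm 0 F * eXnorm 0 F) \<le> 2 * (eXnorm (-1) F * eXnorm 1 F)"
    using eXnorm_interpolation_product[OF assms assms] by (simp add: mult.commute mult_2)
  then show ?thesis by (simp add: ennreal_mult_le_mult_iff)
qed

lemma section_meas [measurable (raw)]:
  fixes w :: "'a::euclidean_space \<Rightarrow> 'b::euclidean_space \<Rightarrow> 'c::topological_space"
  assumes [measurable]: "case_prod w \<in> borel_measurable (lborel \<Otimes>\<^sub>M lborel)"
  shows "w s \<in> borel_measurable borel" and "(\<lambda>s. w s \<xi>) \<in> borel_measurable borel"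
proof -
  have "(\<lambda>\<xi>. case_prod w (s, \<xi>)) \<in> borel_measurable lborel" by measurable
  then show "w s \<in> borel_measurable borel" by simp
  have "(\<lambda>s. case_prod w (s, \<xi>)) \<in> borel_measurable lborel" by measurable
  then show "(\<lambda>s. w s \<xi>) \<in> borel_measurable borel" by simp
qed

lemma Xnorm_eq_enn2real:
  assumes [measurable]: "F \<in> borel_measurable borel"
  shows "Xnorm i F = enn2real (eXnorm i F)"
  unfolding Xnorm_def eXnorm_def by (rule integral_eq_nn_integral) auto

text \<open>Local integrability comes from the X^{-1} norm: 1 \<le> R / |\<xi>| on a punctured ball
  of radius R. The weight of X^1 vanishes at the origin and gives no control there, so the X^{-1}
  norm is assumed finite for every i.\<close>

lemma in_X_I:
  assumes [measurable]: "F \<in> borel_measurable borel" and fin: "eXnorm (-1) F < \<infinity>" "eXnorm i F < \<infinity>"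
  shows "in_X i F"
  unfolding in_X_def
proof (intro conjI allI impI)
  fix K :: "(real^3) set" assume K: "compact K"
  then obtain R where R: "\<And>x. x \<in> K \<Longrightarrow> norm x \<le> R" using compact_imp_bounded bounded_iff by metis
  have [measurable]: "K \<in> sets borel" using K by (simp add: borel_compact)
  show "set_integrable lborel K F"
    unfolding set_integrable_def
  proof (rule integrableI_bounded)
    have "(\<integral>\<^sup>+\<xi>. ennreal (norm (indicator K \<xi> *\<^sub>R F \<xi>)) \<partial>lborel) \<le> (\<integral>\<^sup>+\<xi>. ennreal R * ennreal (Xweight (-1) \<xi> * norm (F \<xi>)) \<partial>lborel)"
    proof (intro nn_integral_mono_AE eventually_mono[OF AE_lborel_singleton[of 0]])
      fix \<xi> :: "real^3" assume "\<xi> \<noteq> 0"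
      show "ennreal (norm (indicator K \<xi> *\<^sub>R F \<xi>)) \<le> ennreal R * ennreal (Xweight (-1) \<xi> * norm (F \<xi>))"
      proof (cases "\<xi> \<in> K")
        case True
        have "0 \<le> R" using R[OF True] norm_ge_zero[of \<xi>] by linarith
        have "1 \<le> R * inverse (norm \<xi>)" using R[OF True] \<open>\<xi> \<noteq> 0\<close> by (simp add: field_simps)
        then have "1 * norm (F \<xi>) \<le> R * inverse (norm \<xi>) * norm (F \<xi>)" by (intro mult_right_mono) auto
        then show ?thesis using True \<open>0 \<le> R\<close>
          by (simp add: ennreal_mult'[symmetric] Xweight_def mult.assoc ennreal_leI del: mult_1)
      qed simp
    qed
    also have "\<dots> = ennreal R * eXnorm (-1) F" unfolding eXnorm_def by (rule nn_integral_cmult) measurable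
    also have "\<dots> < \<infinity>" using fin by (simp add: ennreal_mult_less_top)
    finally show "(\<integral>\<^sup>+\<xi>. ennreal (norm (indicator K \<xi> *\<^sub>R F \<xi>)) \<partial>lborel) < \<infinity>" .
  qed measurable
next
  show "integrable lborel (\<lambda>\<xi>. Xweight i \<xi> * norm (F \<xi>))"
    using fin(2) by (intro integrableI_bounded) (auto simp: eXnorm_def abs_mult)
qed simp

lemma in_X_D:
  assumes "in_X i F"
  shows "F \<in> borel_measurable borel" "eXnorm i F < \<infinity>" "eXnorm i F = ennreal (Xnorm i F)"
proof -
  show m: "F \<in> borel_measurable borel" using assms by (simp add: in_X_def)
  have "integrable lborel (\<lambda>\<xi>. Xweight i \<xi> * norm (F \<xi>))" using assms by (simp add: in_X_def)
  then show fin: "eXnorm i F < \<infinity>" by (simp add: integrable_iff_bounded eXnorm_def abs_mult)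
  show "eXnorm i F = ennreal (Xnorm i F)" unfolding Xnorm_eq_enn2real[OF m] using fin by (simp add: less_top[symmetric])
qed

text \<open>What the construction uses of \<open>u\<close> and of the datum. The identity
  \<open>u_a\<close> holds for almost every time since \<open>u s\<close> lies in X^1 only for such
  s, while \<open>a\<close> is a real number at all times and can serve as a damping rate.
  \<open>\<delta>_small\<close> is the smallness hypothesis with the exponential moved to the
  left.\<close>

locale ns_perturbation = time_weight +
  fixes u :: "real \<Rightarrow> real^3 \<Rightarrow> complex^3" and w0 :: "real^3 \<Rightarrow> complex^3" and \<delta> :: real
  assumes u_meas [measurable]: "case_prod u \<in> borel_measurable (lborel \<Otimes>\<^sub>M lborel)"
    and a_nonneg: "0 \<le> a s"
    and u_a: "AE s in lborel. 0 \<le> s \<longrightarrow> eXnorm 0 (u s) = ennreal (a s)"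
    and w0_meas [measurable]: "w0 \<in> borel_measurable borel"
    and w0_\<delta>: "eXnorm (-1) w0 = ennreal \<delta>"
    and \<delta>_nonneg: "0 \<le> \<delta>"
    and \<delta>_small: "\<delta> * exp (2 / \<nu> * Uinf) \<le> \<nu> / 8"
begin

text \<open>\<open>sol\<close> turns a forcing into a perturbation and \<open>B\<close> turns a
  perturbation into the forcing that it generates; the map to be contracted is their
  composition.\<close>

definition sol :: "(real \<Rightarrow> real^3 \<Rightarrow> complex^3) \<Rightarrow> real \<Rightarrow> real^3 \<Rightarrow> complex^3" where
  "sol g t \<xi> = duhamel (\<nu> * (norm \<xi>)\<^sup>2) (w0 \<xi>) (\<lambda>s. g s \<xi>) t"

definition B :: "(real \<Rightarrow> real^3 \<Rightarrow> complex^3) \<Rightarrow> real \<Rightarrow> real^3 \<Rightarrow> complex^3" where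
  "B w s \<xi> = NSnonlin (\<lambda>\<eta>. u s \<eta> + w s \<eta>) (\<lambda>\<eta>. u s \<eta> + w s \<eta>) \<xi> - NSnonlin (u s) (u s) \<xi>"

definition forcing_norm :: "(real \<Rightarrow> real^3 \<Rightarrow> complex^3) \<Rightarrow> ennreal" where
  "forcing_norm g = (\<integral>\<^sup>+s\<in>{0..}. ennreal (\<theta> s) * eXnorm (-1) (g s) \<partial>lborel)"

definition E :: real where "E = exp (2 / \<nu> * Uinf)"

lemma E_pos: "0 < E" by (simp add: E_def)

lemma E_\<theta>: "1 \<le> E * \<theta> t" unfolding E_def by (rule \<theta>_inverse_le)

lemma \<delta>_E: "\<delta> * E \<le> \<nu> / 8" unfolding E_def by (rule \<delta>_small)

lemma sol_meas [measurable]: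
  assumes [measurable]: "case_prod g \<in> borel_measurable (lborel \<Otimes>\<^sub>M lborel)"
  shows "case_prod (sol g) \<in> borel_measurable (lborel \<Otimes>\<^sub>M lborel)"
  unfolding sol_def[abs_def] by measurable

lemma B_meas [measurable]:
  assumes [measurable]: "case_prod w \<in> borel_measurable (lborel \<Otimes>\<^sub>M lborel)"
  shows "case_prod (B w) \<in> borel_measurable (lborel \<Otimes>\<^sub>M lborel)"
proof -
  have "(\<lambda>(s, \<xi>). NSnonlin (\<lambda>\<eta>. u s \<eta> + w s \<eta>) (\<lambda>\<eta>. u s \<eta> + w s \<eta>) \<xi>) \<in> borel_measurable (lborel \<Otimes>\<^sub>M lborel)"
    by (rule measurable_NSnonlin) measurable
  moreover have "(\<lambda>(s, \<xi>). NSnonlin (u s) (u s) \<xi>) \<in> borel_measurable (lborel \<Otimes>\<^sub>M lborel)"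
    by (rule measurable_NSnonlin) measurable
  ultimately have "(\<lambda>x. (case x of (s, \<xi>) \<Rightarrow> NSnonlin (\<lambda>\<eta>. u s \<eta> + w s \<eta>) (\<lambda>\<eta>. u s \<eta> + w s \<eta>) \<xi>) - (case x of (s, \<xi>) \<Rightarrow> NSnonlin (u s) (u s) \<xi>)) \<in> borel_measurable (lborel \<Otimes>\<^sub>M lborel)"
    by (rule borel_measurable_diff)
  then show ?thesis by (simp add: B_def[abs_def] case_prod_beta')
qed

section \<open>Consequences of a uniform energy bound\<close>

lemma weighted_le_energy_of:
  assumes "\<And>t. 0 \<le> t \<Longrightarrow> energy_of w t \<le> ennreal S" and "0 \<le> t"
  shows "eXnorm (-1) (w t) \<le> ennreal (E * S)"
proof -
  have S: "ennreal (\<theta> t) * eXnorm (-1) (w t) \<le> ennreal S"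
    using assms(1)[OF assms(2)] unfolding energy_of_def by (rule order_trans[rotated]) simp
  have "eXnorm (-1) (w t) = ennreal 1 * eXnorm (-1) (w t)" by simp
  also have "\<dots> \<le> ennreal (E * \<theta> t) * eXnorm (-1) (w t)" by (intro mult_right_mono ennreal_leI E_\<theta>) auto
  also have "\<dots> = ennreal E * (ennreal (\<theta> t) * eXnorm (-1) (w t))" using \<theta>_pos[of t] E_pos by (simp add: ennreal_mult mult.assoc)
  also have "\<dots> \<le> ennreal E * ennreal S" by (intro mult_left_mono S) auto
  also have "\<dots> = ennreal (E * S)" using E_pos by (simp add: ennreal_mult')
  finally show ?thesis .
qed

lemma dissipation_le:
  assumes [measurable]: "case_prod w \<in> borel_measurable (lborel \<Otimes>\<^sub>M lborel)"
    and "\<And>t. 0 \<le> t \<Longrightarrow> energy_of w t \<le> ennreal S"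
  shows "(\<integral>\<^sup>+\<tau>\<in>{0..}. ennreal (\<theta> \<tau>) * (ennreal \<nu> * eXnorm 1 (w \<tau>) + ennreal (2 / \<nu> * (a \<tau>)\<^sup>2) * eXnorm (-1) (w \<tau>)) \<partial>lborel) \<le> ennreal S"
proof (rule nn_integral_atLeast_le)
  fix t :: real assume "0 \<le> t"
  show "(\<integral>\<^sup>+\<tau>\<in>{0..t}. ennreal (\<theta> \<tau>) * (ennreal \<nu> * eXnorm 1 (w \<tau>) + ennreal (2 / \<nu> * (a \<tau>)\<^sup>2) * eXnorm (-1) (w \<tau>)) \<partial>lborel) \<le> ennreal S"
    using assms(2)[OF \<open>0 \<le> t\<close>] unfolding energy_of_def by (rule order_trans[rotated]) simp
qed measurable

lemma dissipation1_le:
  assumes [measurable]: "case_prod w \<in> borel_measurable (lborel \<Otimes>\<^sub>M lborel)"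
    and bd: "\<And>t. 0 \<le> t \<Longrightarrow> energy_of w t \<le> ennreal S" and S: "0 \<le> S"
  shows "(\<integral>\<^sup>+\<tau>\<in>{0..}. ennreal (\<theta> \<tau>) * eXnorm 1 (w \<tau>) \<partial>lborel) \<le> ennreal (S / \<nu>)"
proof -
  have "ennreal \<nu> * (\<integral>\<^sup>+\<tau>\<in>{0..}. ennreal (\<theta> \<tau>) * eXnorm 1 (w \<tau>) \<partial>lborel) = (\<integral>\<^sup>+\<tau>. ennreal \<nu> * (ennreal (\<theta> \<tau>) * eXnorm 1 (w \<tau>) * indicator {0..} \<tau>) \<partial>lborel)"
    by (rule nn_integral_cmult[symmetric]) measurable
  also have "\<dots> \<le> (\<integral>\<^sup>+\<tau>\<in>{0..}. ennreal (\<theta> \<tau>) * (ennreal \<nu> * eXnorm 1 (w \<tau>) + ennreal (2 / \<nu> * (a \<tau>)\<^sup>2) * eXnorm (-1) (w \<tau>)) \<partial>lborel)"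
    by (intro nn_integral_mono) (auto simp: indicator_def distrib_left mult_ac)
  also have "\<dots> \<le> ennreal S" by (intro dissipation_le assms)
  finally have *: "ennreal \<nu> * (\<integral>\<^sup>+\<tau>\<in>{0..}. ennreal (\<theta> \<tau>) * eXnorm 1 (w \<tau>) \<partial>lborel) \<le> ennreal S" .
  have "(\<integral>\<^sup>+\<tau>\<in>{0..}. ennreal (\<theta> \<tau>) * eXnorm 1 (w \<tau>) \<partial>lborel) = ennreal (1 / \<nu>) * (ennreal \<nu> * (\<integral>\<^sup>+\<tau>\<in>{0..}. ennreal (\<theta> \<tau>) * eXnorm 1 (w \<tau>) \<partial>lborel))"
    using \<nu>_pos by (simp add: mult.assoc[symmetric] ennreal_mult[symmetric])
  also have "\<dots> \<le> ennreal (1 / \<nu>) * ennreal S" by (intro mult_left_mono *) auto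
  also have "\<dots> = ennreal (S / \<nu>)" using \<nu>_pos S by (simp add: ennreal_mult[symmetric])
  finally show ?thesis .
qed

text \<open>Finite total dissipation gives finite X^1 norms at almost every time, and interpolation
  with X^{-1} then gives X^0, as the bilinear expansion of \<open>B\<close> requires.\<close>

lemma AE_finite_norms:
  assumes [measurable]: "case_prod w \<in> borel_measurable (lborel \<Otimes>\<^sub>M lborel)"
    and bd: "\<And>t. 0 \<le> t \<Longrightarrow> energy_of w t \<le> ennreal S" and S: "0 \<le> S"
  shows "AE s in lborel. 0 \<le> s \<longrightarrow> eXnorm 1 (w s) < \<infinity> \<and> eXnorm 0 (w s) < \<infinity>"
proof -
  have "AE s in lborel. ennreal (\<theta> s) * eXnorm 1 (w s) * indicator {0..} s \<noteq> \<infinity>"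
    using dissipation1_le[OF assms] by (intro nn_integral_PInf_AE) (auto simp: top_unique)
  then show ?thesis
  proof eventually_elim
    case (elim s)
    show ?case
    proof
      assume s: "0 \<le> s"
      then have 1: "eXnorm 1 (w s) < \<infinity>" using elim \<theta>_pos[of s] by (auto simp: ennreal_mult_eq_top_iff less_top)
      moreover have "eXnorm (-1) (w s) < \<infinity>" using weighted_le_energy_of[OF bd s] by (auto simp: less_top[symmetric] top_unique)
      moreover have "w s \<in> borel_measurable borel" by measurable
      ultimately show "eXnorm 1 (w s) < \<infinity> \<and> eXnorm 0 (w s) < \<infinity>" using eXnorm_0_finite by blast
    qed
  qed
qed

text \<open>The term of \<open>u\<close> alone cancels, so the difference is the increment of the
  square from u + w' to u + w. The three summands (linear, cross, quadratic) are kept apart because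
  each is interpolated differently later.\<close>

lemma B_diff_le:
  assumes [measurable]: "case_prod w \<in> borel_measurable (lborel \<Otimes>\<^sub>M lborel)" "case_prod w' \<in> borel_measurable (lborel \<Otimes>\<^sub>M lborel)"
    and s: "0 \<le> s" "eXnorm 0 (u s) = ennreal (a s)" "eXnorm 0 (\<lambda>\<xi>. w s \<xi> - w' s \<xi>) < \<infinity>" "eXnorm 0 (w' s) < \<infinity>"
  shows "eXnorm (-1) (\<lambda>\<xi>. B w s \<xi> - B w' s \<xi>) \<le> ennreal (1/8) *
    (ennreal (2 * a s) * eXnorm 0 (\<lambda>\<xi>. w s \<xi> - w' s \<xi>) + 2 * (eXnorm 0 (\<lambda>\<xi>. w s \<xi> - w' s \<xi>) * eXnorm 0 (w' s))
      + eXnorm 0 (\<lambda>\<xi>. w s \<xi> - w' s \<xi>) * eXnorm 0 (\<lambda>\<xi>. w s \<xi> - w' s \<xi>))"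
proof -
  define F where "F \<xi> = u s \<xi> + w' s \<xi>" for \<xi>
  define D where "D \<xi> = w s \<xi> - w' s \<xi>" for \<xi>
  have [measurable]: "F \<in> borel_measurable borel" "D \<in> borel_measurable borel"
    unfolding F_def[abs_def] D_def[abs_def] by measurable
  have F_le: "eXnorm 0 F \<le> ennreal (a s) + eXnorm 0 (w' s)"
    unfolding F_def using eXnorm_add_le[of "u s" "w' s" 0] s(2) by simp
  have "eXnorm (-1) (\<lambda>\<xi>. B w s \<xi> - B w' s \<xi>) = eXnorm (-1) (\<lambda>\<xi>. NSnonlin (\<lambda>\<xi>. F \<xi> + D \<xi>) (\<lambda>\<xi>. F \<xi> + D \<xi>) \<xi> - NSnonlin F F \<xi>)"
    by (simp add: B_def F_def[abs_def] D_def)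
  also have "\<dots> \<le> ennreal (1/8) * (eXnorm 0 D * (2 * eXnorm 0 F + eXnorm 0 D))"
    using F_le s by (intro eXnorm_NSnonlin_square_diff_le) (auto simp: D_def less_top[symmetric] top_unique)
  also have "\<dots> \<le> ennreal (1/8) * (eXnorm 0 D * (2 * (ennreal (a s) + eXnorm 0 (w' s)) + eXnorm 0 D))"
    by (intro mult_left_mono add_mono F_le order_refl) auto
  also have "\<dots> = ennreal (1/8) * (ennreal (2 * a s) * eXnorm 0 D + 2 * (eXnorm 0 D * eXnorm 0 (w' s)) + eXnorm 0 D * eXnorm 0 D)"
    using a_nonneg[of s] by (simp add: ennreal_mult) (simp only: distrib_left distrib_right mult_ac add_ac)
  finally show ?thesis unfolding D_def .
qed

text \<open>After interpolation the linear part is bounded by the dissipation of the difference and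
  costs r. In the other parts one factor is an X^{-1} norm, bounded uniformly in time at the price
  of \<open>E\<close>, and the other an X^1 norm, whose weighted time integral is at most an energy
  bound over \<nu>. The cross term takes these roles both ways, hence
  \<open>2 * S' + r\<close>.\<close>

lemma B_lipschitz:
  assumes [measurable]: "case_prod w \<in> borel_measurable (lborel \<Otimes>\<^sub>M lborel)" "case_prod w' \<in> borel_measurable (lborel \<Otimes>\<^sub>M lborel)"
    and bd': "\<And>t. 0 \<le> t \<Longrightarrow> energy_of w' t \<le> ennreal S'"
    and bd: "\<And>t. 0 \<le> t \<Longrightarrow> energy_of (\<lambda>s \<xi>. w s \<xi> - w' s \<xi>) t \<le> ennreal r"
    and nn: "0 \<le> S'" "0 \<le> r"
  shows "forcing_norm (\<lambda>s \<xi>. B w s \<xi> - B w' s \<xi>) \<le> ennreal (1/8 * (r + (2 * S' + r) * r * E / \<nu>))"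
proof -
  define d where "d s \<xi> = w s \<xi> - w' s \<xi>" for s \<xi>
  have [measurable]: "case_prod d \<in> borel_measurable (lborel \<Otimes>\<^sub>M lborel)" unfolding d_def[abs_def] by measurable
  have bdd: "\<And>t. 0 \<le> t \<Longrightarrow> energy_of d t \<le> ennreal r" using bd unfolding d_def .
  define I1 where "I1 s = ennreal (\<theta> s) * (ennreal \<nu> * eXnorm 1 (d s) + ennreal (2 / \<nu> * (a s)\<^sup>2) * eXnorm (-1) (d s))" for s
  define I2 where "I2 s = ennreal (\<theta> s) * eXnorm 1 (d s)" for s
  define I3 where "I3 s = ennreal (\<theta> s) * eXnorm 1 (w' s)" for s
  have [measurable]: "I1 \<in> borel_measurable borel" "I2 \<in> borel_measurable borel" "I3 \<in> borel_measurable borel"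
    unfolding I1_def[abs_def] I2_def[abs_def] I3_def[abs_def] by measurable
  have "forcing_norm (\<lambda>s \<xi>. B w s \<xi> - B w' s \<xi>) \<le> (\<integral>\<^sup>+s. ennreal (1/8) * (I1 s * indicator {0..} s + (ennreal (E * (S' + r)) * (I2 s * indicator {0..} s) + ennreal (E * r) * (I3 s * indicator {0..} s))) \<partial>lborel)"
  proof -
    have fin_d: "AE s in lborel. 0 \<le> s \<longrightarrow> eXnorm 1 (d s) < \<infinity> \<and> eXnorm 0 (d s) < \<infinity>"
      by (rule AE_finite_norms[OF _ bdd nn(2)]) measurable
    have fin_w: "AE s in lborel. 0 \<le> s \<longrightarrow> eXnorm 1 (w' s) < \<infinity> \<and> eXnorm 0 (w' s) < \<infinity>"
      by (rule AE_finite_norms[OF _ bd' nn(1)]) measurable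
    have "AE s in lborel. ennreal (\<theta> s) * eXnorm (-1) (\<lambda>\<xi>. B w s \<xi> - B w' s \<xi>) * indicator {0..} s
       \<le> ennreal (1/8) * (I1 s * indicator {0..} s + (ennreal (E * (S' + r)) * (I2 s * indicator {0..} s) + ennreal (E * r) * (I3 s * indicator {0..} s)))"
      using u_a fin_d fin_w
    proof eventually_elim
      case (elim s)
      show ?case
      proof (cases "0 \<le> s")
        case True
        have [measurable]: "d s \<in> borel_measurable borel" "w' s \<in> borel_measurable borel" by measurable
        have dm: "eXnorm (-1) (d s) \<le> ennreal (E * r)" by (rule weighted_le_energy_of[OF bdd True])
        have wm: "eXnorm (-1) (w' s) \<le> ennreal (E * S')" by (rule weighted_le_energy_of[OF bd' True])
        have d: "(\<lambda>\<xi>. w s \<xi> - w' s \<xi>) = d s" by (simp add: d_def fun_eq_iff)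
        have 1: "ennreal (2 * a s) * eXnorm 0 (d s) \<le> ennreal \<nu> * eXnorm 1 (d s) + ennreal (2 / \<nu> * (a s)\<^sup>2) * eXnorm (-1) (d s)"
        proof -
          have "ennreal (2 * a s) * eXnorm 0 (d s) \<le> ennreal (2 / \<nu> * (a s)\<^sup>2) * eXnorm (-1) (d s) + ennreal (\<nu> / 2) * eXnorm 1 (d s)"
            by (intro eXnorm_interpolation_linear a_nonneg \<nu>_pos) measurable
          \<comment> \<open>Rounding \<nu>/2 up to \<nu> turns the bound into the integrand of
            \<open>dissipation_le\<close>.\<close>
          also have "\<dots> \<le> ennreal (2 / \<nu> * (a s)\<^sup>2) * eXnorm (-1) (d s) + ennreal \<nu> * eXnorm 1 (d s)"
            using \<nu>_pos by (intro add_mono mult_right_mono ennreal_leI) auto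
          finally show ?thesis by (simp add: add.commute)
        qed
        have 2: "2 * (eXnorm 0 (d s) * eXnorm 0 (w' s)) \<le> ennreal (E * S') * eXnorm 1 (d s) + ennreal (E * r) * eXnorm 1 (w' s)"
        proof -
          have "2 * (eXnorm 0 (d s) * eXnorm 0 (w' s)) \<le> eXnorm 1 (d s) * eXnorm (-1) (w' s) + eXnorm (-1) (d s) * eXnorm 1 (w' s)"
            by (intro eXnorm_interpolation_product) measurable
          also have "\<dots> \<le> eXnorm 1 (d s) * ennreal (E * S') + ennreal (E * r) * eXnorm 1 (w' s)"
            by (intro add_mono mult_left_mono mult_right_mono dm wm) auto
          finally show ?thesis by (simp add: mult.commute)
        qed
        have 3: "eXnorm 0 (d s) * eXnorm 0 (d s) \<le> ennreal (E * r) * eXnorm 1 (d s)"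
          by (rule order_trans[OF eXnorm_interpolation]) (auto intro!: mult_right_mono dm)
        have "eXnorm (-1) (\<lambda>\<xi>. B w s \<xi> - B w' s \<xi>) \<le> ennreal (1/8) *
          (ennreal (2 * a s) * eXnorm 0 (d s) + 2 * (eXnorm 0 (d s) * eXnorm 0 (w' s)) + eXnorm 0 (d s) * eXnorm 0 (d s))"
          using B_diff_le[of w w' s] elim True by (simp add: d)
        also have "\<dots> \<le> ennreal (1/8) * ((ennreal \<nu> * eXnorm 1 (d s) + ennreal (2 / \<nu> * (a s)\<^sup>2) * eXnorm (-1) (d s))
           + (ennreal (E * S') * eXnorm 1 (d s) + ennreal (E * r) * eXnorm 1 (w' s)) + ennreal (E * r) * eXnorm 1 (d s))"
          by (intro mult_left_mono add_mono 1 2 3) auto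
        also have "\<dots> = ennreal (1/8) * ((ennreal \<nu> * eXnorm 1 (d s) + ennreal (2 / \<nu> * (a s)\<^sup>2) * eXnorm (-1) (d s))
           + (ennreal (E * (S' + r)) * eXnorm 1 (d s) + ennreal (E * r) * eXnorm 1 (w' s)))"
          using nn E_pos by (simp add: distrib_left[of E] distrib_right add_ac)
        finally have "ennreal (\<theta> s) * eXnorm (-1) (\<lambda>\<xi>. B w s \<xi> - B w' s \<xi>) \<le> ennreal (\<theta> s) * \<dots>"
          by (rule mult_left_mono) simp
        also have "\<dots> = ennreal (1/8) * (I1 s + (ennreal (E * (S' + r)) * I2 s + ennreal (E * r) * I3 s))"
          unfolding I1_def I2_def I3_def by (simp only: distrib_left mult_ac)
        finally show ?thesis using True by simp
      qed simp
    qed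
    then show ?thesis unfolding forcing_norm_def by (rule nn_integral_mono_AE)
  qed
  also have "\<dots> = ennreal (1/8) * ((\<integral>\<^sup>+s\<in>{0..}. I1 s \<partial>lborel) + (ennreal (E * (S' + r)) * (\<integral>\<^sup>+s\<in>{0..}. I2 s \<partial>lborel) + ennreal (E * r) * (\<integral>\<^sup>+s\<in>{0..}. I3 s \<partial>lborel)))"
    by (simp add: nn_integral_cmult nn_integral_add)
  also have "\<dots> \<le> ennreal (1/8) * (ennreal r + (ennreal (E * (S' + r)) * ennreal (r / \<nu>) + ennreal (E * r) * ennreal (S' / \<nu>)))"
    unfolding I1_def I2_def I3_def
    by (intro mult_left_mono add_mono dissipation_le dissipation1_le bdd bd' nn) auto
  also have "\<dots> = ennreal (1/8 * (r + (2 * S' + r) * r * E / \<nu>))"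
  proof -
    have "(2 * S' + r) * r * E / \<nu> = E * (S' + r) * (r / \<nu>) + E * r * (S' / \<nu>)" by (simp add: algebra_simps add_divide_distrib)
    moreover have "0 \<le> E * (S' + r) * (r / \<nu>)" "0 \<le> E * r * (S' / \<nu>)" using nn \<nu>_pos E_pos by auto
    ultimately show ?thesis using nn \<nu>_pos E_pos by (simp add: ennreal_mult'[symmetric] ennreal_plus[symmetric] del: ennreal_plus)
  qed
  finally show ?thesis .
qed

section \<open>Existence of the forcing\<close>

text \<open>With this density the L1 norm over space-time is \<open>forcing_norm\<close>, so the
  abstract fixed point theorem applies. The density vanishes for s < 0 and at \<xi> = 0, where
  almost-everywhere statements say nothing.\<close>

definition forcing_measure :: "(real \<times> (real^3)) measure" where
  "forcing_measure = density (lborel \<Otimes>\<^sub>M lborel) (\<lambda>(s, \<xi>). ennreal (\<theta> s * Xweight (-1) \<xi>) * indicator {0..} s)"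

lemma forcing_measure_measurable: "borel_measurable forcing_measure = borel_measurable (lborel \<Otimes>\<^sub>M lborel)"
  by (intro measurable_cong_sets) (auto simp: forcing_measure_def)

lemma nn_integral_forcing_measure:
  assumes [measurable]: "case_prod g \<in> borel_measurable (lborel \<Otimes>\<^sub>M lborel)"
  shows "(\<integral>\<^sup>+x. ennreal (norm (case_prod g x)) \<partial>forcing_measure) = forcing_norm g"
proof -
  have "(\<integral>\<^sup>+x. ennreal (norm (case_prod g x)) \<partial>forcing_measure)
     = (\<integral>\<^sup>+x. (case x of (s, \<xi>) \<Rightarrow> ennreal (\<theta> s * Xweight (-1) \<xi>) * indicator {0..} s) * ennreal (norm (case_prod g x)) \<partial>(lborel \<Otimes>\<^sub>M lborel))"
    unfolding forcing_measure_def by (rule nn_integral_density) measurable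
  also have "\<dots> = (\<integral>\<^sup>+s. (\<integral>\<^sup>+\<xi>. ennreal (\<theta> s) * indicator {0..} s * ennreal (Xweight (-1) \<xi> * norm (g s \<xi>)) \<partial>lborel) \<partial>lborel)"
    using \<theta>_pos[THEN less_imp_le] by (subst lborel.nn_integral_fst[symmetric]) (auto simp: ennreal_mult mult_ac)
  also have "\<dots> = forcing_norm g"
    unfolding forcing_norm_def eXnorm_def by (intro nn_integral_cong) (subst nn_integral_cmult, measurable, simp only: mult_ac)
  finally show ?thesis .
qed

text \<open>Tonelli with the frequency outside: Duhamel's formula works at a fixed frequency and
  integrates in time.\<close>

lemma forcing_norm_eq_space:
  assumes [measurable]: "case_prod g \<in> borel_measurable (lborel \<Otimes>\<^sub>M lborel)"
  shows "forcing_norm g = (\<integral>\<^sup>+\<xi>. ennreal (Xweight (-1) \<xi>) * (\<integral>\<^sup>+s\<in>{0..}. ennreal (\<theta> s) * ennreal (norm (g s \<xi>)) \<partial>lborel) \<partial>lborel)"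
proof -
  have "forcing_norm g = (\<integral>\<^sup>+s. (\<integral>\<^sup>+\<xi>. ennreal (Xweight (-1) \<xi>) * (ennreal (\<theta> s) * ennreal (norm (g s \<xi>)) * indicator {0..} s) \<partial>lborel) \<partial>lborel)"
    unfolding forcing_norm_def
  proof (rule nn_integral_cong)
    fix s
    have "(\<integral>\<^sup>+\<xi>. ennreal (Xweight (-1) \<xi>) * (ennreal (\<theta> s) * ennreal (norm (g s \<xi>)) * indicator {0..} s) \<partial>lborel)
      = (\<integral>\<^sup>+\<xi>. (ennreal (\<theta> s) * indicator {0..} s) * ennreal (Xweight (-1) \<xi> * norm (g s \<xi>)) \<partial>lborel)"
      by (intro nn_integral_cong) (simp add: ennreal_mult mult_ac)
    also have "\<dots> = (ennreal (\<theta> s) * indicator {0..} s) * eXnorm (-1) (g s)"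
      unfolding eXnorm_def by (rule nn_integral_cmult) measurable
    finally show "ennreal (\<theta> s) * eXnorm (-1) (g s) * indicator {0..} s
      = (\<integral>\<^sup>+\<xi>. ennreal (Xweight (-1) \<xi>) * (ennreal (\<theta> s) * ennreal (norm (g s \<xi>)) * indicator {0..} s) \<partial>lborel)"
      by (simp add: mult_ac)
  qed
  also have "\<dots> = (\<integral>\<^sup>+\<xi>. (\<integral>\<^sup>+s. ennreal (Xweight (-1) \<xi>) * (ennreal (\<theta> s) * ennreal (norm (g s \<xi>)) * indicator {0..} s) \<partial>lborel) \<partial>lborel)"
    by (rule lborel_pair.Fubini'[symmetric]) measurable
  also have "\<dots> = (\<integral>\<^sup>+\<xi>. ennreal (Xweight (-1) \<xi>) * (\<integral>\<^sup>+s\<in>{0..}. ennreal (\<theta> s) * ennreal (norm (g s \<xi>)) \<partial>lborel) \<partial>lborel)"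
    by (intro nn_integral_cong nn_integral_cmult) measurable
  finally show ?thesis .
qed

lemma time_integral_le_forcing_norm:
  assumes [measurable]: "case_prod g \<in> borel_measurable (lborel \<Otimes>\<^sub>M lborel)"
  shows "(\<integral>\<^sup>+\<xi>. ennreal (Xweight (-1) \<xi>) * (\<integral>\<^sup>+s\<in>{0..}. ennreal (norm (g s \<xi>)) \<partial>lborel) \<partial>lborel) \<le> ennreal E * forcing_norm g"
proof -
  have "(\<integral>\<^sup>+s\<in>{0..}. ennreal (norm (g s \<xi>)) \<partial>lborel) \<le> ennreal E * (\<integral>\<^sup>+s\<in>{0..}. ennreal (\<theta> s) * ennreal (norm (g s \<xi>)) \<partial>lborel)" for \<xi>
  proof -
    have "(\<integral>\<^sup>+s\<in>{0..}. ennreal (norm (g s \<xi>)) \<partial>lborel) \<le> (\<integral>\<^sup>+s. ennreal E * (ennreal (\<theta> s) * ennreal (norm (g s \<xi>)) * indicator {0..} s) \<partial>lborel)"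
    proof (rule nn_integral_mono)
      fix s
      have "ennreal 1 * (ennreal (norm (g s \<xi>)) * indicator {0..} s) \<le> ennreal (E * \<theta> s) * (ennreal (norm (g s \<xi>)) * indicator {0..} s)"
        by (intro mult_right_mono ennreal_leI E_\<theta>) auto
      then show "ennreal (norm (g s \<xi>)) * indicator {0..} s \<le> ennreal E * (ennreal (\<theta> s) * ennreal (norm (g s \<xi>)) * indicator {0..} s)"
        using E_pos \<theta>_pos[of s] by (simp add: ennreal_mult mult.assoc)
    qed
    also have "\<dots> = ennreal E * (\<integral>\<^sup>+s\<in>{0..}. ennreal (\<theta> s) * ennreal (norm (g s \<xi>)) \<partial>lborel)"
      by (rule nn_integral_cmult) measurable
    finally show ?thesis .
  qed
  then have "(\<integral>\<^sup>+\<xi>. ennreal (Xweight (-1) \<xi>) * (\<integral>\<^sup>+s\<in>{0..}. ennreal (norm (g s \<xi>)) \<partial>lborel) \<partial>lborel)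
    \<le> (\<integral>\<^sup>+\<xi>. ennreal (Xweight (-1) \<xi>) * (ennreal E * (\<integral>\<^sup>+s\<in>{0..}. ennreal (\<theta> s) * ennreal (norm (g s \<xi>)) \<partial>lborel)) \<partial>lborel)"
    by (intro nn_integral_mono mult_left_mono) auto
  also have "\<dots> = (\<integral>\<^sup>+\<xi>. ennreal E * (ennreal (Xweight (-1) \<xi>) * (\<integral>\<^sup>+s\<in>{0..}. ennreal (\<theta> s) * ennreal (norm (g s \<xi>)) \<partial>lborel)) \<partial>lborel)"
    by (simp only: mult_ac)
  also have "\<dots> = ennreal E * forcing_norm g"
    unfolding forcing_norm_eq_space[OF assms] by (rule nn_integral_cmult) measurable
  finally show ?thesis .
qed

text \<open>The weight 1/|\<xi>| is positive off the origin, so a finite space-time norm forces a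
  finite time integral at almost every frequency. One null set of frequencies serves all times,
  which continuity in time relies on.\<close>

lemma AE_time_integrable:
  assumes [measurable]: "case_prod g \<in> borel_measurable (lborel \<Otimes>\<^sub>M lborel)" and "forcing_norm g < \<infinity>"
  shows "AE \<xi> in lborel. (\<integral>\<^sup>+s\<in>{0..}. ennreal (norm (g s \<xi>)) \<partial>lborel) < \<infinity> \<and> (\<forall>t. set_integrable lborel {0..t} (\<lambda>s. g s \<xi>))"
proof -
  have "(\<integral>\<^sup>+\<xi>. ennreal (Xweight (-1) \<xi>) * (\<integral>\<^sup>+s\<in>{0..}. ennreal (norm (g s \<xi>)) \<partial>lborel) \<partial>lborel) \<noteq> \<infinity>"
    using time_integral_le_forcing_norm[OF assms(1)] assms(2)
    by (metis ennreal_mult_eq_top_iff ennreal_neq_top infinity_ennreal_def less_top top.extremum_unique)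
  then have "AE \<xi> in lborel. ennreal (Xweight (-1) \<xi>) * (\<integral>\<^sup>+s\<in>{0..}. ennreal (norm (g s \<xi>)) \<partial>lborel) \<noteq> \<infinity>"
    by (intro nn_integral_PInf_AE) measurable
  then show ?thesis using AE_lborel_singleton[of 0]
  proof eventually_elim
    case (elim \<xi>)
    then have fin: "(\<integral>\<^sup>+s\<in>{0..}. ennreal (norm (g s \<xi>)) \<partial>lborel) < \<infinity>"
      by (auto simp: ennreal_mult_eq_top_iff Xweight_def less_top)
    have "set_integrable lborel {0..t} (\<lambda>s. g s \<xi>)" for t
      unfolding set_integrable_def
    proof (rule integrableI_bounded)
      have "(\<integral>\<^sup>+s. ennreal (norm (indicator {0..t} s *\<^sub>R g s \<xi>)) \<partial>lborel) \<le> (\<integral>\<^sup>+s\<in>{0..}. ennreal (norm (g s \<xi>)) \<partial>lborel)"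
        by (intro nn_integral_mono) (auto simp: indicator_def)
      then show "(\<integral>\<^sup>+s. ennreal (norm (indicator {0..t} s *\<^sub>R g s \<xi>)) \<partial>lborel) < \<infinity>" using fin by (rule order.strict_trans1)
    qed measurable
    with fin show ?case by blast
  qed
qed

lemma set_time_integral_le_forcing_norm: "(\<integral>\<^sup>+s\<in>{0..t}. ennreal (\<theta> s) * eXnorm (-1) (g s) \<partial>lborel) \<le> forcing_norm g"
  unfolding forcing_norm_def by (intro nn_integral_mono) (auto simp: indicator_def)

section \<open>Energy of Duhamel solutions and the contraction property\<close>

lemma energy_of_sol_le:
  assumes [measurable]: "case_prod g \<in> borel_measurable (lborel \<Otimes>\<^sub>M lborel)" and "0 \<le> t"
  shows "energy_of (sol g) t \<le> ennreal \<delta> + (\<integral>\<^sup>+s\<in>{0..t}. ennreal (\<theta> s) * eXnorm (-1) (g s) \<partial>lborel)"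
  unfolding w0_\<delta>[symmetric]
  by (rule energy) (auto simp: sol_def norm_duhamel_le assms)

lemma energy_of_sol_le_ball:
  assumes "case_prod g \<in> borel_measurable (lborel \<Otimes>\<^sub>M lborel)" "forcing_norm g \<le> ennreal \<delta>" "0 \<le> t"
  shows "energy_of (sol g) t \<le> ennreal (2 * \<delta>)"
proof -
  have "energy_of (sol g) t \<le> ennreal \<delta> + ennreal \<delta>"
    using energy_of_sol_le[OF assms(1,3)] set_time_integral_le_forcing_norm[of g t] assms(2)
    by (meson add_left_mono order_trans)
  then show ?thesis using \<delta>_nonneg by (simp flip: ennreal_plus)
qed

lemma energy_of_sol_diff_le:
  assumes [measurable]: "case_prod g \<in> borel_measurable (lborel \<Otimes>\<^sub>M lborel)" "case_prod g' \<in> borel_measurable (lborel \<Otimes>\<^sub>M lborel)"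
    and fin: "forcing_norm g < \<infinity>" "forcing_norm g' < \<infinity>" and t: "0 \<le> t"
  shows "energy_of (\<lambda>s \<xi>. sol g s \<xi> - sol g' s \<xi>) t \<le> forcing_norm (\<lambda>s \<xi>. g s \<xi> - g' s \<xi>)"
proof -
  have "energy_of (\<lambda>s \<xi>. sol g s \<xi> - sol g' s \<xi>) t \<le> eXnorm (-1) (\<lambda>_. 0) + (\<integral>\<^sup>+s\<in>{0..t}. ennreal (\<theta> s) * eXnorm (-1) (\<lambda>\<xi>. g s \<xi> - g' s \<xi>) \<partial>lborel)"
  proof (rule energy[OF _ _ _ t])
    fix t :: real assume "0 \<le> t"
    show "AE \<xi> in lborel. ennreal (norm (sol g t \<xi> - sol g' t \<xi>)) \<le> duhamel_majorant (\<nu> * (norm \<xi>)\<^sup>2) (ennreal (norm (0::complex^3))) (\<lambda>s. ennreal (norm (g s \<xi> - g' s \<xi>))) t"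
      using AE_time_integrable[OF assms(1) fin(1)] AE_time_integrable[OF assms(2) fin(2)]
    proof eventually_elim
      case (elim \<xi>)
      then show ?case unfolding sol_def using \<nu>_pos by (simp only: norm_zero ennreal_0, intro norm_duhamel_diff_le) auto
    qed
  qed measurable
  also have "\<dots> \<le> forcing_norm (\<lambda>s \<xi>. g s \<xi> - g' s \<xi>)"
    using set_time_integral_le_forcing_norm[of "\<lambda>s \<xi>. g s \<xi> - g' s \<xi>" t] by (simp add: eXnorm_def)
  finally show ?thesis .
qed

lemma \<delta>_E_div: "\<delta> * E / \<nu> \<le> 1 / 8"
  using \<delta>_E \<nu>_pos by (simp add: field_simps)

text \<open>The Lipschitz estimate against the zero perturbation, which generates no forcing: S' = 0
  and r = 2 \<delta> give (2 \<delta> + 4 \<delta>^2 E/\<nu>)/8, at most 5 \<delta>/16.\<close>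

lemma forcing_norm_B_sol_le:
  assumes [measurable]: "case_prod g \<in> borel_measurable (lborel \<Otimes>\<^sub>M lborel)" and "forcing_norm g \<le> ennreal \<delta>"
  shows "forcing_norm (B (sol g)) \<le> ennreal \<delta>"
proof -
  have "forcing_norm (\<lambda>s \<xi>. B (sol g) s \<xi> - B (\<lambda>_ _. 0) s \<xi>) \<le> ennreal (1/8 * (2 * \<delta> + (2 * 0 + 2 * \<delta>) * (2 * \<delta>) * E / \<nu>))"
  proof (rule B_lipschitz)
    show "energy_of (\<lambda>_ _. 0) t \<le> ennreal 0" for t by (simp add: energy_of_def eXnorm_def)
    show "energy_of (\<lambda>s \<xi>. sol g s \<xi> - 0) t \<le> ennreal (2 * \<delta>)" if "0 \<le> t" for t
      using energy_of_sol_le_ball[OF assms that] by simp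
  qed (use \<delta>_nonneg in auto)
  also have "\<dots> \<le> ennreal \<delta>"
  proof (rule ennreal_leI)
    have "(2 * 0 + 2 * \<delta>) * (2 * \<delta>) * E / \<nu> = 4 * \<delta> * (\<delta> * E / \<nu>)" by (simp add: field_simps)
    also have "\<dots> \<le> 4 * \<delta> * (1 / 8)" using \<delta>_nonneg by (intro mult_left_mono \<delta>_E_div) auto
    finally show "1/8 * (2 * \<delta> + (2 * 0 + 2 * \<delta>) * (2 * \<delta>) * E / \<nu>) \<le> \<delta>" using \<delta>_nonneg by simp
  qed
  finally show ?thesis by (simp add: B_def[of "\<lambda>_ _. 0"])
qed

text \<open>Here S' = 2 \<delta> and r is the distance of the forcings. On the ball r \<le> 2
  \<delta> by the triangle inequality, which makes the quadratic term linear in r; the bound becomes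
  (r + 6r/8)/8 = 7r/32.\<close>

lemma forcing_norm_B_sol_diff_le:
  assumes [measurable]: "case_prod g \<in> borel_measurable (lborel \<Otimes>\<^sub>M lborel)" "case_prod g' \<in> borel_measurable (lborel \<Otimes>\<^sub>M lborel)"
    and le: "forcing_norm g \<le> ennreal \<delta>" "forcing_norm g' \<le> ennreal \<delta>"
  shows "forcing_norm (\<lambda>s \<xi>. B (sol g) s \<xi> - B (sol g') s \<xi>) \<le> ennreal (1/2) * forcing_norm (\<lambda>s \<xi>. g s \<xi> - g' s \<xi>)"
proof -
  have "forcing_norm (\<lambda>s \<xi>. g s \<xi> - g' s \<xi>) \<le> (\<integral>\<^sup>+s. ennreal (\<theta> s) * eXnorm (-1) (g s) * indicator {0..} s + ennreal (\<theta> s) * eXnorm (-1) (g' s) * indicator {0..} s \<partial>lborel)"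
    unfolding forcing_norm_def
  proof (intro nn_integral_mono)
    fix s
    have "eXnorm (-1) (\<lambda>\<xi>. g s \<xi> - g' s \<xi>) \<le> eXnorm (-1) (g s) + eXnorm (-1) (\<lambda>\<xi>. - g' s \<xi>)"
      using eXnorm_add_le[of "g s" "\<lambda>\<xi>. - g' s \<xi>" "-1"] by simp
    also have "eXnorm (-1) (\<lambda>\<xi>. - g' s \<xi>) = eXnorm (-1) (g' s)" by (simp add: eXnorm_def)
    finally have "ennreal (\<theta> s) * indicator {0..} s * eXnorm (-1) (\<lambda>\<xi>. g s \<xi> - g' s \<xi>) \<le> ennreal (\<theta> s) * indicator {0..} s * (eXnorm (-1) (g s) + eXnorm (-1) (g' s))"
      by (intro mult_left_mono) auto
    then show "ennreal (\<theta> s) * eXnorm (-1) (\<lambda>\<xi>. g s \<xi> - g' s \<xi>) * indicator {0..} s \<le> ennreal (\<theta> s) * eXnorm (-1) (g s) * indicator {0..} s + ennreal (\<theta> s) * eXnorm (-1) (g' s) * indicator {0..} s"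
      by (simp only: distrib_left mult_ac)
  qed
  also have "\<dots> = forcing_norm g + forcing_norm g'" unfolding forcing_norm_def by (rule nn_integral_add) measurable
  also have "\<dots> \<le> ennreal \<delta> + ennreal \<delta>" by (intro add_mono le)
  finally have G: "forcing_norm (\<lambda>s \<xi>. g s \<xi> - g' s \<xi>) \<le> ennreal (2 * \<delta>)" using \<delta>_nonneg by (simp flip: ennreal_plus)
  then obtain r where r: "forcing_norm (\<lambda>s \<xi>. g s \<xi> - g' s \<xi>) = ennreal r" "0 \<le> r" "r \<le> 2 * \<delta>"
    using \<delta>_nonneg by (cases "forcing_norm (\<lambda>s \<xi>. g s \<xi> - g' s \<xi>)") (auto simp: top_unique)
  have fin: "forcing_norm g < \<infinity>" "forcing_norm g' < \<infinity>" using le by (auto simp: less_top[symmetric] top_unique)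
  have "forcing_norm (\<lambda>s \<xi>. B (sol g) s \<xi> - B (sol g') s \<xi>) \<le> ennreal (1/8 * (r + (2 * (2 * \<delta>) + r) * r * E / \<nu>))"
    by (rule B_lipschitz)
       (use energy_of_sol_diff_le[OF assms(1,2) fin] energy_of_sol_le_ball[OF assms(2) le(2)] r \<delta>_nonneg in auto)
  also have "\<dots> \<le> ennreal (1/2 * r)"
  proof (rule ennreal_leI)
    have "(2 * (2 * \<delta>) + r) * r * E / \<nu> \<le> 6 * \<delta> * r * E / \<nu>"
      using r E_pos \<nu>_pos by (intro divide_right_mono mult_right_mono) auto
    also have "\<dots> = 6 * r * (\<delta> * E / \<nu>)" by simp
    also have "\<dots> \<le> 6 * r * (1 / 8)" using r by (intro mult_left_mono \<delta>_E_div) auto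
    finally have X: "(2 * (2 * \<delta>) + r) * r * E / \<nu> \<le> 6 * r * (1 / 8)" .
    have "1/8 * (r + x) \<le> 1/2 * r" if "x \<le> 6 * r * (1 / 8)" for x using that r by simp
    then show "1/8 * (r + (2 * (2 * \<delta>) + r) * r * E / \<nu>) \<le> 1/2 * r" using X by blast
  qed
  also have "\<dots> = ennreal (1/2) * ennreal r" using r by (subst ennreal_mult[symmetric]) auto
  finally show ?thesis using r by simp
qed

text \<open>The equation holds almost everywhere in space-time and is delivered in both iterated
  forms: time outermost for the norm estimate, frequency outermost for the divergence condition and
  the evolution equation.\<close>

lemma fixed_point:
  obtains g where "case_prod g \<in> borel_measurable (lborel \<Otimes>\<^sub>M lborel)" "forcing_norm g \<le> ennreal \<delta>"
    "AE s in lborel. 0 \<le> s \<longrightarrow> (AE \<xi> in lborel. B (sol g) s \<xi> = g s \<xi>)"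
    "AE \<xi> in lborel. AE s in lborel. 0 \<le> s \<longrightarrow> B (sol g) s \<xi> = g s \<xi>"
proof -
  have cu: "case_prod (curry f) = f" for f :: "real \<times> (real^3) \<Rightarrow> complex^3" by simp
  have "\<exists>f \<in> borel_measurable forcing_measure. (\<integral>\<^sup>+x. norm (f x) \<partial>forcing_measure) \<le> ennreal \<delta> \<and> (AE x in forcing_measure. case_prod (B (sol (curry f))) x = f x)"
  proof (rule L1_contraction_fixpoint[where \<Phi>="\<lambda>f. case_prod (B (sol (curry f)))"])
    fix f :: "real \<times> (real^3) \<Rightarrow> complex^3" assume "f \<in> borel_measurable forcing_measure"
    then have fm: "f \<in> borel_measurable (lborel \<Otimes>\<^sub>M lborel)" by (simp add: forcing_measure_measurable)
    then have [measurable]: "case_prod (curry f) \<in> borel_measurable (lborel \<Otimes>\<^sub>M lborel)" by simp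
    show "case_prod (B (sol (curry f))) \<in> borel_measurable forcing_measure"
      unfolding forcing_measure_measurable by measurable
    show "(\<integral>\<^sup>+x. norm (case_prod (B (sol (curry f))) x) \<partial>forcing_measure) \<le> ennreal \<delta>" if "(\<integral>\<^sup>+x. norm (f x) \<partial>forcing_measure) \<le> ennreal \<delta>"
      using that fm nn_integral_forcing_measure[of "curry f"] nn_integral_forcing_measure[of "B (sol (curry f))"] forcing_norm_B_sol_le[of "curry f"] by (simp add: cu)
    fix f' :: "real \<times> (real^3) \<Rightarrow> complex^3" assume "f' \<in> borel_measurable forcing_measure"
    then have fm': "f' \<in> borel_measurable (lborel \<Otimes>\<^sub>M lborel)" by (simp add: forcing_measure_measurable)
    then have [measurable]: "case_prod (curry f') \<in> borel_measurable (lborel \<Otimes>\<^sub>M lborel)" by simp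
    assume le: "(\<integral>\<^sup>+x. norm (f x) \<partial>forcing_measure) \<le> ennreal \<delta>" "(\<integral>\<^sup>+x. norm (f' x) \<partial>forcing_measure) \<le> ennreal \<delta>"
    have "(\<integral>\<^sup>+x. norm (case_prod (B (sol (curry f))) x - case_prod (B (sol (curry f'))) x) \<partial>forcing_measure) = forcing_norm (\<lambda>s \<xi>. B (sol (curry f)) s \<xi> - B (sol (curry f')) s \<xi>)"
      by (subst nn_integral_forcing_measure[symmetric]) (auto simp: case_prod_beta')
    moreover have "(\<integral>\<^sup>+x. norm (f x - f' x) \<partial>forcing_measure) = forcing_norm (\<lambda>s \<xi>. curry f s \<xi> - curry f' s \<xi>)"
      using fm fm' by (subst nn_integral_forcing_measure[symmetric]) (auto simp: case_prod_beta')
    ultimately show "(\<integral>\<^sup>+x. norm (case_prod (B (sol (curry f))) x - case_prod (B (sol (curry f'))) x) \<partial>forcing_measure) \<le> ennreal (1/2) * (\<integral>\<^sup>+x. norm (f x - f' x) \<partial>forcing_measure)"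
      using le fm fm' nn_integral_forcing_measure[of "curry f"] nn_integral_forcing_measure[of "curry f'"] forcing_norm_B_sol_diff_le[of "curry f" "curry f'"] by (simp add: cu)
  qed (rule \<delta>_nonneg)
  then obtain f where f: "f \<in> borel_measurable forcing_measure" "(\<integral>\<^sup>+x. norm (f x) \<partial>forcing_measure) \<le> ennreal \<delta>" "AE x in forcing_measure. case_prod (B (sol (curry f))) x = f x"
    by blast
  define g where "g = curry f"
  have g_meas [measurable]: "case_prod g \<in> borel_measurable (lborel \<Otimes>\<^sub>M lborel)" using f(1) by (simp add: forcing_measure_measurable g_def)
  have "AE x in lborel \<Otimes>\<^sub>M lborel. 0 < (case x of (s, \<xi>) \<Rightarrow> ennreal (\<theta> s * Xweight (-1) \<xi>) * indicator {0..} s) \<longrightarrow> case_prod (B (sol g)) x = f x"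
    using f(3) unfolding forcing_measure_def g_def by (subst (asm) AE_density) measurable
  moreover have "AE x in lborel \<Otimes>\<^sub>M lborel. snd x \<noteq> (0::real^3)"
  proof (rule lborel_pair.AE_pair_measure)
    show "{x \<in> space (lborel \<Otimes>\<^sub>M lborel). snd x \<noteq> (0::real^3)} \<in> sets (lborel \<Otimes>\<^sub>M lborel)" by measurable
  qed (auto intro!: AE_lborel_singleton AE_I2)
  ultimately have ae: "AE x in lborel \<Otimes>\<^sub>M lborel. 0 \<le> fst x \<longrightarrow> B (sol g) (fst x) (snd x) = g (fst x) (snd x)"
    by eventually_elim (use \<theta>_pos in \<open>auto simp: g_def Xweight_def indicator_def case_prod_beta'\<close>)
  have sets: "{x \<in> space (lborel \<Otimes>\<^sub>M lborel). 0 \<le> fst x \<longrightarrow> B (sol g) (fst x) (snd x) = g (fst x) (snd x)} \<in> sets (lborel \<Otimes>\<^sub>M lborel)"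
    by measurable
  have 1: "AE s in lborel. AE \<xi> in lborel. 0 \<le> s \<longrightarrow> B (sol g) s \<xi> = g s \<xi>"
    using lborel_pair.AE_pair[OF ae] by simp
  show thesis
  proof (rule that[OF g_meas])
    show "forcing_norm g \<le> ennreal \<delta>" using f(2) nn_integral_forcing_measure[OF g_meas] by (simp add: g_def)
    show "AE s in lborel. 0 \<le> s \<longrightarrow> (AE \<xi> in lborel. B (sol g) s \<xi> = g s \<xi>)"
      using 1 by eventually_elim auto
    show "AE \<xi> in lborel. AE s in lborel. 0 \<le> s \<longrightarrow> B (sol g) s \<xi> = g s \<xi>"
      using 1 lborel_pair.AE_commute[OF sets] by blast
  qed
qed

section \<open>The solution of the perturbation equation\<close>

text \<open>The energy bound available so far is 2 \<delta>, twice the claim. It makes the X^{-1}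
  norm at most 2 \<delta> E \<le> \<nu>/4, so that the forcing is bounded by the damping plus half
  of the viscous term, and it makes the integral of that bound finite, so that it cancels from both
  sides. The datum \<delta> then controls the weighted norm and the other half of the dissipation,
  hence the coefficient \<nu>/2.\<close>

lemma sol_bound:
  assumes [measurable]: "case_prod g \<in> borel_measurable (lborel \<Otimes>\<^sub>M lborel)" and G: "forcing_norm g \<le> ennreal \<delta>"
    and fp: "AE s in lborel. 0 \<le> s \<longrightarrow> (AE \<xi> in lborel. B (sol g) s \<xi> = g s \<xi>)" and t: "0 \<le> t"
  shows "eXnorm (-1) (sol g t) + ennreal (\<nu> / 2) * (\<integral>\<^sup>+s\<in>{0..t}. eXnorm 1 (sol g s) \<partial>lborel) \<le> ennreal (E * \<delta>)"
proof -
  define w where "w = sol g"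
  have [measurable]: "case_prod w \<in> borel_measurable (lborel \<Otimes>\<^sub>M lborel)" unfolding w_def by measurable
  have bd: "energy_of w s \<le> ennreal (2 * \<delta>)" if "0 \<le> s" for s unfolding w_def by (rule energy_of_sol_le_ball[OF assms(1) G that])
  define I where "I s = ennreal (\<theta> s) * (ennreal (2 / \<nu> * (a s)\<^sup>2) * eXnorm (-1) (w s) + ennreal (\<nu> / 2) * eXnorm 1 (w s))" for s
  define J where "J s = ennreal (\<theta> s) * (ennreal (\<nu> / 2) * eXnorm 1 (w s))" for s
  have [measurable]: "I \<in> borel_measurable borel" "J \<in> borel_measurable borel" unfolding I_def[abs_def] J_def[abs_def] by measurable
  have fin_w: "AE s in lborel. 0 \<le> s \<longrightarrow> eXnorm 1 (w s) < \<infinity> \<and> eXnorm 0 (w s) < \<infinity>"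
    by (rule AE_finite_norms[OF _ bd]) (use \<delta>_nonneg in auto)
  have "AE s in lborel. ennreal (\<theta> s) * eXnorm (-1) (g s) * indicator {0..t} s \<le> I s * indicator {0..t} s"
    using fp u_a fin_w
  proof eventually_elim
    case (elim s)
    show ?case
    proof (cases "s \<in> {0..t}")
      case True
      then have s: "0 \<le> s" by simp
      have [measurable]: "w s \<in> borel_measurable borel" by measurable
      have x: "eXnorm (-1) (w s) \<le> ennreal (\<nu> / 4)"
        by (rule order_trans[OF weighted_le_energy_of[OF bd s]]) (use \<delta>_E in \<open>auto intro!: ennreal_leI simp: mult_ac\<close>)
      \<comment> \<open>Subtracting the vanishing forcing of the zero perturbation brings
        \<open>g s\<close> into the shape of \<open>B_diff_le\<close>.\<close>
      have "eXnorm (-1) (g s) = eXnorm (-1) (\<lambda>\<xi>. B w s \<xi> - B (\<lambda>_ _. 0) s \<xi>)"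
        using elim(1) s by (intro eXnorm_cong_AE) (auto simp: w_def B_def[of "\<lambda>_ _. 0"] elim!: eventually_mono)
      also have "\<dots> \<le> ennreal (1/8) * (ennreal (2 * a s) * eXnorm 0 (w s) + eXnorm 0 (w s) * eXnorm 0 (w s))"
        using B_diff_le[of w "\<lambda>_ _. 0" s] elim s by (simp add: eXnorm_0[of "\<lambda>_. 0"])
      also have "\<dots> \<le> 1 * (ennreal (2 / \<nu> * (a s)\<^sup>2) * eXnorm (-1) (w s)) + ennreal (\<nu> / 2) * eXnorm 1 (w s)"
      proof -
        have "ennreal (2 * a s) * eXnorm 0 (w s) + eXnorm 0 (w s) * eXnorm 0 (w s)
          \<le> (ennreal (2 / \<nu> * (a s)\<^sup>2) * eXnorm (-1) (w s) + ennreal (\<nu> / 2) * eXnorm 1 (w s)) + ennreal (\<nu> / 4) * eXnorm 1 (w s)"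
          by (intro add_mono eXnorm_interpolation_linear a_nonneg \<nu>_pos order_trans[OF eXnorm_interpolation] mult_right_mono x) auto
        also have "\<dots> = ennreal (2 / \<nu> * (a s)\<^sup>2) * eXnorm (-1) (w s) + ennreal (\<nu> / 2 + \<nu> / 4) * eXnorm 1 (w s)"
        proof -
          have "ennreal (\<nu> / 2 + \<nu> / 4) = ennreal (\<nu> / 2) + ennreal (\<nu> / 4)" using \<nu>_pos by (intro ennreal_plus) auto
          then show ?thesis by (simp only: distrib_right add.assoc)
        qed
        finally have "ennreal (1/8) * (ennreal (2 * a s) * eXnorm 0 (w s) + eXnorm 0 (w s) * eXnorm 0 (w s))
          \<le> ennreal (1/8) * (ennreal (2 / \<nu> * (a s)\<^sup>2) * eXnorm (-1) (w s) + ennreal (\<nu> / 2 + \<nu> / 4) * eXnorm 1 (w s))"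
          by (intro mult_left_mono) auto
        also have "\<dots> = ennreal (1/8) * (ennreal (2 / \<nu> * (a s)\<^sup>2) * eXnorm (-1) (w s)) + ennreal (1/8 * (\<nu> / 2 + \<nu> / 4)) * eXnorm 1 (w s)"
          using \<nu>_pos by (subst (2) ennreal_mult) (auto simp: distrib_left mult.assoc)
        \<comment> \<open>Both coefficients, 1/8 and 3\<nu>/32, are rounded up to those occurring in
          \<open>I\<close>.\<close>
        also have "\<dots> \<le> 1 * (ennreal (2 / \<nu> * (a s)\<^sup>2) * eXnorm (-1) (w s)) + ennreal (\<nu> / 2) * eXnorm 1 (w s)"
          using \<nu>_pos by (intro add_mono mult_right_mono ennreal_leI) (auto simp: ennreal_le_1 simp flip: ennreal_1)
        finally show ?thesis .
      qed
      finally show ?thesis unfolding I_def using True by (simp add: mult_left_mono)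
    qed simp
  qed
  then have "(\<integral>\<^sup>+s\<in>{0..t}. ennreal (\<theta> s) * eXnorm (-1) (g s) \<partial>lborel) \<le> (\<integral>\<^sup>+s\<in>{0..t}. I s \<partial>lborel)"
    by (rule nn_integral_mono_AE)
  then have energy_of_le: "energy_of w t \<le> ennreal \<delta> + (\<integral>\<^sup>+s\<in>{0..t}. I s \<partial>lborel)"
    using energy_of_sol_le[OF assms(1) t] unfolding w_def by (meson add_left_mono order_trans)
  have energy_of_eq: "energy_of w t = (\<integral>\<^sup>+s\<in>{0..t}. I s \<partial>lborel) + (ennreal (\<theta> t) * eXnorm (-1) (w t) + (\<integral>\<^sup>+s\<in>{0..t}. J s \<partial>lborel))"
  proof -
    have "(\<integral>\<^sup>+\<tau>\<in>{0..t}. ennreal (\<theta> \<tau>) * (ennreal \<nu> * eXnorm 1 (w \<tau>) + ennreal (2 / \<nu> * (a \<tau>)\<^sup>2) * eXnorm (-1) (w \<tau>)) \<partial>lborel)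
      = (\<integral>\<^sup>+s. I s * indicator {0..t} s + J s * indicator {0..t} s \<partial>lborel)"
    proof (rule nn_integral_cong)
      fix \<tau>
      have "ennreal \<nu> = ennreal (\<nu> / 2) + ennreal (\<nu> / 2)" using \<nu>_pos by (simp flip: ennreal_plus)
      then show "ennreal (\<theta> \<tau>) * (ennreal \<nu> * eXnorm 1 (w \<tau>) + ennreal (2 / \<nu> * (a \<tau>)\<^sup>2) * eXnorm (-1) (w \<tau>)) * indicator {0..t} \<tau>
        = I \<tau> * indicator {0..t} \<tau> + J \<tau> * indicator {0..t} \<tau>"
        unfolding I_def J_def by (simp only: distrib_left distrib_right add_ac)
    qed
    also have "\<dots> = (\<integral>\<^sup>+s\<in>{0..t}. I s \<partial>lborel) + (\<integral>\<^sup>+s\<in>{0..t}. J s \<partial>lborel)" by (rule nn_integral_add) measurable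
    finally show ?thesis unfolding energy_of_def by (simp add: add_ac)
  qed
  have "(\<integral>\<^sup>+s\<in>{0..t}. I s \<partial>lborel) \<le> energy_of w t" unfolding energy_of_eq by simp
  then have "(\<integral>\<^sup>+s\<in>{0..t}. I s \<partial>lborel) \<noteq> \<infinity>" using bd[OF t] by (auto simp: top_unique)
  then have main: "ennreal (\<theta> t) * eXnorm (-1) (w t) + (\<integral>\<^sup>+s\<in>{0..t}. J s \<partial>lborel) \<le> ennreal \<delta>"
    using energy_of_le unfolding energy_of_eq by (simp add: add.commute[of "ennreal \<delta>"] ennreal_add_left_cancel_le)
  have weight: "z \<le> ennreal E * (ennreal (\<theta> s) * z)" for s z
  proof -
    have "ennreal 1 * z \<le> ennreal (E * \<theta> s) * z" by (intro mult_right_mono ennreal_leI E_\<theta>) auto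
    then show ?thesis using E_pos \<theta>_pos[of s] by (simp add: ennreal_mult mult.assoc)
  qed
  have "ennreal (\<nu> / 2) * (\<integral>\<^sup>+s\<in>{0..t}. eXnorm 1 (w s) \<partial>lborel) = (\<integral>\<^sup>+s. ennreal (\<nu> / 2) * (eXnorm 1 (w s) * indicator {0..t} s) \<partial>lborel)"
    by (rule nn_integral_cmult[symmetric]) measurable
  also have "\<dots> \<le> (\<integral>\<^sup>+s. ennreal E * (J s * indicator {0..t} s) \<partial>lborel)"
    using weight[of "ennreal (\<nu> / 2) * (eXnorm 1 (w s) * indicator {0..t} s)" s for s]
    by (intro nn_integral_mono) (simp add: J_def mult.assoc)
  also have "\<dots> = ennreal E * (\<integral>\<^sup>+s\<in>{0..t}. J s \<partial>lborel)" by (rule nn_integral_cmult) measurable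
  finally have "eXnorm (-1) (w t) + ennreal (\<nu> / 2) * (\<integral>\<^sup>+s\<in>{0..t}. eXnorm 1 (w s) \<partial>lborel)
      \<le> ennreal E * (ennreal (\<theta> t) * eXnorm (-1) (w t)) + ennreal E * (\<integral>\<^sup>+s\<in>{0..t}. J s \<partial>lborel)"
    by (intro add_mono weight)
  also have "\<dots> \<le> ennreal E * ennreal \<delta>" unfolding distrib_left[symmetric] by (intro mult_left_mono main) auto
  also have "\<dots> = ennreal (E * \<delta>)" using E_pos \<delta>_nonneg by (simp add: ennreal_mult)
  finally show ?thesis unfolding w_def .
qed

text \<open>Dominated convergence over the frequencies. At almost every frequency the solution is
  continuous in time, and the modulus of the datum plus the whole time integral of the forcing
  dominates it at all times; this majorant has finite X^{-1} norm by
  \<open>time_integral_le_forcing_norm\<close>.\<close>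

lemma sol_continuous:
  assumes [measurable]: "case_prod g \<in> borel_measurable (lborel \<Otimes>\<^sub>M lborel)" and G: "forcing_norm g < \<infinity>" and t: "0 \<le> t"
  shows "((\<lambda>s. eXnorm (-1) (\<lambda>\<xi>. sol g s \<xi> - sol g t \<xi>)) \<longlongrightarrow> 0) (at t within {0..})"
proof (subst tendsto_at_iff_sequentially, intro allI impI)
  fix X :: "nat \<Rightarrow> real" assume X: "\<forall>i. X i \<in> {0..} - {t}" and lim: "X \<longlonglongrightarrow> t"
  define m where "m \<xi> = ennreal (norm (w0 \<xi>)) + (\<integral>\<^sup>+s\<in>{0..}. ennreal (norm (g s \<xi>)) \<partial>lborel)" for \<xi>
  have [measurable]: "m \<in> borel_measurable borel" unfolding m_def[abs_def] by measurable
  have sol_le: "ennreal (norm (sol g s \<xi>)) \<le> m \<xi>" if "0 \<le> s" for s \<xi>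
  proof -
    have "ennreal (norm (sol g s \<xi>)) \<le> ennreal (norm (w0 \<xi>)) + (\<integral>\<^sup>+r\<in>{0..s}. ennreal (norm (g r \<xi>)) \<partial>lborel)"
      unfolding sol_def using that \<nu>_pos by (intro order_trans[OF norm_duhamel_le duhamel_majorant_le]) auto
    also have "\<dots> \<le> m \<xi>" unfolding m_def by (intro add_left_mono nn_integral_mono) (auto simp: indicator_def)
    finally show ?thesis .
  qed
  have "(\<lambda>n. \<integral>\<^sup>+\<xi>. ennreal (Xweight (-1) \<xi> * norm (sol g (X n) \<xi> - sol g t \<xi>)) \<partial>lborel) \<longlonglongrightarrow> (\<integral>\<^sup>+\<xi>. 0 \<partial>(lborel :: (real^3) measure))"
  proof (rule nn_integral_dominated_convergence[where w="\<lambda>\<xi>. 2 * (ennreal (Xweight (-1) \<xi>) * m \<xi>)"])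
    fix n
    show "AE \<xi> in lborel. ennreal (Xweight (-1) \<xi> * norm (sol g (X n) \<xi> - sol g t \<xi>)) \<le> 2 * (ennreal (Xweight (-1) \<xi>) * m \<xi>)"
    proof (rule AE_I2)
      fix \<xi>
      have "ennreal (norm (sol g (X n) \<xi> - sol g t \<xi>)) \<le> ennreal (norm (sol g (X n) \<xi>)) + ennreal (norm (sol g t \<xi>))"
        by (simp flip: ennreal_plus add: norm_triangle_ineq4 ennreal_leI)
      also have "\<dots> \<le> m \<xi> + m \<xi>" using X t by (intro add_mono sol_le) auto
      finally have "ennreal (Xweight (-1) \<xi>) * ennreal (norm (sol g (X n) \<xi> - sol g t \<xi>)) \<le> ennreal (Xweight (-1) \<xi>) * (m \<xi> + m \<xi>)"
        by (intro mult_left_mono) auto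
      then show "ennreal (Xweight (-1) \<xi> * norm (sol g (X n) \<xi> - sol g t \<xi>)) \<le> 2 * (ennreal (Xweight (-1) \<xi>) * m \<xi>)"
        by (simp add: ennreal_mult mult_2 distrib_left)
    qed
  next
    have "(\<integral>\<^sup>+\<xi>. 2 * (ennreal (Xweight (-1) \<xi>) * m \<xi>) \<partial>lborel) = 2 * (\<integral>\<^sup>+\<xi>. ennreal (Xweight (-1) \<xi>) * m \<xi> \<partial>lborel)"
      by (rule nn_integral_cmult) measurable
    also have "(\<integral>\<^sup>+\<xi>. ennreal (Xweight (-1) \<xi>) * m \<xi> \<partial>lborel) = eXnorm (-1) w0 + (\<integral>\<^sup>+\<xi>. ennreal (Xweight (-1) \<xi>) * (\<integral>\<^sup>+s\<in>{0..}. ennreal (norm (g s \<xi>)) \<partial>lborel) \<partial>lborel)"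
      unfolding m_def distrib_left eXnorm_def by (subst nn_integral_add) (auto simp: ennreal_mult)
    also have "2 * \<dots> \<le> 2 * (ennreal \<delta> + ennreal E * forcing_norm g)"
      unfolding w0_\<delta> by (intro mult_left_mono add_left_mono time_integral_le_forcing_norm) auto
    also have "\<dots> < \<infinity>" using G by (simp add: ennreal_mult_less_top)
    finally show "(\<integral>\<^sup>+\<xi>. 2 * (ennreal (Xweight (-1) \<xi>) * m \<xi>) \<partial>lborel) < \<infinity>" .
  next
    show "AE \<xi> in lborel. (\<lambda>n. ennreal (Xweight (-1) \<xi> * norm (sol g (X n) \<xi> - sol g t \<xi>))) \<longlonglongrightarrow> 0"
      using AE_time_integrable[OF assms(1) G]
    proof eventually_elim
      case (elim \<xi>)
      \<comment> \<open>A convergent sequence of times is bounded, so one interval [0, T] contains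
        it and its limit.\<close>
      obtain T where T: "\<And>n. X n \<le> T" using convergent_imp_Bseq[OF convergentI[OF lim]] by (metis Bseq_def abs_le_D1 real_norm_def)
      have tT: "t \<le> T" by (rule LIMSEQ_le_const2[OF lim]) (use T in auto)
      have "continuous_on {0..T} (\<lambda>s. sol g s \<xi>)"
        unfolding sol_def using elim \<nu>_pos by (intro continuous_on_duhamel) auto
      then have "(\<lambda>n. sol g (X n) \<xi>) \<longlonglongrightarrow> sol g t \<xi>"
        by (rule continuous_on_tendsto_compose[OF _ lim]) (use X T t tT in auto)
      then have "(\<lambda>n. ennreal (Xweight (-1) \<xi> * norm (sol g (X n) \<xi> - sol g t \<xi>))) \<longlonglongrightarrow> ennreal (Xweight (-1) \<xi> * norm (sol g t \<xi> - sol g t \<xi>))"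
        by (intro tendsto_intros tendsto_ennrealI)
      then show ?case by simp
    qed
  qed measurable
  then show "((\<lambda>s. eXnorm (-1) (\<lambda>\<xi>. sol g s \<xi> - sol g t \<xi>)) \<circ> X) \<longlonglongrightarrow> 0"
    by (simp add: eXnorm_def comp_def)
qed

text \<open>Off the origin \<open>B\<close> is a difference of Leray projections, hence orthogonal
  to \<xi>; the fixed point equation passes this on to \<open>g\<close> at almost every
  time.\<close>

lemma sol_div_free:
  assumes [measurable]: "case_prod g \<in> borel_measurable (lborel \<Otimes>\<^sub>M lborel)" and G: "forcing_norm g < \<infinity>"
    and fp: "AE \<xi> in lborel. AE s in lborel. 0 \<le> s \<longrightarrow> B (sol g) s \<xi> = g s \<xi>"
    and w0: "div_free w0"
  shows "div_free (sol g t)"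
  unfolding div_free_def
  using AE_time_integrable[OF assms(1) G] fp w0[unfolded div_free_def] AE_lborel_singleton[of 0]
proof eventually_elim
  case (elim \<xi>)
  interpret bounded_linear "dotc \<xi>" by (rule bounded_linear_dotc)
  show ?case
    unfolding sol_def
  proof (rule dotc_duhamel)
    show "AE s in lborel. 0 \<le> s \<longrightarrow> dotc \<xi> (g s \<xi>) = 0"
      using elim(2)
    proof eventually_elim
      case (elim s)
      have "dotc \<xi> (B (sol g) s \<xi>) = 0"
        unfolding B_def NSnonlin_def diff using \<open>\<xi> \<noteq> 0\<close> by (simp add: dotc_leray)
      then show ?case using elim by auto
    qed
  qed (use elim \<nu>_pos in auto)
qed

lemma sol_equation:
  assumes [measurable]: "case_prod g \<in> borel_measurable (lborel \<Otimes>\<^sub>M lborel)" and G: "forcing_norm g < \<infinity>" and t: "0 \<le> t"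
  shows "AE \<xi> in lborel. set_integrable lborel {0..t} (\<lambda>s. (\<nu> * (norm \<xi>)\<^sup>2) *\<^sub>R sol g s \<xi> + g s \<xi>) \<and>
     sol g t \<xi> = w0 \<xi> - (LINT s:{0..t}|lborel. (\<nu> * (norm \<xi>)\<^sup>2) *\<^sub>R sol g s \<xi> + g s \<xi>)"
  using AE_time_integrable[OF assms(1) G]
proof eventually_elim
  case (elim \<xi>)
  have "(\<lambda>s. g s \<xi>) \<in> borel_measurable borel" "0 \<le> \<nu> * (norm \<xi>)\<^sup>2" using \<nu>_pos by auto
  then show ?case unfolding sol_def using duhamel_integral_equation[of "\<lambda>s. g s \<xi>" t "\<nu> * (norm \<xi>)\<^sup>2" "w0 \<xi>"] elim t by blast
qed

end

section \<open>Global stability\<close>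

text \<open>Finiteness of \<open>L1sq_total u\<close> is stated explicitly because
  \<open>enn2real\<close> sends infinity to 0. With exp(-\<infinity>) = 0 the informal smallness
  condition, a norm strictly below 0, excludes that case by itself.\<close>

theorem theorem1p4:
  fixes \<nu> :: real
    and u :: "real \<Rightarrow> real^3 \<Rightarrow> complex^3"
    and v0 :: "real^3 \<Rightarrow> complex^3"
  assumes "\<nu> > 0"
    and "NS_global_solution \<nu> u"
    and "in_X (-1) v0" and "div_free v0"
    and "L1sq_total u < \<infinity>"
    and "Xnorm (-1) (\<lambda>\<xi>. v0 \<xi> - u 0 \<xi>) < \<nu> / 8 * exp (- (2 / \<nu>) * enn2real (L1sq_total u))"
  shows "\<exists>v. NS_global_solution \<nu> v \<and> (AE \<xi> in lborel. v 0 \<xi> = v0 \<xi>)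
           \<and> (\<forall>t\<ge>0. Xnorm (-1) (\<lambda>\<xi>. v t \<xi> - u t \<xi>)
                      + \<nu> / 2 * (LINT s:{0..t}|lborel. Xnorm 1 (\<lambda>\<xi>. v s \<xi> - u s \<xi>))
                    \<le> Xnorm (-1) (\<lambda>\<xi>. v0 \<xi> - u 0 \<xi>) * exp ((2 / \<nu>) * enn2real (L1sq_total u)))"
proof -
  \<comment> \<open>A solution is unconstrained at negative times; this cutoff is the version that
    is jointly measurable.\<close>
  define ut where "ut t \<xi> = (if 0 \<le> t then u t \<xi> else 0)" for t \<xi>
  have ut_eq: "ut t = u t" if "0 \<le> t" for t using that by (simp add: ut_def fun_eq_iff)
  note NS = assms(2)[unfolded NS_global_solution_def]
  have u_X: "in_X (-1) (u t)" if "0 \<le> t" for t using NS that by blast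
  have u_cont: "((\<lambda>s. Xnorm (-1) (\<lambda>\<xi>. u s \<xi> - u t \<xi>)) \<longlongrightarrow> 0) (at t within {0..})" if "0 \<le> t" for t using NS that by blast
  have ut_meas [measurable]: "case_prod ut \<in> borel_measurable (lborel \<Otimes>\<^sub>M lborel)"
    using NS unfolding ut_def[abs_def] by blast
  have u_X1: "AE s in lborel. 0 \<le> s \<longrightarrow> in_X 1 (u s)" using NS by blast
  have u_L1: "set_integrable lborel {0..T} (\<lambda>s. Xnorm 1 (u s))" if "0 \<le> T" for T using NS that by blast
  have u_div: "div_free (u t)" if "0 \<le> t" for t using NS that by blast
  have u_eq: "AE \<xi> in lborel. set_integrable lborel {0..t} (\<lambda>s. (\<nu> * (norm \<xi>)\<^sup>2) *\<^sub>R u s \<xi> + NSnonlin (u s) (u s) \<xi>)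
      \<and> u t \<xi> = u 0 \<xi> - (LINT s:{0..t}|lborel. (\<nu> * (norm \<xi>)\<^sup>2) *\<^sub>R u s \<xi> + NSnonlin (u s) (u s) \<xi>)" if "0 \<le> t" for t
    using NS that by blast
  have u_sec [measurable]: "u t \<in> borel_measurable borel" if "0 \<le> t" for t using in_X_D(1)[OF u_X[OF that]] .
  note v0_X = in_X_D[OF assms(3)]

  \<comment> \<open>\<open>enn2real\<close> gives 0 where the X^0 norm is infinite; by
    \<open>u_X1\<close> and interpolation this can happen only on a null set of times.\<close>
  define a where "a s = enn2real (eXnorm 0 (ut s))" for s
  have a_meas: "a \<in> borel_measurable borel" unfolding a_def[abs_def] by measurable
  have a_u: "a s = Xnorm 0 (u s)" if "0 \<le> s" for s
    using that by (simp add: a_def ut_eq Xnorm_eq_enn2real)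
  have a_neg: "a s = 0" if "s < 0" for s using that by (simp add: a_def ut_def eXnorm_def)
  have a_total: "(\<integral>\<^sup>+s. ennreal ((a s)\<^sup>2) \<partial>lborel) = L1sq_total u"
    unfolding L1sq_total_def by (intro nn_integral_cong) (auto simp: indicator_def a_u a_neg)
  have a_int: "integrable lborel (\<lambda>s. (a s)\<^sup>2)"
    using a_meas a_total assms(5) by (intro integrableI_bounded) auto
  interpret W: time_weight \<nu> a
    by standard (use assms(1) a_meas a_int in auto)
  have Uinf: "W.Uinf = enn2real (L1sq_total u)"
    unfolding W.Uinf_def a_total[symmetric] using a_meas by (intro integral_eq_nn_integral) auto

  define w0 where "w0 \<xi> = v0 \<xi> - u 0 \<xi>" for \<xi>
  define \<delta> where "\<delta> = Xnorm (-1) w0"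
  have w0_meas [measurable]: "w0 \<in> borel_measurable borel"
    unfolding w0_def[abs_def] using v0_X(1) u_sec[of 0] by measurable
  have w0_fin: "eXnorm (-1) w0 < \<infinity>"
  proof -
    have "eXnorm (-1) w0 \<le> eXnorm (-1) v0 + eXnorm (-1) (\<lambda>\<xi>. - u 0 \<xi>)"
      using eXnorm_add_le[of v0 "\<lambda>\<xi>. - u 0 \<xi>" "-1"] v0_X(1) u_sec[of 0] by (simp add: w0_def[abs_def])
    also have "\<dots> < \<infinity>" using v0_X(2) in_X_D(2)[OF u_X[of 0]] by (simp add: eXnorm_def)
    finally show ?thesis .
  qed
  interpret ns_perturbation \<nu> a ut w0 \<delta>
  proof
    show "0 \<le> a s" for s by (simp add: a_def)
    show "AE s in lborel. 0 \<le> s \<longrightarrow> eXnorm 0 (ut s) = ennreal (a s)"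
      using u_X1
    proof eventually_elim
      case (elim s)
      show ?case
      proof
        assume s: "0 \<le> s"
        then have "eXnorm 0 (u s) < \<infinity>" using elim in_X_D(2)[OF u_X[OF s]] in_X_D(2)[of 1 "u s"] by (intro eXnorm_0_finite u_sec) auto
        then show "eXnorm 0 (ut s) = ennreal (a s)" using s by (simp add: a_def ut_eq less_top[symmetric])
      qed
    qed
    show "eXnorm (-1) w0 = ennreal \<delta>" using w0_fin by (simp add: \<delta>_def Xnorm_eq_enn2real less_top[symmetric])
    show "0 \<le> \<delta>" by (simp add: \<delta>_def Xnorm_eq_enn2real)
    have "\<delta> * exp (2 / \<nu> * W.Uinf) \<le> \<nu> / 8 * exp (- (2 / \<nu>) * W.Uinf) * exp (2 / \<nu> * W.Uinf)"
      using assms(6) unfolding Uinf \<delta>_def w0_def[abs_def] by (intro mult_right_mono) auto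
    also have "\<dots> = \<nu> / 8" by (simp add: exp_minus)
    finally show "\<delta> * exp (2 / \<nu> * W.Uinf) \<le> \<nu> / 8" .
  qed (simp_all add: ut_meas)

  obtain g where g [measurable]: "case_prod g \<in> borel_measurable (lborel \<Otimes>\<^sub>M lborel)" and Gg: "forcing_norm g \<le> ennreal \<delta>"
    and fp_s: "AE s in lborel. 0 \<le> s \<longrightarrow> (AE \<xi> in lborel. B (sol g) s \<xi> = g s \<xi>)"
    and fp_\<xi>: "AE \<xi> in lborel. AE s in lborel. 0 \<le> s \<longrightarrow> B (sol g) s \<xi> = g s \<xi>"
    by (rule fixed_point)
  define w where "w = sol g"
  define v where "v t \<xi> = u t \<xi> + w t \<xi>" for t \<xi>
  \<comment> \<open>The counterpart of \<open>ut\<close> for \<open>v\<close>: jointly measurable,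
    and equal to \<open>v\<close> at nonnegative times.\<close>
  define vt where "vt t \<xi> = ut t \<xi> + w t \<xi>" for t \<xi>
  have vt_eq: "vt t = v t" if "0 \<le> t" for t using that by (simp add: vt_def v_def ut_def fun_eq_iff)
  have Gfin: "forcing_norm g < \<infinity>" using Gg by (auto simp: less_top[symmetric] top_unique)
  have w_meas [measurable]: "case_prod w \<in> borel_measurable (lborel \<Otimes>\<^sub>M lborel)" unfolding w_def by measurable
  have wt_meas [measurable]: "w t \<in> borel_measurable borel" for t by measurable
  have vt_meas [measurable]: "case_prod vt \<in> borel_measurable (lborel \<Otimes>\<^sub>M lborel)" unfolding vt_def[abs_def] by measurable
  have v_meas: "v t \<in> borel_measurable borel" if "0 \<le> t" for t
    unfolding v_def[abs_def] using u_sec[OF that] by measurable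
  have bound: "eXnorm (-1) (w t) + ennreal (\<nu> / 2) * (\<integral>\<^sup>+s\<in>{0..t}. eXnorm 1 (w s) \<partial>lborel) \<le> ennreal (E * \<delta>)" if "0 \<le> t" for t
    unfolding w_def by (rule sol_bound[OF g Gg fp_s that])
  have dotc_add: "dotc \<xi> (x + y) = dotc \<xi> x + dotc \<xi> y" for \<xi> x y
    by (rule linear_add[OF bounded_linear.linear[OF bounded_linear_dotc]])
  have "div_free w0"
    unfolding div_free_def using assms(4)[unfolded div_free_def] u_div[of 0, unfolded div_free_def, simplified]
    by eventually_elim (simp add: w0_def linear_diff[OF bounded_linear.linear[OF bounded_linear_dotc]])
  then have w_div: "div_free (w t)" for t
    unfolding w_def by (rule sol_div_free[OF g Gfin fp_\<xi>])
  have w_m1: "eXnorm (-1) (w t) < \<infinity>" if "0 \<le> t" for t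
    using order_trans[OF _ bound[OF that], of "eXnorm (-1) (w t)"] by (auto simp: less_top[symmetric] top_unique)
  have w_1: "AE s in lborel. 0 \<le> s \<longrightarrow> eXnorm 1 (w s) < \<infinity>"
    using AE_finite_norms[OF w_meas energy_of_sol_le_ball[OF g Gg, folded w_def]] \<delta>_nonneg by auto
  have v_m1: "eXnorm (-1) (v t) < \<infinity>" if "0 \<le> t" for t
  proof -
    have "eXnorm (-1) (v t) \<le> eXnorm (-1) (u t) + eXnorm (-1) (w t)"
      unfolding v_def[abs_def] by (intro eXnorm_add_le u_sec that wt_meas)
    also have "\<dots> < \<infinity>" using in_X_D(2)[OF u_X[OF that]] w_m1[OF that] by simp
    finally show ?thesis .
  qed
  have v_1: "eXnorm 1 (v s) \<le> ennreal (Xnorm 1 (u s)) + eXnorm 1 (w s)" if "0 \<le> s" "in_X 1 (u s)" for s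
    using eXnorm_add_le[OF u_sec[OF that(1)] wt_meas, of 1 s] in_X_D(3)[OF that(2)] by (simp add: v_def[abs_def])
  have w_L1: "(\<integral>\<^sup>+s\<in>{0..T}. eXnorm 1 (w s) \<partial>lborel) < \<infinity>" if "0 \<le> T" for T
  proof -
    have "ennreal (\<nu> / 2) * (\<integral>\<^sup>+s\<in>{0..T}. eXnorm 1 (w s) \<partial>lborel) \<le> ennreal (E * \<delta>)"
      using bound[OF that] by (rule order_trans[rotated]) simp
    then show ?thesis using assms(1) by (auto simp: ennreal_mult_eq_top_iff top_unique less_top[symmetric])
  qed
  have "NS_global_solution \<nu> v"
    unfolding NS_global_solution_def
  proof (intro conjI allI impI)
    fix t :: real assume t: "0 \<le> t"
    show "in_X (-1) (v t)" by (intro in_X_I v_meas v_m1 t)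
    show "div_free (v t)"
      unfolding div_free_def
      using u_div[OF t, unfolded div_free_def] w_div[of t, unfolded div_free_def]
      by eventually_elim (simp add: v_def dotc_add)
    show "((\<lambda>s. Xnorm (-1) (\<lambda>\<xi>. v s \<xi> - v t \<xi>)) \<longlongrightarrow> 0) (at t within {0..})"
    proof (rule tendsto_sandwich[OF _ _ tendsto_const])
      show "((\<lambda>s. Xnorm (-1) (\<lambda>\<xi>. u s \<xi> - u t \<xi>) + Xnorm (-1) (\<lambda>\<xi>. w s \<xi> - w t \<xi>)) \<longlongrightarrow> 0) (at t within {0..})"
      proof -
        have "((\<lambda>s. enn2real (eXnorm (-1) (\<lambda>\<xi>. w s \<xi> - w t \<xi>))) \<longlongrightarrow> 0) (at t within {0..})"
          unfolding w_def using sol_continuous[OF g Gfin t] by (intro tendsto_enn2real) auto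
        moreover have "Xnorm (-1) (\<lambda>\<xi>. w s \<xi> - w t \<xi>) = enn2real (eXnorm (-1) (\<lambda>\<xi>. w s \<xi> - w t \<xi>))" for s
          by (rule Xnorm_eq_enn2real) measurable
        ultimately show ?thesis using tendsto_add[OF u_cont[OF t]] by fastforce
      qed
      show "\<forall>\<^sub>F s in at t within {0..}. Xnorm (-1) (\<lambda>\<xi>. v s \<xi> - v t \<xi>) \<le> Xnorm (-1) (\<lambda>\<xi>. u s \<xi> - u t \<xi>) + Xnorm (-1) (\<lambda>\<xi>. w s \<xi> - w t \<xi>)"
        unfolding eventually_at_filter
      proof (rule always_eventually, intro allI impI)
        fix s :: real assume "s \<in> {0..}"
        then have s: "0 \<le> s" by simp
        have [measurable]: "(\<lambda>\<xi>. u s \<xi> - u t \<xi>) \<in> borel_measurable borel" "(\<lambda>\<xi>. w s \<xi> - w t \<xi>) \<in> borel_measurable borel"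
          using u_sec[OF s] u_sec[OF t] by measurable
        have eq: "(\<lambda>\<xi>. v s \<xi> - v t \<xi>) = (\<lambda>\<xi>. (u s \<xi> - u t \<xi>) + (w s \<xi> - w t \<xi>))" by (simp add: v_def fun_eq_iff)
        \<comment> \<open>Since \<open>enn2real\<close> sends infinity to 0, the triangle inequality
          passes to \<open>Xnorm\<close> only once both summands are known to be finite.\<close>
        have diff_fin: "eXnorm (-1) (\<lambda>\<xi>. F \<xi> - G \<xi>) < \<infinity>"
          if "F \<in> borel_measurable borel" "G \<in> borel_measurable borel" "eXnorm (-1) F < \<infinity>" "eXnorm (-1) G < \<infinity>" for F G
        proof -
          have "eXnorm (-1) (\<lambda>\<xi>. F \<xi> - G \<xi>) \<le> eXnorm (-1) F + eXnorm (-1) (\<lambda>\<xi>. - G \<xi>)"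
            using eXnorm_add_le[of F "\<lambda>\<xi>. - G \<xi>" "-1"] that by simp
          also have "\<dots> < \<infinity>" using that by (simp add: eXnorm_def)
          finally show ?thesis .
        qed
        have fu: "eXnorm (-1) (\<lambda>\<xi>. u s \<xi> - u t \<xi>) < \<infinity>"
          by (intro diff_fin u_sec s t in_X_D(2) u_X)
        have fw: "eXnorm (-1) (\<lambda>\<xi>. w s \<xi> - w t \<xi>) < \<infinity>"
          by (intro diff_fin wt_meas w_m1 s t)
        have "enn2real (eXnorm (-1) (\<lambda>\<xi>. (u s \<xi> - u t \<xi>) + (w s \<xi> - w t \<xi>)))
          \<le> enn2real (eXnorm (-1) (\<lambda>\<xi>. u s \<xi> - u t \<xi>) + eXnorm (-1) (\<lambda>\<xi>. w s \<xi> - w t \<xi>))"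
          using fu fw by (intro enn2real_mono eXnorm_add_le) auto
        also have "\<dots> = enn2real (eXnorm (-1) (\<lambda>\<xi>. u s \<xi> - u t \<xi>)) + enn2real (eXnorm (-1) (\<lambda>\<xi>. w s \<xi> - w t \<xi>))"
          using fu fw by (intro enn2real_plus) auto
        finally show "Xnorm (-1) (\<lambda>\<xi>. v s \<xi> - v t \<xi>) \<le> Xnorm (-1) (\<lambda>\<xi>. u s \<xi> - u t \<xi>) + Xnorm (-1) (\<lambda>\<xi>. w s \<xi> - w t \<xi>)"
          unfolding eq by (simp add: Xnorm_eq_enn2real)
      qed
    qed (simp add: Xnorm_def)
    show "AE \<xi> in lborel. set_integrable lborel {0..t} (\<lambda>s. (\<nu> * (norm \<xi>)\<^sup>2) *\<^sub>R v s \<xi> + NSnonlin (v s) (v s) \<xi>)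
      \<and> v t \<xi> = v 0 \<xi> - (LINT s:{0..t}|lborel. (\<nu> * (norm \<xi>)\<^sup>2) *\<^sub>R v s \<xi> + NSnonlin (v s) (v s) \<xi>)"
      using u_eq[OF t] sol_equation[OF g Gfin t, folded w_def] fp_\<xi>
    proof eventually_elim
      case (elim \<xi>)
      define f1 where "f1 s = (\<nu> * (norm \<xi>)\<^sup>2) *\<^sub>R vt s \<xi> + NSnonlin (vt s) (vt s) \<xi>" for s
      define f2 where "f2 s = (\<nu> * (norm \<xi>)\<^sup>2) *\<^sub>R ut s \<xi> + NSnonlin (ut s) (ut s) \<xi>" for s
      define f3 where "f3 s = (\<nu> * (norm \<xi>)\<^sup>2) *\<^sub>R w s \<xi> + g s \<xi>" for s
      have NSm: "(\<lambda>s. NSnonlin (z s) (z s) \<xi>) \<in> borel_measurable borel"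
        if z: "case_prod z \<in> borel_measurable (lborel \<Otimes>\<^sub>M lborel)" for z
        using section_meas(2)[of "\<lambda>s \<xi>. NSnonlin (z s) (z s) \<xi>" \<xi>] measurable_NSnonlin[OF z z] by simp
      have [measurable]: "f1 \<in> borel_measurable borel" "f2 \<in> borel_measurable borel" "f3 \<in> borel_measurable borel"
        unfolding f1_def[abs_def] f2_def[abs_def] f3_def[abs_def] using NSm[OF vt_meas] NSm[OF ut_meas] by measurable
      have i1: "set_integrable lborel {0..t} (\<lambda>s. (\<nu> * (norm \<xi>)\<^sup>2) *\<^sub>R v s \<xi> + NSnonlin (v s) (v s) \<xi>) = set_integrable lborel {0..t} f1"
        by (intro set_integrable_cong refl) (auto simp: f1_def vt_eq)
      have e1: "(LINT s:{0..t}|lborel. (\<nu> * (norm \<xi>)\<^sup>2) *\<^sub>R v s \<xi> + NSnonlin (v s) (v s) \<xi>) = (LINT s:{0..t}|lborel. f1 s)"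
        by (intro set_lebesgue_integral_cong) (auto simp: f1_def vt_eq)
      have i2: "set_integrable lborel {0..t} f2"
        using elim(1) by (subst set_integrable_cong[OF refl refl]) (auto simp: f2_def ut_eq)
      have e2: "(LINT s:{0..t}|lborel. (\<nu> * (norm \<xi>)\<^sup>2) *\<^sub>R u s \<xi> + NSnonlin (u s) (u s) \<xi>) = (LINT s:{0..t}|lborel. f2 s)"
        by (intro set_lebesgue_integral_cong) (auto simp: f2_def ut_eq)
      have i3: "set_integrable lborel {0..t} f3" using elim(2) unfolding f3_def[abs_def] by blast
      \<comment> \<open>The fixed point equation enters: at almost every time \<open>g\<close> is
        the excess of the nonlinearity of \<open>v\<close> over that of \<open>u\<close>, so the
        equations for \<open>u\<close> and \<open>w\<close> add up to the one for
        \<open>v\<close>.\<close>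
      have ae: "AE s\<in>{0..t} in lborel. f1 s = f2 s + f3 s"
        using elim(3)
      proof eventually_elim
        case (elim s)
        show ?case
        proof
          assume "s \<in> {0..t}"
          then have "NSnonlin (vt s) (vt s) \<xi> = NSnonlin (ut s) (ut s) \<xi> + g s \<xi>"
            using elim by (auto simp: B_def w_def[symmetric] vt_def[abs_def] algebra_simps)
          then show "f1 s = f2 s + f3 s" by (simp add: f1_def f2_def f3_def vt_def algebra_simps)
        qed
      qed
      have "set_integrable lborel {0..t} (\<lambda>s. f2 s + f3 s)" by (intro set_integral_add i2 i3)
      then have "set_integrable lborel {0..t} f1"
        by (subst set_integrable_cong_AE[OF _ _ ae]) auto
      moreover have "(LINT s:{0..t}|lborel. f1 s) = (LINT s:{0..t}|lborel. f2 s) + (LINT s:{0..t}|lborel. f3 s)"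
        using set_lebesgue_integral_cong_AE[OF _ _ _ ae] set_integral_add(2)[OF i2 i3] by simp
      ultimately show ?case
        unfolding i1 e1 using elim(1,2) unfolding e2 f3_def[symmetric] by (simp add: v_def w_def sol_def[of g 0])
    qed
  next
    have "(\<lambda>x. case x of (t, \<xi>) \<Rightarrow> if 0 \<le> t then vt t \<xi> else 0) \<in> borel_measurable (lborel \<Otimes>\<^sub>M lborel)"
      by measurable
    also have "(\<lambda>x. case x of (t, \<xi>) \<Rightarrow> if 0 \<le> t then vt t \<xi> else 0) = (\<lambda>(t, \<xi>). if 0 \<le> t then v t \<xi> else 0)"
      by (auto simp: fun_eq_iff vt_eq)
    finally show "(\<lambda>(t, \<xi>). if 0 \<le> t then v t \<xi> else 0) \<in> borel_measurable (lborel \<Otimes>\<^sub>M lborel)" .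
  next
    show "AE s in lborel. 0 \<le> s \<longrightarrow> in_X 1 (v s)"
      using u_X1 w_1
    proof eventually_elim
      case (elim s)
      then show ?case using v_1[of s] by (auto intro!: in_X_I v_meas v_m1 elim!: order.strict_trans1)
    qed
  next
    fix T :: real assume T: "0 \<le> T"
    show "set_integrable lborel {0..T} (\<lambda>s. Xnorm 1 (v s))"
      unfolding set_integrable_def
    proof (rule integrableI_bounded)
      have "(\<lambda>s. indicator {0..T} s *\<^sub>R Xnorm 1 (v s)) = (\<lambda>s. indicator {0..T} s *\<^sub>R enn2real (eXnorm 1 (vt s)))"
        by (auto simp: fun_eq_iff indicator_def vt_eq v_meas Xnorm_eq_enn2real)
      also have "\<dots> \<in> borel_measurable lborel" by measurable
      finally show "(\<lambda>s. indicator {0..T} s *\<^sub>R Xnorm 1 (v s)) \<in> borel_measurable lborel" .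
      have "(\<integral>\<^sup>+s. ennreal (norm (indicator {0..T} s *\<^sub>R Xnorm 1 (v s))) \<partial>lborel)
        \<le> (\<integral>\<^sup>+s. ennreal (norm (indicator {0..T} s *\<^sub>R Xnorm 1 (u s))) + eXnorm 1 (w s) * indicator {0..T} s \<partial>lborel)"
        using u_X1
      proof (intro nn_integral_mono_AE, eventually_elim)
        case (elim s)
        show ?case
        proof (cases "s \<in> {0..T}")
          case True
          have "ennreal (Xnorm 1 (v s)) \<le> eXnorm 1 (v s)"
            using True by (simp add: Xnorm_eq_enn2real v_meas ennreal_enn2real_if)
          also have "\<dots> \<le> ennreal (Xnorm 1 (u s)) + eXnorm 1 (w s)" using elim True by (intro v_1) auto
          finally show ?thesis using True by (simp add: Xnorm_eq_enn2real v_meas)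
        qed simp
      qed
      also have "\<dots> = (\<integral>\<^sup>+s. ennreal (norm (indicator {0..T} s *\<^sub>R Xnorm 1 (u s))) \<partial>lborel) + (\<integral>\<^sup>+s\<in>{0..T}. eXnorm 1 (w s) \<partial>lborel)"
        using u_L1[OF T] by (intro nn_integral_add) (auto simp: set_integrable_def)
      also have "\<dots> < \<infinity>"
        using u_L1[OF T] w_L1[OF T] by (simp add: set_integrable_def integrable_iff_bounded)
      finally show "(\<integral>\<^sup>+s. ennreal (norm (indicator {0..T} s *\<^sub>R Xnorm 1 (v s))) \<partial>lborel) < \<infinity>" .
    qed
  qed
  moreover have "AE \<xi> in lborel. v 0 \<xi> = v0 \<xi>"
    by (simp add: v_def w_def sol_def w0_def)
  moreover have "Xnorm (-1) (\<lambda>\<xi>. v t \<xi> - u t \<xi>) + \<nu> / 2 * (LINT s:{0..t}|lborel. Xnorm 1 (\<lambda>\<xi>. v s \<xi> - u s \<xi>))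
      \<le> Xnorm (-1) (\<lambda>\<xi>. v0 \<xi> - u 0 \<xi>) * exp ((2 / \<nu>) * enn2real (L1sq_total u))" if t: "0 \<le> t" for t
  proof -
    have "Xnorm (-1) (w t) + \<nu> / 2 * (LINT s:{0..t}|lborel. Xnorm 1 (w s)) \<le> E * \<delta>"
    proof -
      have Xw: "Xnorm i (w s) = enn2real (eXnorm i (w s))" for i s by (rule Xnorm_eq_enn2real) measurable
      have "(LINT s:{0..t}|lborel. Xnorm 1 (w s)) = enn2real (\<integral>\<^sup>+s. ennreal (indicator {0..t} s *\<^sub>R Xnorm 1 (w s)) \<partial>lborel)"
        unfolding set_lebesgue_integral_def Xw by (intro integral_eq_nn_integral) auto
      \<comment> \<open>Only an inequality, since \<open>Xnorm\<close> is 0 where the extended norm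
        is infinite.\<close>
      also have "\<dots> \<le> enn2real (\<integral>\<^sup>+s\<in>{0..t}. eXnorm 1 (w s) \<partial>lborel)"
        using w_L1[OF t] by (intro enn2real_mono nn_integral_mono) (auto simp: indicator_def Xw ennreal_enn2real_if)
      finally have "Xnorm (-1) (w t) + \<nu> / 2 * (LINT s:{0..t}|lborel. Xnorm 1 (w s))
        \<le> enn2real (eXnorm (-1) (w t)) + \<nu> / 2 * enn2real (\<integral>\<^sup>+s\<in>{0..t}. eXnorm 1 (w s) \<partial>lborel)"
        using assms(1) by (simp add: Xw)
      also have "\<dots> = enn2real (eXnorm (-1) (w t) + ennreal (\<nu> / 2) * (\<integral>\<^sup>+s\<in>{0..t}. eXnorm 1 (w s) \<partial>lborel))"
        using assms(1) w_m1[OF t] w_L1[OF t] by (subst enn2real_plus) (auto simp: ennreal_mult_less_top enn2real_mult)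
      also have "\<dots> \<le> enn2real (ennreal (E * \<delta>))" by (intro enn2real_mono bound t) auto
      also have "\<dots> = E * \<delta>" using E_pos \<delta>_nonneg by simp
      finally show ?thesis .
    qed
    then show ?thesis by (simp add: v_def \<delta>_def w0_def[abs_def] E_def Uinf mult.commute)
  qed
  ultimately show ?thesis by blast
qed

end
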